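(* Let $q\in[-1,1]$ and let $\varrho(N)$, $N\in\mathbb{N}$, be a sequence of probability measures on $\hat U(N)$. Assume that there are real numbers $(a_k)_{k\ge 1}$ such that, for every $k\in\mathbb{N}$, every fixed index $i_0$ and every fixed indices $i_1,\dots,i_m$ with $|\{i_1,\dots,i_m\}|\ge 2$, \[ \lim_{N\to\infty}\partial_{i_0}^k\Big(\tfrac1N\log S_{\varrho(N)}\Big)(1^N)=a_k,\qquad \lim_{N\to\infty}\partial_{i_1}\cdots\partial_{i_m}\Big(\tfrac1N\log S_{\varrho(N)}\Big)(1^N)=0, \] and that the power series $\Psi(z)=\sum_{k\ge0}a_k\frac{(z-1)^k}{k!}$ (with any $a_0$) converges in a neighborhood of $1$. Then $m_{N,PP(q)}[\varrho(N)]$ converges as $N\to\infty$ in probability, in the sense of moments, to a deterministic probability measure $\mu^{(q)}$ on $\mathbb{R}$ with moments \[ \mu^{(q)}_k=\sum_{m=0}^k\binom km\frac1{(m+1)!}\frac{d^m}{du^m}\Big(u^{k-q}(\Psi'(u))^{k-m}\Big)\Big|_{u=1}. \] Moreover, for $q,q'\in[-1,1]$ the limits are related by the identity of formal power series in $z$ \[ \Big(1-q\sum_{k\ge0}\mu^{(q)}_kz^{k+1}\Big)^{1/q}=\Big(1-q'\sum_{k\ge0}\mu^{(q')}_kz^{k+1}\Big)^{1/q'}, \] where for $q=0$ the expression $\big(1-q\sum_k\mu^{(q)}_kz^{k+1}\big)^{1/q}$ is interpreted as $\exp\big(-\sum_k\mu^{(0)}_kz^{k+1}\big)$.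
   Context: A signature of length $N$ is a tuple $\lambda=(\lambda_1\ge\dots\ge\lambda_N)\in\mathbb{Z}^N$; $\hat U(N)$ denotes the set of signatures of length $N$. For $\lambda\in\hat U(N)$, $\chi^{\lambda}(u_1,\dots,u_N)=\det(u_i^{\lambda_j+N-j})_{i,j}/\prod_{i<j}(u_i-u_j)$ is the rational Schur function. For a probability measure $\varrho(N)$ on $\hat U(N)$, the Schur generating function is $S_{\varrho(N)}(u_1,\dots,u_N)=\sum_{\lambda\in\hat U(N)}\varrho(N)[\lambda]\,\chi^\lambda(u_1,\dots,u_N)/\chi^\lambda(1^N)$, where $1^N=(1,\dots,1)$; it is assumed that this series converges uniformly in a neighborhood of $1^N$. $\partial_i$ denotes the partial derivative in $u_i$. For $q\in[-1,1]$ and $\lambda\in\hat U(N)$ the $q$-deformed Perelomov–Popov measure is \[ m_{N,PP(q)}[\lambda]=\frac1N\sum_{i=1}^N\Big(\prod_{j\ne i}\frac{(\lambda_i-i)-(\lambda_j-j)-q}{(\lambda_i-i)-(\lambda_j-j)}\Big)\delta\Big(\frac{\lambda_i+N-i}{N}\Big), \] and $m_{N,PP(q)}[\varrho(N)]$ denotes the random measure $m_{N,PP(q)}[\lambda]$ with $\lambda$ distributed according to $\varrho(N)$. Random measures $m_N$ converge in probability in the sense of moments to a deterministic measure $\mu$ if for every $k\in\mathbb{N}$, $\int t^k m_N(dt)\to\int t^k\mu(dt)$ in probability. *)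

theory Defs
  imports "HOL-Analysis.Analysis" "HOL-Probability.Probability"
    "HOL-Computational_Algebra.Formal_Power_Series"
begin

definition signatures :: "nat \<Rightarrow> int list set" where
  "signatures N = {l. length l = N \<and> sorted_wrt (\<ge>) l}"

text \<open>Points of C^N are functions nat => complex; only coordinates 0..N-1 matter.\<close>
definition ones :: "nat \<Rightarrow> complex" where "ones = (\<lambda>_. 1)"

definition schur_num :: "int list \<Rightarrow> (nat \<Rightarrow> complex) \<Rightarrow> complex" where
  "schur_num l u = (let N = length l in
     \<Sum>p | p permutes {..<N}. of_int (sign p) *
        (\<Prod>i<N. u i powi (l ! (p i) + int N - 1 - int (p i))))"

definition vandermonde :: "nat \<Rightarrow> (nat \<Rightarrow> complex) \<Rightarrow> complex" where
  "vandermonde N u = (\<Prod>i<N. \<Prod>j\<in>{i<..<N}. (u i - u j))"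

text \<open>Rational Schur function: ratio of determinants, extended by continuity
  (limit) to points where the Vandermonde determinant vanishes (e.g. 1^N).\<close>
definition schur :: "int list \<Rightarrow> (nat \<Rightarrow> complex) \<Rightarrow> complex" where
  "schur l u = (let N = length l in
     if vandermonde N u \<noteq> 0 then schur_num l u / vandermonde N u
     else Lim (at u within {v. vandermonde N v \<noteq> 0})
              (\<lambda>v. schur_num l v / vandermonde N v))"

definition schur_term :: "int list pmf \<Rightarrow> int list \<Rightarrow> (nat \<Rightarrow> complex) \<Rightarrow> complex" where
  "schur_term \<rho> l u = complex_of_real (pmf \<rho> l) * (schur l u / schur l ones)"

definition SGF :: "int list pmf \<Rightarrow> (nat \<Rightarrow> complex) \<Rightarrow> complex" where
  "SGF \<rho> u = infsum (\<lambda>l. schur_term \<rho> l u) UNIV"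

definition pdiff :: "nat \<Rightarrow> ((nat \<Rightarrow> complex) \<Rightarrow> complex) \<Rightarrow> (nat \<Rightarrow> complex) \<Rightarrow> complex" where
  "pdiff i F = (\<lambda>u. deriv (\<lambda>t. F (u(i := t))) (u i))"

definition pdiffs :: "nat list \<Rightarrow> ((nat \<Rightarrow> complex) \<Rightarrow> complex) \<Rightarrow> (nat \<Rightarrow> complex) \<Rightarrow> complex" where
  "pdiffs is F = foldr pdiff is F"

text \<open>k-th moment of the q-deformed Perelomov--Popov measure m_{N,PP(q)}[l], N = length l
  (index i here is 0-based, i.e. paper's index i+1).\<close>
definition PP_weight :: "real \<Rightarrow> int list \<Rightarrow> nat \<Rightarrow> real" where
  "PP_weight q l i = (let N = length l in
     \<Prod>j\<in>{..<N} - {i}. (real_of_int ((l!i - int i) - (l!j - int j)) - q)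
                           / real_of_int ((l!i - int i) - (l!j - int j)))"

definition PP_moment :: "real \<Rightarrow> int list \<Rightarrow> nat \<Rightarrow> real" where
  "PP_moment q l k = (let N = length l in
     (1 / real N) * (\<Sum>i<N. PP_weight q l i *
        (real_of_int (l!i + int N - 1 - int i) / real N) ^ k))"

definition Psi' :: "(nat \<Rightarrow> real) \<Rightarrow> real \<Rightarrow> real" where
  "Psi' a u = (\<Sum>k. a (Suc k) * (u - 1) ^ k / fact k)"

definition mu_moment :: "(nat \<Rightarrow> real) \<Rightarrow> real \<Rightarrow> nat \<Rightarrow> real" where
  "mu_moment a q k = (\<Sum>m\<le>k. real (k choose m) / fact (m + 1) *
     (deriv ^^ m) (\<lambda>u. u powr (real k - q) * (Psi' a u) ^ (k - m)) 1)"

text \<open>The formal power series (1 - q sum_k mu_k z^(k+1))^(1/q), with the q = 0 convention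
  exp(- sum_k mu_k z^(k+1)).  For h with zero constant term, (1+h)^c = fps_binomial c oo h.\<close>
definition mom_fps :: "(nat \<Rightarrow> real) \<Rightarrow> real fps" where
  "mom_fps \<mu> = Abs_fps (\<lambda>n. if n = 0 then 0 else \<mu> (n - 1))"

definition PP_gen :: "real \<Rightarrow> (nat \<Rightarrow> real) \<Rightarrow> real fps" where
  "PP_gen q \<mu> = (if q = 0 then fps_exp 1 oo (- mom_fps \<mu>)
                  else fps_binomial (1 / q) oo (- (fps_const q * mom_fps \<mu>)))"

end

theory Submission
  imports Defs "HOL-Library.Multiset_Order" "HOL-Computational_Algebra.Normalized_Fraction"
    "Jordan_Normal_Form.Determinant" "HOL-Complex_Analysis.Cauchy_Integral_Formula"
begin

text \<open>
  For q = 1 the Perelomov--Popov moments are eigenvalues: the operators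
  Y_i = u_i (d_i + sum_{j ~= i} (1 - s_ij) / (u_i - u_j)), where s_ij exchanges u_i and u_j, satisfy
  (sum_i Y_i^k) chi^l = N^(k+1) p_k(l) chi^l with p_k(l) the k-th moment of m_{N,PP(1)}[l].
  Write S = exp (N F). Conjugation by S turns Y_i / N into an operator that converges
  coefficientwise as N tends to infinity, because F asymptotically splits into a sum of functions of
  one variable. Hence E p_k tends to a limit M_k and E p_k p_l to M_k M_l, and Chebyshev's inequality
  gives convergence in probability for q = 1.

  The limit satisfies 1 - sum_k M_k z^(k+1) = 1 / (1 + w) with w = z (1 + w) (1 + w Psi'(1 + w)), and
  Lagrange inversion shows (1 + w)^(-q) = 1 - q sum_k mu^(q)_k z^(k+1), which relates the limits for
  different q. For a single signature, 1 - q sum_k p^(q)_k z^(k+1) is the product over j of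
  (1 - (x_j + q) z / N) / (1 - x_j z / N), where x_j = l_j + N - j. Its logarithmic derivative
  involves only the power sums of the x_j / N, so the moments for any q are, up to terms vanishing as
  N tends to infinity, determined continuously by those for q = 1. The limit measure exists by
  Helly's theorem, since the weights are nonnegative for |q| <= 1.
\<close>

subsection \<open>Formal power series in countably many variables\<close>

text \<open>The neighbourhood on which the series converges may depend on \<open>N\<close> and
  shrink, so no uniform analytic estimate is at hand: what converges is each Taylor coefficient at
  1^N. Hence limits are taken of formal series, in one ring with infinitely many variables, so that
  coefficients for different \<open>N\<close> can be compared. A second obstacle is that 1^N lies on
  every hyperplane u_i = u_j, where differential operators conjugated by the Vandermonde determinant
  are singular. Each Y_i maps power series to power series, so evaluation at 1^N is just the
  constant term. The price is that Y_i does not preserve symmetric functions; the diagonalisation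
  therefore treats all Y_i^k chi^l, i < N, at once, as a vector whose components are exchanged by
  s_ij. This coupling produces the weights of q = 1 in the eigenvalues. After division by N the N -
  1 divided differences survive as an average, while a derivative of the argument disappears. In E
  p_k p_l the pairs of distinct indices dominate, and the limit operators in different variables act
  independently; hence the product M_k M_l.\<close>

text \<open>A multiset of indices stands for a monomial in the variables w_0, w_1, ...\<close>

typedef mfps = "UNIV :: (nat multiset \<Rightarrow> complex) set"
  morphisms coef Abs_mfps ..

lemma coef_Abs_mfps [simp]: "coef (Abs_mfps c) = c"
  by (simp add: Abs_mfps_inverse)

lemma mfps_eqI: "(\<And>M. coef f M = coef g M) \<Longrightarrow> f = g"
  by (metis coef_inject ext)

lemma finite_submultisets [simp]: "finite {A. A \<subseteq># (M :: 'a multiset)}"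
proof (rule finite_subset)
  show "{A. A \<subseteq># M} \<subseteq> mset ` {xs. set xs \<subseteq> set_mset M \<and> length xs \<le> size M}"
  proof
    fix A assume "A \<in> {A. A \<subseteq># M}"
    moreover obtain xs where "A = mset xs" by (metis ex_mset)
    ultimately show "A \<in> mset ` {xs. set xs \<subseteq> set_mset M \<and> length xs \<le> size M}"
      using set_mset_mono[of A M] size_mset_mono[of A M] by auto
  qed
qed (simp add: finite_lists_length_le)

lemma submultiset_diff_mono: "B \<subseteq># A \<Longrightarrow> A \<subseteq># M \<Longrightarrow> A - B \<subseteq># M - B \<and> M - B - (A - B) = M - A"
  by (metis diff_diff_add_mset subset_mset.add_diff_inverse subset_mset.le_diff_conv2 subset_mset.order_trans add.commute)

lemma submultiset_add_diff: "B \<subseteq># M \<Longrightarrow> C \<subseteq># M - B \<Longrightarrow> B + C \<subseteq># M"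
  by (metis add.commute subset_mset.le_diff_conv2)

lemma double_diff_mset: "A \<subseteq># M \<Longrightarrow> M - (M - A) = (A :: 'a multiset)"
  by (metis add_diff_cancel_left' subset_mset.add_diff_inverse subset_mset.diff_add)

instantiation mfps :: comm_ring_1
begin

definition zero_mfps_def: "0 = Abs_mfps (\<lambda>_. 0)"
definition one_mfps_def: "1 = Abs_mfps (\<lambda>M. if M = {#} then 1 else 0)"
definition plus_mfps_def: "f + g = Abs_mfps (\<lambda>M. coef f M + coef g M)"
definition uminus_mfps_def: "- f = Abs_mfps (\<lambda>M. - coef f M)"
definition minus_mfps_def: "f - g = Abs_mfps (\<lambda>M. coef f M - coef g M)"
definition times_mfps_def: "f * g = Abs_mfps (\<lambda>M. \<Sum>A | A \<subseteq># M. coef f A * coef g (M - A))"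

instance
proof
  fix a b c :: mfps
  show "a * b * c = a * (b * c)"
  proof (rule mfps_eqI)
    fix M
    have "coef (a * b * c) M
        = (\<Sum>(A, B)\<in>Sigma {A. A \<subseteq># M} (\<lambda>A. {B. B \<subseteq># A}). coef a B * coef b (A - B) * coef c (M - A))"
      by (simp add: times_mfps_def sum_distrib_right sum.Sigma)
    also have "\<dots> = (\<Sum>(B, C)\<in>Sigma {B. B \<subseteq># M} (\<lambda>B. {C. C \<subseteq># M - B}). coef a B * (coef b C * coef c (M - B - C)))"
      by (rule sum.reindex_bij_witness[where i = "\<lambda>(B, C). (B + C, B)" and j = "\<lambda>(A, B). (B, A - B)"])
        (auto simp: subset_mset.add_diff_inverse mult.assoc 
          dest: submultiset_diff_mono submultiset_add_diff intro: subset_mset.order_trans)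
    also have "\<dots> = coef (a * (b * c)) M"
      by (simp add: times_mfps_def sum_distrib_left sum.Sigma)
    finally show "coef (a * b * c) M = coef (a * (b * c)) M" .
  qed
  show "a * b = b * a"
  proof (rule mfps_eqI)
    fix M
    show "coef (a * b) M = coef (b * a) M"
      unfolding times_mfps_def coef_Abs_mfps
      by (rule sum.reindex_bij_witness[where i = "\<lambda>A. M - A" and j = "\<lambda>A. M - A"])
        (auto simp: double_diff_mset)
  qed
  show "1 * a = a"
  proof (rule mfps_eqI)
    fix M
    have "coef (1 * a) M = (\<Sum>A\<in>{{#}}. coef a (M - A))"
      unfolding times_mfps_def one_mfps_def coef_Abs_mfps by (rule sum.mono_neutral_cong_right) auto
    then show "coef (1 * a) M = coef a M" by simp
  qed
  show "(a + b) * c = a * c + b * c"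
    by (rule mfps_eqI) (simp add: times_mfps_def plus_mfps_def distrib_right sum.distrib)
  show "(0 :: mfps) \<noteq> 1"
    by (auto simp: zero_mfps_def one_mfps_def Abs_mfps_inject fun_eq_iff)
qed (rule mfps_eqI; simp add: zero_mfps_def plus_mfps_def uminus_mfps_def minus_mfps_def)+

end

lemma coef_simps [simp]:
  "coef 0 M = 0" "coef (f + g) M = coef f M + coef g M" "coef (- f) M = - coef f M"
  "coef (f - g) M = coef f M - coef g M"
  by (simp_all add: zero_mfps_def plus_mfps_def uminus_mfps_def minus_mfps_def)

lemma coef_one: "coef 1 M = (if M = {#} then 1 else 0)"
  by (simp add: one_mfps_def)

lemma coef_mult: "coef (f * g) M = (\<Sum>A | A \<subseteq># M. coef f A * coef g (M - A))"
  by (simp add: times_mfps_def)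

lemma coef_mult_empty [simp]: "coef (f * g) {#} = coef f {#} * coef g {#}"
  by (simp add: coef_mult)

lemma coef_sum: "coef (sum f A) M = (\<Sum>x\<in>A. coef (f x) M)"
  by (induction A rule: infinite_finite_induct) auto

text \<open>The multiset order on monomials is a well-order compatible with addition, so the least
  monomials \<open>P\<close> and \<open>Q\<close> of the factors contribute the only nonzero term at
  \<open>P + Q\<close>. Integrality allows cancelling \<open>mvar i - mvar j\<close> and
  \<open>vdm\<close>, and passing to the field of fractions.\<close>

instance mfps :: idom
proof
  fix a b :: mfps
  assume "a \<noteq> 0" "b \<noteq> 0"
  define P Q where "P = (LEAST M. coef a M \<noteq> 0)" and "Q = (LEAST M. coef b M \<noteq> 0)"
  have ex: "\<exists>M. coef c M \<noteq> 0" if "c \<noteq> 0" for c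
    using that mfps_eqI[of c 0] by auto
  have P: "coef a P \<noteq> 0" and Q: "coef b Q \<noteq> 0"
    using LeastI_ex[OF ex[OF \<open>a \<noteq> 0\<close>]] LeastI_ex[OF ex[OF \<open>b \<noteq> 0\<close>]] by (auto simp: P_def Q_def)
  have "coef (a * b) (P + Q) = (\<Sum>A\<in>{P}. coef a A * coef b (P + Q - A))"
    unfolding coef_mult
  proof (rule sum.mono_neutral_right)
    show "\<forall>A\<in>{A. A \<subseteq># P + Q} - {P}. coef a A * coef b (P + Q - A) = 0"
    proof
      fix A assume "A \<in> {A. A \<subseteq># P + Q} - {P}"
      then have A: "A \<subseteq># P + Q" and ne: "A \<noteq> P" by auto
      show "coef a A * coef b (P + Q - A) = 0"
      proof (rule ccontr)
        assume "coef a A * coef b (P + Q - A) \<noteq> 0"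
        then have "P \<le> A" "Q \<le> P + Q - A"
          by (auto simp: P_def Q_def intro: Least_le)
        moreover have "P < A" using \<open>P \<le> A\<close> ne by simp
        ultimately have "P + Q < A + (P + Q - A)" by (intro add_less_le_mono)
        then show False using A by simp
      qed
    qed
  qed auto
  then show "a * b \<noteq> 0" using P Q by (auto dest: arg_cong[where f = "\<lambda>f. coef f (P + Q)"])
qed

definition mconst :: "complex \<Rightarrow> mfps" where
  "mconst z = Abs_mfps (\<lambda>M. if M = {#} then z else 0)"

lemma coef_mconst: "coef (mconst z) M = (if M = {#} then z else 0)"
  by (simp add: mconst_def)

lemma coef_mconst_mult [simp]: "coef (mconst z * f) M = z * coef f M"
proof -
  have "coef (mconst z * f) M = (\<Sum>A\<in>{{#}}. coef (mconst z) A * coef f (M - A))"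
    unfolding coef_mult by (rule sum.mono_neutral_right) (auto simp: coef_mconst)
  then show ?thesis by (simp add: coef_mconst)
qed

lemma mconst_add: "mconst (a + b) = mconst a + mconst b" and mconst_mult: "mconst (a * b) = mconst a * mconst b"
  and mconst_diff: "mconst (a - b) = mconst a - mconst b" and mconst_uminus: "mconst (- a) = - mconst a"
  by (auto intro!: mfps_eqI simp: coef_mconst)

lemma mconst_0 [simp]: "mconst 0 = 0" and mconst_1 [simp]: "mconst 1 = 1"
  by (auto intro!: mfps_eqI simp: coef_mconst coef_one)

lemma mconst_eq_iff [simp]: "mconst a = mconst b \<longleftrightarrow> a = b"
  by (metis coef_mconst)

definition mvar :: "nat \<Rightarrow> mfps" where
  "mvar i = Abs_mfps (\<lambda>M. if M = {#i#} then 1 else 0)"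

text \<open>All expansions are at the point 1^N: the variables are w_i = u_i - 1.\<close>

abbreviation ucoord :: "nat \<Rightarrow> mfps" where "ucoord i \<equiv> 1 + mvar i"

lemma coef_mvar: "coef (mvar i) M = (if M = {#i#} then 1 else 0)"
  by (simp add: mvar_def)

lemma coef_mvar_mult: "coef (mvar i * f) M = (if i \<in># M then coef f (M - {#i#}) else 0)"
proof -
  have "coef (mvar i * f) M = (\<Sum>A\<in>(if i \<in># M then {{#i#}} else {}). coef (mvar i) A * coef f (M - A))"
    unfolding coef_mult by (rule sum.mono_neutral_right) (auto simp: coef_mvar)
  then show ?thesis by (simp add: coef_mvar)
qed

definition mderiv :: "nat \<Rightarrow> mfps \<Rightarrow> mfps" where
  "mderiv i f = Abs_mfps (\<lambda>M. of_nat (Suc (count M i)) * coef f (add_mset i M))"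

lemma coef_mderiv: "coef (mderiv i f) M = of_nat (Suc (count M i)) * coef f (add_mset i M)"
  by (simp add: mderiv_def)

lemma mderiv_add [simp]: "mderiv i (f + g) = mderiv i f + mderiv i g"
  and mderiv_diff [simp]: "mderiv i (f - g) = mderiv i f - mderiv i g"
  and mderiv_uminus [simp]: "mderiv i (- f) = - mderiv i f"
  and mderiv_0 [simp]: "mderiv i 0 = 0"
  and mderiv_mconst [simp]: "mderiv i (mconst z) = 0"
  and mderiv_mvar: "mderiv i (mvar j) = (if i = j then 1 else 0)"
  by (auto intro!: mfps_eqI simp: coef_mderiv coef_mconst coef_mvar coef_one algebra_simps)

lemma mderiv_1 [simp]: "mderiv i 1 = 0"
  using mderiv_mconst[of i 1] by simp

lemma mderiv_commute: "mderiv i (mderiv j f) = mderiv j (mderiv i f)"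
  by (rule mfps_eqI) (auto simp: coef_mderiv add_mset_commute)

lemma mderiv_mult: "mderiv i (f * g) = mderiv i f * g + f * mderiv i g"
proof (rule mfps_eqI)
  fix M
  let ?M = "add_mset i M"
  have half: "(\<Sum>A | A \<subseteq># ?M. of_nat (count A i) * coef f A * coef g (?M - A)) = coef (mderiv i f * g) M" for f g
  proof -
    have "(\<Sum>A | A \<subseteq># ?M. of_nat (count A i) * coef f A * coef g (?M - A))
        = (\<Sum>A | A \<subseteq># ?M \<and> i \<in># A. of_nat (count A i) * coef f A * coef g (?M - A))"
      by (rule sum.mono_neutral_right) (auto simp: count_eq_zero_iff)
    also have "\<dots> = (\<Sum>A | A \<subseteq># M. of_nat (Suc (count A i)) * coef f (add_mset i A) * coef g (M - A))"
      by (rule sum.reindex_bij_witness[where i = "add_mset i" and j = "\<lambda>A. A - {#i#}"])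
        (auto simp: insert_subset_eq_iff dest!: multi_member_split)
    finally show ?thesis by (simp add: coef_mult coef_mderiv)
  qed
  have "coef (mderiv i (f * g)) M = (\<Sum>A | A \<subseteq># ?M. of_nat (Suc (count M i)) * (coef f A * coef g (?M - A)))"
    by (simp add: coef_mderiv coef_mult sum_distrib_left)
  also have "\<dots> = (\<Sum>A | A \<subseteq># ?M. of_nat (count A i) * coef f A * coef g (?M - A)
      + of_nat (count (?M - A) i) * (coef f A * coef g (?M - A)))"
  proof (rule sum.cong, simp)
    fix A assume "A \<in> {A. A \<subseteq># ?M}"
    then have "count A i \<le> count ?M i" using mset_subset_eq_count[of A ?M i] by simp
    then have "(of_nat (Suc (count M i)) :: complex) = of_nat (count A i) + of_nat (count (?M - A) i)"
      unfolding of_nat_add[symmetric] by (intro arg_cong[where f = of_nat]) simp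
    then show "of_nat (Suc (count M i)) * (coef f A * coef g (?M - A)) = of_nat (count A i) * coef f A * coef g (?M - A)
      + of_nat (count (?M - A) i) * (coef f A * coef g (?M - A))"
      by (simp only: distrib_right mult.assoc)
  qed
  also have "\<dots> = coef (mderiv i f * g) M + (\<Sum>A | A \<subseteq># ?M. of_nat (count (?M - A) i) * (coef f A * coef g (?M - A)))"
    by (simp add: sum.distrib half)
  also have "(\<Sum>A | A \<subseteq># ?M. of_nat (count (?M - A) i) * (coef f A * coef g (?M - A)))
     = (\<Sum>A | A \<subseteq># ?M. of_nat (count A i) * coef g A * coef f (?M - A))"
    by (rule sum.reindex_bij_witness[where i = "\<lambda>A. ?M - A" and j = "\<lambda>A. ?M - A"])
        (auto simp: double_diff_mset)
  also have "\<dots> = coef (mderiv i g * f) M"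
    by (rule half)
  finally show "coef (mderiv i (f * g)) M = coef (mderiv i f * g + f * mderiv i g) M" by (simp add: mult.commute)
qed

section \<open>Exchange of variables and divided differences\<close>

abbreviation tr :: "nat \<Rightarrow> nat \<Rightarrow> nat \<Rightarrow> nat" where "tr \<equiv> Transposition.transpose"

definition mswap :: "nat \<Rightarrow> nat \<Rightarrow> mfps \<Rightarrow> mfps" where
  "mswap i j f = Abs_mfps (\<lambda>M. coef f (image_mset (tr i j) M))"

lemma coef_mswap: "coef (mswap i j f) M = coef f (image_mset (tr i j) M)"
  by (simp add: mswap_def)

lemma image_mset_tr_invol [simp]: "image_mset (tr i j) (image_mset (tr i j) M) = M"
  by (simp add: multiset.map_comp)

lemma mswap_add [simp]: "mswap i j (f + g) = mswap i j f + mswap i j g"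
  and mswap_diff [simp]: "mswap i j (f - g) = mswap i j f - mswap i j g"
  and mswap_uminus [simp]: "mswap i j (- f) = - mswap i j f"
  and mswap_0 [simp]: "mswap i j 0 = 0"
  and mswap_mconst [simp]: "mswap i j (mconst z) = mconst z"
  by (auto intro!: mfps_eqI simp: coef_mswap coef_mconst)

lemma mswap_1 [simp]: "mswap i j 1 = 1"
  using mswap_mconst[of i j 1] by simp

lemma mswap_sum: "mswap i j (sum f A) = (\<Sum>x\<in>A. mswap i j (f x))"
  by (induction A rule: infinite_finite_induct) auto

lemma mswap_mult [simp]: "mswap i j (f * g) = mswap i j f * mswap i j g"
proof (rule mfps_eqI)
  fix M
  let ?s = "image_mset (tr i j)"
  show "coef (mswap i j (f * g)) M = coef (mswap i j f * mswap i j g) M"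
    unfolding coef_mswap coef_mult
  proof (rule sum.reindex_bij_witness[where i = ?s and j = ?s])
    fix A assume "A \<in> {A. A \<subseteq># M}"
    then show "?s A \<in> {A. A \<subseteq># ?s M}" by (auto intro: image_mset_subseteq_mono)
  next
    fix A assume "A \<in> {A. A \<subseteq># ?s M}"
    then have "A \<subseteq># ?s M" by simp
    then have *: "?s A \<subseteq># M" using image_mset_subseteq_mono[of A "?s M" "tr i j"] by simp
    then show "?s A \<in> {A. A \<subseteq># M}" by simp
    show "coef f (?s (?s A)) * coef g (?s (M - ?s A)) = coef f A * coef g (?s M - A)"
      using * by (simp add: image_mset_Diff)
  qed auto
qed

lemma mswap_prod: "mswap i j (prod f A) = (\<Prod>x\<in>A. mswap i j (f x))"
  by (induction A rule: infinite_finite_induct) auto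

lemma image_mset_tr_eq_iff: "image_mset (tr i j) M = N \<longleftrightarrow> M = image_mset (tr i j) N"
  by auto

lemma mswap_mvar [simp]: "mswap i j (mvar k) = mvar (tr i j k)"
  by (rule mfps_eqI) (auto simp: coef_mswap coef_mvar image_mset_tr_eq_iff)

lemma count_image_tr: "count (image_mset (tr i j) M) k = count M (tr i j k)"
  by (induction M) auto

lemma mswap_mderiv: "mswap i j (mderiv k f) = mderiv (tr i j k) (mswap i j f)"
  by (rule mfps_eqI) (simp add: coef_mswap coef_mderiv count_image_tr)

text \<open>Closed form of the coefficients of (f - mswap i j f) / (u_i - u_j).\<close>

definition mddiff :: "nat \<Rightarrow> nat \<Rightarrow> mfps \<Rightarrow> mfps" where
  "mddiff i j f = Abs_mfps (\<lambda>M. \<Sum>r\<le>count M j.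
     coef (f - mswap i j f) (M + replicate_mset (Suc r) i - replicate_mset r j))"

lemma coef_mddiff: "coef (mddiff i j f) M = (\<Sum>r\<le>count M j.
     coef (f - mswap i j f) (M + replicate_mset (Suc r) i - replicate_mset r j))"
  by (simp add: mddiff_def)

text \<open>Multiplication by \<open>mvar i\<close> and by \<open>mvar j\<close> gives two copies of
  the same sum over \<open>e r\<close>, shifted by one, so that only the term at
  \<open>e 0 = M\<close> remains. If \<open>i\<close> does not occur in \<open>M\<close>, the first
  copy is absent; then the exchange maps \<open>e r\<close> to \<open>e (b - r)\<close>, and
  antisymmetry of \<open>f - mswap i j f\<close> makes the whole sum vanish.\<close>

lemma mddiff_eq:
  assumes "i \<noteq> j"
  shows "(mvar i - mvar j) * mddiff i j f = f - mswap i j f"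
proof (rule mfps_eqI)
  fix M
  define D where "D = f - mswap i j f"
  define e where "e r = M + replicate_mset r i - replicate_mset r j" for r
  define b where "b = count M j"
  have 1: "coef (mddiff i j f) (M - {#i#}) = (\<Sum>r\<le>b. coef D (e r))" if "i \<in># M"
  proof -
    have "coef (mddiff i j f) (M - {#i#}) = (\<Sum>r\<le>b. coef D (M - {#i#} + replicate_mset (Suc r) i - replicate_mset r j))"
      using assms by (simp add: coef_mddiff D_def b_def del: replicate_mset_Suc)
    also have "\<dots> = (\<Sum>r\<le>b. coef D (e r))"
      using that assms
      by (intro sum.cong refl arg_cong[where f = "coef D"])
        (auto simp: e_def multiset_eq_iff count_greater_zero_iff[symmetric] b_def simp del: count_greater_zero_iff)
    finally show ?thesis .
  qed
  have 2: "coef (mddiff i j f) (M - {#j#}) = (\<Sum>r\<in>{1..b}. coef D (e r))" if "j \<in># M"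
  proof -
    have "b > 0" using that by (simp add: b_def)
    have "coef (mddiff i j f) (M - {#j#}) = (\<Sum>r\<le>b - 1. coef D (M - {#j#} + replicate_mset (Suc r) i - replicate_mset r j))"
      using assms by (simp add: coef_mddiff D_def b_def del: replicate_mset_Suc)
    also have "\<dots> = (\<Sum>r\<le>b - 1. coef D (e (Suc r)))"
      using that assms
      by (intro sum.cong refl arg_cong[where f = "coef D"])
        (auto simp: e_def multiset_eq_iff count_greater_zero_iff[symmetric] b_def simp del: count_greater_zero_iff)
    also have "\<dots> = (\<Sum>r\<in>{1..b}. coef D (e r))"
      by (rule sum.reindex_bij_witness[where i = "\<lambda>r. r - 1" and j = Suc]) (use \<open>b > 0\<close> in auto)
    finally show ?thesis .
  qed
  have e0: "e 0 = M" by (simp add: e_def)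
  have split: "(\<Sum>r\<le>b. coef D (e r)) = coef D M + (\<Sum>r\<in>{1..b}. coef D (e r))"
    by (simp add: e0 sum.atMost_shift sum.atLeast1_atMost_eq)
  have anti: "(\<Sum>r\<le>b. coef D (e r)) = 0" if "i \<notin># M"
  proof -
    have "image_mset (tr i j) (e r) = e (b - r)" if "r \<le> b" for r
      using assms \<open>i \<notin># M\<close> that
      by (auto simp: multiset_eq_iff count_image_tr e_def b_def Transposition.transpose_def not_in_iff)
    then have "coef D (e (b - r)) = - coef D (e r)" if "r \<le> b" for r
      using that by (metis coef_simps(3,4) coef_mswap image_mset_tr_invol minus_diff_eq D_def)
    then have "(\<Sum>r\<le>b. coef D (e (b - r))) = - (\<Sum>r\<le>b. coef D (e r))"
      by (simp add: sum_negf[symmetric])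
    moreover have "(\<Sum>r\<le>b. coef D (e (b - r))) = (\<Sum>r\<le>b. coef D (e r))"
      by (rule sum.reindex_bij_witness[where i = "\<lambda>r. b - r" and j = "\<lambda>r. b - r"]) auto
    ultimately show ?thesis by simp
  qed
  have b0: "(\<Sum>r\<in>{1..b}. coef D (e r)) = 0" if "j \<notin># M"
    using that by (simp add: b_def count_eq_zero_iff)
  show "coef ((mvar i - mvar j) * mddiff i j f) M = coef (f - mswap i j f) M"
    unfolding D_def[symmetric] left_diff_distrib coef_simps coef_mvar_mult
    using 1 2 split anti b0 by (auto simp: add_eq_0_iff)
qed

lemma mvar_diff_ne_0 [simp]: "i \<noteq> j \<Longrightarrow> mvar i - mvar j \<noteq> 0"
  by (auto dest!: arg_cong[where f = "\<lambda>f. coef f {#i#}"] simp: coef_mvar)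

text \<open>Cancellation in the domain. The rules for \<open>mddiff\<close> below are obtained by
  exhibiting a quotient instead of manipulating coefficients.\<close>

lemma mddiff_unique:
  assumes "i \<noteq> j" "(mvar i - mvar j) * g = f - mswap i j f"
  shows "mddiff i j f = g"
  using mddiff_eq[OF assms(1), of f] assms mvar_diff_ne_0 mult_cancel_left by metis

lemma mswap_mddiff:
  assumes "i \<noteq> j"
  shows "mswap k l (mddiff i j f) = mddiff (tr k l i) (tr k l j) (mswap k l f)"
proof (rule mddiff_unique[symmetric])
  have ne: "tr k l i \<noteq> tr k l j" using assms by (metis transpose_involutory)
  show "tr k l i \<noteq> tr k l j" by (rule ne)
  have *: "mswap (tr k l i) (tr k l j) (mswap k l f) = mswap k l (mswap i j f)"
  proof (rule mfps_eqI)
    fix M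
    have "tr k l \<circ> tr (tr k l i) (tr k l j) = tr i j \<circ> tr k l"
      by (auto simp: fun_eq_iff Transposition.transpose_def)
    then show "coef (mswap (tr k l i) (tr k l j) (mswap k l f)) M = coef (mswap k l (mswap i j f)) M"
      by (simp add: coef_mswap multiset.map_comp)
  qed
  have "mswap k l ((mvar i - mvar j) * mddiff i j f) = mswap k l (f - mswap i j f)"
    using mddiff_eq[OF assms] by simp
  then show "(mvar (tr k l i) - mvar (tr k l j)) * mswap k l (mddiff i j f) = mswap k l f - mswap (tr k l i) (tr k l j) (mswap k l f)"
    by (simp add: *)
qed

lemma mddiff_add: "i \<noteq> j \<Longrightarrow> mddiff i j (f + g) = mddiff i j f + mddiff i j g"
  by (rule mddiff_unique) (simp_all add: distrib_left mddiff_eq)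

lemma mddiff_mult_sym: "i \<noteq> j \<Longrightarrow> mswap i j s = s \<Longrightarrow> mddiff i j (s * f) = s * mddiff i j f"
  by (rule mddiff_unique) (simp_all add: mddiff_eq mult.left_commute[of _ s] right_diff_distrib)

text \<open>Binomial series of u_i^n.\<close>

definition mpowi :: "nat \<Rightarrow> int \<Rightarrow> mfps" where
  "mpowi i n = Abs_mfps (\<lambda>M. if set_mset M \<subseteq> {i} then of_int n gchoose size M else 0)"

lemma coef_mpowi: "coef (mpowi i n) M = (if set_mset M \<subseteq> {i} then of_int n gchoose size M else 0)"
  by (simp add: mpowi_def)

lemma mpowi_1: "mpowi i 1 = ucoord i"
proof (rule mfps_eqI)
  fix M :: "nat multiset"
  consider "M = {#}" | k where "M = add_mset k {#}" | k l M' where "M = add_mset k (add_mset l M')"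
    by (metis multiset_cases)
  then show "coef (mpowi i 1) M = coef (ucoord i) M"
    by cases (auto simp: coef_mpowi coef_one coef_mvar gbinomial_Suc_Suc[of "0::complex" , simplified])
qed

lemma mderiv_mpowi: "mderiv j (mpowi i n) = (if i = j then mconst (of_int n) * mpowi i (n - 1) else 0)"
proof (rule mfps_eqI)
  fix M
  show "coef (mderiv j (mpowi i n)) M = coef (if i = j then mconst (of_int n) * mpowi i (n - 1) else 0) M"
  proof (cases "i = j \<and> set_mset M \<subseteq> {i}")
    case True
    then have "count M i = size M"
      by (metis count_replicate_mset set_mset_subset_singletonD size_replicate_mset)
    then show ?thesis using True gbinomial_absorption[of "size M" "of_int n :: complex"]
      by (auto simp: coef_mderiv coef_mpowi)
  qed (auto simp: coef_mderiv coef_mpowi)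
qed

lemma ucoord_mult_mpowi: "ucoord i * mpowi i n = mpowi i (n + 1)"
proof (rule mfps_eqI)
  fix M
  show "coef (ucoord i * mpowi i n) M = coef (mpowi i (n + 1)) M"
  proof (cases "i \<in># M")
    case True
    then obtain M' where M: "M = add_mset i M'" by (metis mset_add)
    then show ?thesis
      by (auto simp: distrib_right coef_mvar_mult coef_mpowi gbinomial_Suc_Suc)
  next
    case False
    then show ?thesis
      by (cases M) (auto simp: distrib_right coef_mvar_mult coef_mvar coef_one coef_mpowi)
  qed
qed

lemma mswap_mpowi [simp]: "mswap i j (mpowi k n) = mpowi (tr i j k) n"
  by (rule mfps_eqI) (auto simp: coef_mswap coef_mpowi image_subset_iff subset_iff) 

subsection \<open>Dunkl operators and Schur functions\<close>

text \<open>Partial fractions in t with respect to the functions t/(t - u l), all of which vanish at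
  t = 0, where the product is that of the \<eta> j. Taken at t = u_i, the formula displays how such
  a product depends on u_i.\<close>

lemma prod_partial_fraction:
  fixes u \<eta> :: "'b \<Rightarrow> 'a::field"
  assumes "finite J" "inj_on u J" "t \<notin> u ` J"
  shows "(\<Prod>j\<in>J. \<eta> j - t / (t - u j))
    = (\<Prod>j\<in>J. \<eta> j) - (\<Sum>l\<in>J. t / (t - u l) * (\<Prod>j\<in>J - {l}. \<eta> j - u l / (u l - u j)))"
  using assms
proof (induction J arbitrary: t rule: finite_induct)
  case (insert k J)
  define \<alpha> where "\<alpha> l = (\<Prod>j\<in>J - {l}. \<eta> j - u l / (u l - u j))" for l
  have IH: "(\<Prod>j\<in>J. \<eta> j - s / (s - u j)) = (\<Prod>j\<in>J. \<eta> j) - (\<Sum>l\<in>J. s / (s - u l) * \<alpha> l)"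
    if "s \<notin> u ` J" for s
    using insert.IH[OF _ that] insert.prems by (auto simp: \<alpha>_def)
  have k: "u k \<notin> u ` J" and t: "t \<notin> u ` J" "t \<noteq> u k"
    using insert.prems insert.hyps by auto
  have ins: "(\<Prod>j\<in>insert k J - {l}. \<eta> j - u l / (u l - u j)) = (\<eta> k - u l / (u l - u k)) * \<alpha> l"
    if "l \<in> J" for l
  proof -
    have "insert k J - {l} = insert k (J - {l})" using that insert.hyps by auto
    then show ?thesis using insert.hyps by (simp add: \<alpha>_def)
  qed
  \<comment> \<open>The case of two poles; the induction step only distributes this identity over
    the factors \<alpha> l.\<close>
  have key: "t / (t - u k) * (t / (t - u l))
      = t / (t - u l) * (u l / (u l - u k)) + t / (t - u k) * (u k / (u k - u l))" if "l \<in> J" for l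
  proof -
    have "t - u k \<noteq> 0" "t - u l \<noteq> 0" using t that by auto
    moreover have "u l - u k \<noteq> 0" using k that by (metis image_eqI right_minus_eq)
    moreover have "u k / (u k - u l) = - (u k / (u l - u k))"
      by (metis minus_diff_eq minus_divide_right)
    ultimately show ?thesis by (simp add: divide_simps) (simp add: algebra_simps)
  qed
  have "(\<Sum>l\<in>insert k J. t / (t - u l) * (\<Prod>j\<in>insert k J - {l}. \<eta> j - u l / (u l - u j)))
     = t / (t - u k) * (\<Prod>j\<in>J. \<eta> j - u k / (u k - u j))
       + (\<Sum>l\<in>J. t / (t - u l) * ((\<eta> k - u l / (u l - u k)) * \<alpha> l))"
    using insert.hyps by (simp add: ins)
  also have "(\<Prod>j\<in>J. \<eta> j - u k / (u k - u j)) = (\<Prod>j\<in>J. \<eta> j) - (\<Sum>l\<in>J. u k / (u k - u l) * \<alpha> l)"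
    by (rule IH[OF k])
  also have "t / (t - u k) * ((\<Prod>j\<in>J. \<eta> j) - (\<Sum>l\<in>J. u k / (u k - u l) * \<alpha> l))
       + (\<Sum>l\<in>J. t / (t - u l) * ((\<eta> k - u l / (u l - u k)) * \<alpha> l))
     = t / (t - u k) * (\<Prod>j\<in>J. \<eta> j) + (\<Sum>l\<in>J. t / (t - u l) * ((\<eta> k - u l / (u l - u k)) * \<alpha> l)
        - t / (t - u k) * (u k / (u k - u l) * \<alpha> l))"
    by (simp only: sum_subtractf right_diff_distrib sum_distrib_left) simp
  also have "(\<Sum>l\<in>J. t / (t - u l) * ((\<eta> k - u l / (u l - u k)) * \<alpha> l)
        - t / (t - u k) * (u k / (u k - u l) * \<alpha> l))
     = (\<Sum>l\<in>J. (\<eta> k - t / (t - u k)) * (t / (t - u l) * \<alpha> l))"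
  proof (rule sum.cong, rule refl)
    fix l assume "l \<in> J"
    from arg_cong[OF key[OF this], of "\<lambda>x. x * \<alpha> l"]
    show "t / (t - u l) * ((\<eta> k - u l / (u l - u k)) * \<alpha> l)
        - t / (t - u k) * (u k / (u k - u l) * \<alpha> l) = (\<eta> k - t / (t - u k)) * (t / (t - u l) * \<alpha> l)"
      by (simp only: algebra_simps)
  qed
  finally have "(\<Prod>j\<in>insert k J. \<eta> j) - (\<Sum>l\<in>insert k J. t / (t - u l) * (\<Prod>j\<in>insert k J - {l}. \<eta> j - u l / (u l - u j)))
     = \<eta> k * (\<Prod>j\<in>J. \<eta> j) - (t / (t - u k) * (\<Prod>j\<in>J. \<eta> j)
       + (\<eta> k - t / (t - u k)) * (\<Sum>l\<in>J. t / (t - u l) * \<alpha> l))"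
    using insert.hyps by (simp add: sum_distrib_left)
  also have "\<dots> = (\<eta> k - t / (t - u k)) * (\<Prod>j\<in>J. \<eta> j - t / (t - u j))"
    by (simp only: IH[OF t(1)] algebra_simps)
  finally show ?case using insert.hyps by simp
qed auto

text \<open>This is \<open>prod_partial_fraction\<close> at t = infinity, where each t/(t - u l)
  becomes 1. Over an arbitrary field there is no such limit, so the induction is repeated.\<close>

lemma sum_prod_partial_fraction:
  fixes u \<eta> :: "'b \<Rightarrow> 'a::field"
  assumes "finite J" "inj_on u J"
  shows "(\<Sum>l\<in>J. \<Prod>j\<in>J - {l}. \<eta> j - u l / (u l - u j)) = (\<Prod>j\<in>J. \<eta> j) - (\<Prod>j\<in>J. \<eta> j - 1)"
  using assms
proof (induction J rule: finite_induct)
  case (insert k J)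
  define \<alpha> where "\<alpha> l = (\<Prod>j\<in>J - {l}. \<eta> j - u l / (u l - u j))" for l
  have k: "u k \<notin> u ` J" and inj: "inj_on u J"
    using insert.prems insert.hyps by auto
  have ins: "(\<Prod>j\<in>insert k J - {l}. \<eta> j - u l / (u l - u j)) = (\<eta> k - u l / (u l - u k)) * \<alpha> l"
    if "l \<in> J" for l
  proof -
    have "insert k J - {l} = insert k (J - {l})" using that insert.hyps by auto
    then show ?thesis using insert.hyps by (simp add: \<alpha>_def)
  qed
  have key: "u l / (u l - u k) + u k / (u k - u l) = 1" if "l \<in> J" for l
  proof -
    have "u l - u k \<noteq> 0" using k that by (metis image_eqI right_minus_eq)
    moreover have "u k / (u k - u l) = - (u k / (u l - u k))"
      by (metis minus_diff_eq minus_divide_right)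
    ultimately show ?thesis by (simp flip: diff_divide_distrib)
  qed
  have "(\<Sum>l\<in>insert k J. \<Prod>j\<in>insert k J - {l}. \<eta> j - u l / (u l - u j))
     = (\<Prod>j\<in>J. \<eta> j - u k / (u k - u j)) + (\<Sum>l\<in>J. (\<eta> k - u l / (u l - u k)) * \<alpha> l)"
    using insert.hyps by (simp add: ins)
  also have "\<dots> = (\<Prod>j\<in>J. \<eta> j) + (\<Sum>l\<in>J. (\<eta> k - u l / (u l - u k)) * \<alpha> l - u k / (u k - u l) * \<alpha> l)"
    using insert.hyps prod_partial_fraction[OF insert.hyps(1) inj k, of \<eta>] by (simp add: \<alpha>_def sum_subtractf)
  also have "(\<Sum>l\<in>J. (\<eta> k - u l / (u l - u k)) * \<alpha> l - u k / (u k - u l) * \<alpha> l) = (\<Sum>l\<in>J. (\<eta> k - 1) * \<alpha> l)"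
  proof (rule sum.cong, rule refl)
    fix l assume "l \<in> J"
    have "(\<eta> k - u l / (u l - u k)) * \<alpha> l - u k / (u k - u l) * \<alpha> l
        = (\<eta> k - (u l / (u l - u k) + u k / (u k - u l))) * \<alpha> l"
      by (simp only: algebra_simps)
    then show "(\<eta> k - u l / (u l - u k)) * \<alpha> l - u k / (u k - u l) * \<alpha> l = (\<eta> k - 1) * \<alpha> l"
      using key[OF \<open>l \<in> J\<close>] by simp
  qed
  also have "\<dots> = (\<eta> k - 1) * ((\<Prod>j\<in>J. \<eta> j) - (\<Prod>j\<in>J. \<eta> j - 1))"
    using insert.IH[OF inj] by (simp add: \<alpha>_def flip: sum_distrib_left)
  finally show ?case using insert.hyps by (simp add: algebra_simps)
qed auto

text \<open>The monic polynomial with roots b j has degree \<open>card I - 1\<close>, hence equals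
  its Lagrange interpolant at the nodes x m; the sum is the leading coefficient of that interpolant.
  Its value is the same for every b.\<close>

lemma lagrange_leading_coeff:
  fixes x :: "'b \<Rightarrow> 'a::field" and b :: "'c \<Rightarrow> 'a"
  assumes "finite I" "inj_on x I" "finite J" "Suc (card J) = card I"
  shows "(\<Sum>m\<in>I. (\<Prod>j\<in>J. x m - b j) / (\<Prod>r\<in>I - {m}. x m - x r)) = 1"
proof -
  define P where "P = (\<Prod>j\<in>J. [:- b j, 1:])"
  define c where "c m = (\<Prod>j\<in>J. x m - b j) / (\<Prod>r\<in>I - {m}. x m - x r)" for m
  define B where "B m = (\<Prod>r\<in>I - {m}. [:- x r, 1:])" for m
  define L where "L = (\<Sum>m\<in>I. Polynomial.smult (c m) (B m))"
  have degB: "degree (B m) = card J" and lcB: "coeff (B m) (card J) = 1" if "m \<in> I" for m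
  proof -
    show 1: "degree (B m) = card J"
      using that assms by (simp add: B_def degree_prod_sum_eq)
    show "coeff (B m) (card J) = 1"
      unfolding 1[symmetric] by (simp add: B_def lead_coeff_prod)
  qed
  have degP: "degree P = card J" by (simp add: P_def degree_prod_sum_eq)
  have lcP: "coeff P (card J) = 1" unfolding degP[symmetric] by (simp add: P_def lead_coeff_prod)
  have degL: "degree L \<le> card J"
    unfolding L_def by (rule degree_sum_le) (use assms degB in \<open>auto intro: order_trans[OF degree_smult_le]\<close>)
  have "P = L"
  proof (rule poly_eqI_degree[where A = "x ` I"])
    fix t assume "t \<in> x ` I"
    then obtain m where m: "m \<in> I" "t = x m" by auto
    have "poly (B n) t = (if n = m then (\<Prod>r\<in>I - {m}. x m - x r) else 0)" if "n \<in> I" for n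
      using m assms(1) that by (auto simp: B_def poly_prod)
    then have "poly L t = (\<Sum>n\<in>I. if n = m then c m * (\<Prod>r\<in>I - {m}. x m - x r) else 0)"
      unfolding L_def poly_sum by (intro sum.cong) auto
    also have "\<dots> = c m * (\<Prod>r\<in>I - {m}. x m - x r)" using assms m by simp
    also have "(\<Prod>r\<in>I - {m}. x m - x r) \<noteq> 0"
      using assms(1,2) m by (auto simp: inj_on_def)
    then have "c m * (\<Prod>r\<in>I - {m}. x m - x r) = poly P t"
      using m by (simp add: c_def P_def poly_prod)
    finally show "poly P t = poly L t" by simp
  qed (use assms degP degL in \<open>auto simp: card_image\<close>)
  then have "1 = coeff L (card J)" using lcP by simp
  also have "\<dots> = (\<Sum>m\<in>I. c m)" by (simp add: L_def coeff_sum lcB)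
  finally show ?thesis by (simp add: c_def)
qed

section \<open>Derivations on the field of fractions\<close>

abbreviation emb :: "mfps \<Rightarrow> mfps fract" where "emb \<equiv> to_fract"

lemma emb_sum: "emb (sum f A) = (\<Sum>x\<in>A. emb (f x))"
  by (induction A rule: infinite_finite_induct) auto

lemma emb_prod: "emb (prod f A) = (\<Prod>x\<in>A. emb (f x))"
  by (induction A rule: infinite_finite_induct) auto

text \<open>The quotient rule applied to some chosen representative;
  \<open>fract_deriv_Fract\<close> shows that the result does not depend on the choice.\<close>

definition fract_deriv :: "nat \<Rightarrow> mfps fract \<Rightarrow> mfps fract" where
  "fract_deriv i x = (let p = (SOME p. snd p \<noteq> 0 \<and> x = Fract (fst p) (snd p)) in
     Fract (mderiv i (fst p) * snd p - fst p * mderiv i (snd p)) (snd p * snd p))"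

lemma quotient_rule_wd:
  fixes a b :: "'a::comm_ring_1"
  assumes "a * b' = a' * b" "da * b' + a * db' = da' * b + a' * db"
  shows "(da' * b' - a' * db') * (b * b) = (da * b - a * db) * (b' * b')"
proof -
  have "(da * b - a * db) * (b' * b') = b * b' * (da * b' + a * db') - b * b' * a * db' - a * b' * db * b'"
    by (simp add: algebra_simps)
  also have "\<dots> = b * b' * (da' * b + a' * db) - b * db' * (a * b') - a * b' * db * b'"
    unfolding assms(2) by (simp add: algebra_simps)
  also have "\<dots> = (da' * b' - a' * db') * (b * b)"
    unfolding assms(1) by (simp add: algebra_simps)
  finally show ?thesis by simp
qed

lemma fract_deriv_Fract:
  assumes "b \<noteq> 0"
  shows "fract_deriv i (Fract a b) = Fract (mderiv i a * b - a * mderiv i b) (b * b)"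
proof -
  define p where "p = (SOME p. snd p \<noteq> 0 \<and> Fract a b = Fract (fst p) (snd p))"
  obtain a' b' where p: "p = (a', b')" by fastforce
  have "snd p \<noteq> 0 \<and> Fract a b = Fract (fst p) (snd p)"
    unfolding p_def by (rule someI[where x = "(a, b)"]) (use assms in auto)
  then have b': "b' \<noteq> 0" and E: "a * b' = a' * b" using assms by (auto simp: p eq_fract)
  have dE: "mderiv i a * b' + a * mderiv i b' = mderiv i a' * b + a' * mderiv i b"
    using arg_cong[OF E, of "mderiv i"] by (simp add: mderiv_mult)
  have "(mderiv i a' * b' - a' * mderiv i b') * (b * b) = (mderiv i a * b - a * mderiv i b) * (b' * b')"
    by (rule quotient_rule_wd[OF E dE])
  then show ?thesis
    using assms b' unfolding fract_deriv_def p_def[symmetric] Let_def p by (simp add: eq_fract)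
qed

lemma fract_deriv_emb [simp]: "fract_deriv i (emb a) = emb (mderiv i a)"
  by (simp add: to_fract_def fract_deriv_Fract)

lemma fract_deriv_add: "fract_deriv i (x + y) = fract_deriv i x + fract_deriv i y"
proof (cases x; cases y)
  fix a b c d assume *: "x = Fract a b" "b \<noteq> 0" "y = Fract c d" "d \<noteq> 0"
  then show ?thesis
    by (simp add: fract_deriv_Fract mderiv_mult eq_fract algebra_simps)
qed

lemma fract_deriv_mult: "fract_deriv i (x * y) = fract_deriv i x * y + x * fract_deriv i y"
proof (cases x; cases y)
  fix a b c d assume *: "x = Fract a b" "b \<noteq> 0" "y = Fract c d" "d \<noteq> 0"
  then show ?thesis
    by (simp add: fract_deriv_Fract mderiv_mult eq_fract algebra_simps)
qed


context
  fixes N :: nat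
begin

text \<open>This is u_i times the rational Dunkl operator of type A with parameter 1. With this
  parameter the terms u_i/(u_i - u_j) f are exactly those of the Euler derivative of the Vandermonde
  determinant.\<close>

definition dunkl :: "nat \<Rightarrow> mfps \<Rightarrow> mfps" where
  "dunkl i f = ucoord i * (mderiv i f + (\<Sum>j\<in>{..<N} - {i}. mddiff i j f))"

lemma tr_image_lessThan: "k < N \<Longrightarrow> l < N \<Longrightarrow> i < N \<Longrightarrow> tr k l i < N"
  by (simp add: Transposition.transpose_def)

lemma mswap_dunkl:
  assumes "k < N" "l < N" "i < N"
  shows "mswap k l (dunkl i f) = dunkl (tr k l i) (mswap k l f)"
proof -
  have "(\<Sum>j\<in>{..<N} - {i}. mswap k l (mddiff i j f)) = (\<Sum>j\<in>{..<N} - {tr k l i}. mddiff (tr k l i) j (mswap k l f))"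
    by (rule sum.reindex_bij_witness[where i = "tr k l" and j = "tr k l"])
      (use assms in \<open>auto simp: mswap_mddiff tr_image_lessThan\<close>, metis transpose_involutory)
  then show ?thesis by (simp add: dunkl_def mswap_mderiv mswap_sum)
qed

lemma mswap_dunkl_pow:
  assumes "k < N" "l < N" "i < N"
  shows "mswap k l ((dunkl i ^^ n) f) = (dunkl (tr k l i) ^^ n) (mswap k l f)"
  by (induction n) (auto simp: mswap_dunkl assms tr_image_lessThan)

definition vdm :: mfps where
  "vdm = (\<Prod>i<N. \<Prod>j\<in>{i<..<N}. (ucoord i - ucoord j))"

lemma mvar_eq_iff: "mvar i = mvar j \<longleftrightarrow> i = j"
  by (metis mvar_diff_ne_0 right_minus_eq)

lemma vdm_ne_0: "vdm \<noteq> 0"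
  by (auto simp: vdm_def mvar_eq_iff)

definition symm :: "mfps \<Rightarrow> bool" where
  "symm f \<longleftrightarrow> (\<forall>i<N. \<forall>j<N. mswap i j f = f)"

definition alt :: "(nat \<Rightarrow> int) \<Rightarrow> mfps" where
  "alt x = (\<Sum>p | p permutes {..<N}. of_int (sign p) * (\<Prod>i<N. mpowi i (x (p i))))"

end

lemma symm_mswap: "symm N f \<Longrightarrow> i < N \<Longrightarrow> j < N \<Longrightarrow> mswap i j f = f"
  by (simp add: symm_def)

definition fract_coord :: "nat \<Rightarrow> mfps fract" where "fract_coord i = emb (ucoord i)"
definition fract_const :: "complex \<Rightarrow> mfps fract" where "fract_const z = emb (mconst z)"
definition fract_euler :: "nat \<Rightarrow> mfps fract \<Rightarrow> mfps fract" where "fract_euler i x = fract_coord i * fract_deriv i x"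
definition fract_ratio :: "nat \<Rightarrow> nat \<Rightarrow> mfps fract" where "fract_ratio i j = fract_coord i / (fract_coord i - fract_coord j)"

lemma fract_const_hom: "fract_const 0 = 0" "fract_const 1 = 1" "fract_const (a + b) = fract_const a + fract_const b" "fract_const (a - b) = fract_const a - fract_const b"
  "fract_const (a * b) = fract_const a * fract_const b"
  by (simp_all add: fract_const_def mconst_add mconst_diff mconst_mult)

lemma fract_const_eq_iff: "fract_const a = fract_const b \<longleftrightarrow> a = b"
  by (simp add: fract_const_def)

lemma fract_const_sum: "fract_const (sum f A) = (\<Sum>x\<in>A. fract_const (f x))"
  by (induction A rule: infinite_finite_induct) (auto simp: fract_const_hom)

lemma fract_const_prod: "fract_const (prod f A) = (\<Prod>x\<in>A. fract_const (f x))"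
  by (induction A rule: infinite_finite_induct) (auto simp: fract_const_hom)

lemma fract_const_power: "fract_const (a ^ n) = fract_const a ^ n"
  by (induction n) (auto simp: fract_const_hom)

lemma fract_const_divide: "fract_const (a / b) = fract_const a / fract_const b"
proof (cases "b = 0")
  case False
  then have "fract_const (a / b) * fract_const b = fract_const a" by (simp flip: fract_const_hom)
  moreover have "fract_const b \<noteq> 0" using False fract_const_eq_iff[of b 0] by (simp add: fract_const_hom)
  ultimately show ?thesis by (simp add: field_simps)
qed (simp add: fract_const_hom)

lemma fract_coord_eq_iff [simp]: "fract_coord i = fract_coord j \<longleftrightarrow> i = j"
  by (simp add: fract_coord_def mvar_eq_iff)

lemma fract_euler_add: "fract_euler i (x + y) = fract_euler i x + fract_euler i y"
  and fract_euler_mult: "fract_euler i (x * y) = fract_euler i x * y + x * fract_euler i y"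
  by (simp_all add: fract_euler_def fract_deriv_add fract_deriv_mult algebra_simps)

lemma fract_euler_fract_const [simp]: "fract_euler i (fract_const z) = 0"
  by (simp add: fract_euler_def fract_const_def)

lemma fract_euler_0 [simp]: "fract_euler i 0 = 0" and fract_euler_1 [simp]: "fract_euler i 1 = 0"
  using fract_euler_fract_const[of i 0] fract_euler_fract_const[of i 1] by (simp_all add: fract_const_hom)

lemma fract_euler_fract_coord: "fract_euler i (fract_coord j) = (if i = j then fract_coord i else 0)"
  by (simp add: fract_euler_def fract_coord_def mderiv_mvar del: to_fract_add to_fract_1) simp

lemma fract_euler_uminus: "fract_euler i (- x) = - fract_euler i x"
  using fract_euler_add[of i x "- x"] by (simp add: eq_neg_iff_add_eq_0 add.commute)

lemma fract_euler_diff: "fract_euler i (x - y) = fract_euler i x - fract_euler i y"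
  using fract_euler_add[of i x "- y"] by (simp add: fract_euler_uminus)

lemma fract_euler_sum: "fract_euler i (sum f A) = (\<Sum>x\<in>A. fract_euler i (f x))"
  by (induction A rule: infinite_finite_induct) (auto simp: fract_euler_add)

lemma sum_rotate: "(\<Sum>j\<in>A. \<Sum>p\<in>B. \<Sum>m\<in>C. f j p m) = (\<Sum>p\<in>B. \<Sum>m\<in>C. \<Sum>j\<in>A. f j p m)"
  by (subst sum.swap) (intro sum.cong refl sum.swap)

lemma fract_euler_prod_eq_0: "(\<And>x. x \<in> A \<Longrightarrow> fract_euler i (f x) = 0) \<Longrightarrow> fract_euler i (prod f A) = 0"
  by (induction A rule: infinite_finite_induct) (auto simp: fract_euler_mult)

lemma fract_euler_prod_log:
  "finite A \<Longrightarrow> (\<And>x. x \<in> A \<Longrightarrow> f x \<noteq> 0) \<Longrightarrow> fract_euler i (prod f A) = prod f A * (\<Sum>x\<in>A. fract_euler i (f x) / f x)"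
  by (induction A rule: finite_induct) (auto simp: fract_euler_mult field_simps)

lemma fract_ratio_add: "i \<noteq> j \<Longrightarrow> fract_ratio i j + fract_ratio j i = 1"
proof -
  assume "i \<noteq> j"
  have "fract_ratio j i = - (fract_coord j / (fract_coord i - fract_coord j))"
    unfolding fract_ratio_def by (metis minus_diff_eq minus_divide_right)
  then show ?thesis using \<open>i \<noteq> j\<close> by (simp add: fract_ratio_def flip: diff_divide_distrib)
qed

lemma fract_euler_fract_ratio:
  assumes "i \<noteq> j"
  shows "fract_euler i (fract_ratio i j) = fract_ratio i j * fract_ratio j i"
proof -
  have ne: "fract_coord i - fract_coord j \<noteq> 0" using assms by simp
  have 1: "fract_ratio i j * (fract_coord i - fract_coord j) = fract_coord i" using ne by (simp add: fract_ratio_def)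
  have "fract_euler i (fract_ratio i j) * (fract_coord i - fract_coord j) + fract_ratio i j * fract_coord i = fract_coord i"
    using arg_cong[OF 1, of "fract_euler i"] assms by (simp add: fract_euler_mult fract_euler_diff fract_euler_fract_coord)
  then have "fract_euler i (fract_ratio i j) * (fract_coord i - fract_coord j) = (1 - fract_ratio i j) * fract_coord i" by (simp add: algebra_simps)
  also have "1 - fract_ratio i j = fract_ratio j i" using fract_ratio_add[OF assms] by (simp add: algebra_simps)
  also have "fract_ratio j i * fract_coord i = fract_ratio i j * fract_ratio j i * (fract_coord i - fract_coord j)" using 1 by (simp add: mult_ac)
  finally show ?thesis using ne by simp
qed

lemma fract_euler_fract_ratio_other:
  assumes "i \<noteq> j" "i \<noteq> l"
  shows "fract_euler i (fract_ratio j l) = 0"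
proof (cases "j = l")
  case False
  then have ne: "fract_coord j - fract_coord l \<noteq> 0" by simp
  have 1: "fract_ratio j l * (fract_coord j - fract_coord l) = fract_coord j" using ne by (simp add: fract_ratio_def)
  show ?thesis using arg_cong[OF 1, of "fract_euler i"] assms ne by (simp add: fract_euler_mult fract_euler_diff fract_euler_fract_coord)
qed (simp add: fract_ratio_def)

context
  fixes N :: nat
begin

text \<open>Logarithmic differentiation. A factor u_a - u_i with a < i contributes -u_i/(u_a - u_i)
  = u_i/(u_i - u_a), so every pair containing i gives a term of the same form.\<close>

lemma fract_euler_vdm:
  assumes "i < N"
  shows "fract_euler i (emb (vdm N)) = emb (vdm N) * (\<Sum>j\<in>{..<N} - {i}. fract_ratio i j)"
proof -
  have ne: "fract_coord a - fract_coord b \<noteq> 0" if "b \<in> {a<..<N}" for a b using that by simp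
  have V: "emb (vdm N) = (\<Prod>a<N. \<Prod>b\<in>{a<..<N}. fract_coord a - fract_coord b)"
    by (simp add: vdm_def emb_prod fract_coord_def)
  have inner: "fract_euler i (\<Prod>b\<in>{a<..<N}. fract_coord a - fract_coord b) = (\<Prod>b\<in>{a<..<N}. fract_coord a - fract_coord b) *
     (\<Sum>b\<in>{a<..<N}. fract_euler i (fract_coord a - fract_coord b) / (fract_coord a - fract_coord b))" for a
    by (rule fract_euler_prod_log) (use ne in auto)
  have "fract_euler i (emb (vdm N)) = emb (vdm N) * (\<Sum>a<N. fract_euler i (\<Prod>b\<in>{a<..<N}. fract_coord a - fract_coord b) / (\<Prod>b\<in>{a<..<N}. fract_coord a - fract_coord b))"
    unfolding V by (rule fract_euler_prod_log) auto
  also have "(\<Sum>a<N. fract_euler i (\<Prod>b\<in>{a<..<N}. fract_coord a - fract_coord b) / (\<Prod>b\<in>{a<..<N}. fract_coord a - fract_coord b))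
      = (\<Sum>a<N. \<Sum>b\<in>{a<..<N}. fract_euler i (fract_coord a - fract_coord b) / (fract_coord a - fract_coord b))"
    by (intro sum.cong refl) (simp add: inner)
  also have "\<dots> = (\<Sum>a<N. \<Sum>b\<in>{a<..<N}. (if a = i then fract_ratio i b else 0) + (if b = i then fract_ratio i a else 0))"
  proof (intro sum.cong refl)
    fix a b assume "b \<in> {a<..<N}"
    then have "a \<noteq> b" by auto
    then show "fract_euler i (fract_coord a - fract_coord b) / (fract_coord a - fract_coord b) = (if a = i then fract_ratio i b else 0) + (if b = i then fract_ratio i a else 0)"
      by (auto simp: fract_euler_diff fract_euler_fract_coord fract_ratio_def) (metis minus_diff_eq minus_divide_left minus_divide_right)
  qed
  also have "\<dots> = (\<Sum>a<N. \<Sum>b\<in>{a<..<N}. if a = i then fract_ratio i b else 0) + (\<Sum>a<N. \<Sum>b\<in>{a<..<N}. if b = i then fract_ratio i a else 0)"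
    by (simp add: sum.distrib)
  also have "(\<Sum>a<N. \<Sum>b\<in>{a<..<N}. if a = i then fract_ratio i b else 0) = (\<Sum>a<N. if a = i then \<Sum>b\<in>{i<..<N}. fract_ratio i b else 0)"
    by (intro sum.cong) auto
  also have "\<dots> = (\<Sum>b\<in>{i<..<N}. fract_ratio i b)"
    using assms by simp
  also have "(\<Sum>a<N. \<Sum>b\<in>{a<..<N}. if b = i then fract_ratio i a else 0) = (\<Sum>a<N. if a < i then fract_ratio i a else 0)"
    using assms by (intro sum.cong) auto
  also have "\<dots> = (\<Sum>a<i. fract_ratio i a)"
    using assms by (intro sum.mono_neutral_cong_right) auto
  also have "(\<Sum>b\<in>{i<..<N}. fract_ratio i b) + (\<Sum>a<i. fract_ratio i a) = (\<Sum>j\<in>{..<N} - {i}. fract_ratio i j)"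
    using assms by (subst sum.union_disjoint[symmetric]) (auto intro!: sum.cong)
  finally show ?thesis .
qed

text \<open>Multiplication by \<open>vdm N\<close> absorbs the diagonal part of the divided
  differences, and what remains is the Euler derivative minus a coupling to the other components. On
  families whose members are exchanged by \<open>mswap\<close>, the operators thus act as one matrix
  operator.\<close>

lemma emb_dunkl:
  assumes f: "\<And>j. j < N \<Longrightarrow> mswap i j (f i) = f j" and i: "i < N"
  shows "emb (vdm N * dunkl N i (f i)) = fract_euler i (emb (vdm N * f i)) - (\<Sum>j\<in>{..<N} - {i}. fract_ratio i j * emb (vdm N * f j))"
proof -
  have mddiff: "emb (ucoord i * mddiff i j (f i)) = fract_ratio i j * (emb (f i) - emb (f j))" if "j \<in> {..<N} - {i}" for j
  proof -
    have "i \<noteq> j" "j < N" using that by auto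
    have "(fract_coord i - fract_coord j) * emb (mddiff i j (f i)) = emb (f i) - emb (f j)"
      using arg_cong[OF mddiff_eq[OF \<open>i \<noteq> j\<close>, of "f i"], of emb] f[OF \<open>j < N\<close>] by (simp add: fract_coord_def)
    moreover have "fract_coord i - fract_coord j \<noteq> 0" using \<open>i \<noteq> j\<close> by simp
    ultimately have "emb (mddiff i j (f i)) = (emb (f i) - emb (f j)) / (fract_coord i - fract_coord j)"
      by (simp add: field_simps)
    then show ?thesis by (simp add: fract_ratio_def fract_coord_def)
  qed
  have "emb (dunkl N i (f i)) = fract_euler i (emb (f i)) + (\<Sum>j\<in>{..<N} - {i}. fract_ratio i j * (emb (f i) - emb (f j)))"
    unfolding dunkl_def distrib_left sum_distrib_left to_fract_add emb_sum
    by (simp only: mddiff cong: sum.cong) (simp add: fract_euler_def fract_coord_def)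
  then have "emb (vdm N * dunkl N i (f i)) = emb (vdm N) * (fract_euler i (emb (f i)) + (\<Sum>j\<in>{..<N} - {i}. fract_ratio i j * (emb (f i) - emb (f j))))"
    by simp
  then show ?thesis
    by (simp add: fract_euler_mult fract_euler_vdm[OF i] algebra_simps sum_subtractf sum_distrib_left)
qed

section \<open>Spectral decomposition of the matrix operator\<close>

context
  fixes x :: "nat \<Rightarrow> int"
  assumes inj: "inj_on x {..<N}"
begin

definition fnode :: "nat \<Rightarrow> mfps fract" where "fnode m = fract_const (of_int (x m))"
definition umon :: "(nat \<Rightarrow> nat) \<Rightarrow> mfps fract" where "umon p = emb (\<Prod>i<N. mpowi i (x (p i)))"
definition eigv :: "nat \<Rightarrow> nat \<Rightarrow> (nat \<Rightarrow> nat) \<Rightarrow> mfps fract" where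
  "eigv m i p = (\<Prod>j\<in>{..<N} - {i}. fnode m - fnode (p j) - fract_ratio i j)"

lemma fnode_inj: "inj_on fnode {..<N}"
  using inj by (auto simp: inj_on_def fnode_def fract_const_eq_iff)

lemma fract_euler_umon: 
  assumes "i < N"
  shows "fract_euler i (umon p) = fnode (p i) * umon p"
proof -
  have "umon p = emb (mpowi i (x (p i))) * (\<Prod>j\<in>{..<N} - {i}. emb (mpowi j (x (p j))))"
    unfolding umon_def emb_prod using assms by (subst prod.remove[where x = i]) auto
  moreover have "fract_euler i (emb (mpowi i n)) = fract_const (of_int n) * emb (mpowi i n)" for n
    using ucoord_mult_mpowi[of i "n - 1"]
    by (simp add: fract_euler_def mderiv_mpowi fract_const_def fract_coord_def mult.left_commute flip: to_fract_mult to_fract_add to_fract_1)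
  moreover have "fract_euler i (\<Prod>j\<in>{..<N} - {i}. emb (mpowi j (x (p j)))) = 0"
    by (rule fract_euler_prod_eq_0) (auto simp: fract_euler_def mderiv_mpowi)
  ultimately show ?thesis by (simp add: fract_euler_mult fnode_def)
qed

text \<open>The vectors with components eigv m i p * umon p are eigenvectors, with eigenvalue fnode m, of the matrix
  operator that dunkl induces on antisymmetric functions.\<close>

lemma eigv_eigen:
  assumes p: "p permutes {..<N}" and m: "m < N" and i: "i < N"
  shows "fract_euler i (eigv m i p * umon p) - (\<Sum>l\<in>{..<N} - {i}. fract_ratio i l * (eigv m l p * umon p)) = fnode m * (eigv m i p * umon p)"
proof -
  define \<eta> where "\<eta> j = fnode m - fnode (p j)" for j
  define J where "J = {..<N} - {i}"
  define \<alpha> where "\<alpha> l = (\<Prod>j\<in>J - {l}. \<eta> j - fract_ratio l j)" for l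
  have "inj fract_coord" by (simp add: inj_on_def)
  have "fract_coord i \<notin> fract_coord ` J" by (auto simp: J_def)
  \<comment> \<open>All dependence on u_i is moved into the factors \<open>fract_ratio i l\<close>,
    since \<alpha> l does not contain u_i.\<close>
  then have G1: "eigv m i p = prod \<eta> J - (\<Sum>l\<in>J. fract_ratio i l * \<alpha> l)"
    using prod_partial_fraction[of J fract_coord "fract_coord i" \<eta>] \<open>inj fract_coord\<close>
    by (auto simp: eigv_def J_def \<alpha>_def \<eta>_def fract_ratio_def inj_on_subset)
  have G2: "eigv m l p = (\<eta> i - fract_ratio l i) * \<alpha> l" if "l \<in> J" for l
  proof -
    have "{..<N} - {l} = insert i (J - {l})" using that i by (auto simp: J_def)
    then show ?thesis using that by (simp add: eigv_def \<eta>_def \<alpha>_def J_def)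
  qed
  have d\<eta>: "fract_euler i (\<eta> j) = 0" for j by (simp add: \<eta>_def fnode_def fract_euler_diff)
  have d\<alpha>: "fract_euler i (\<alpha> l) = 0" if "l \<in> J" for l
    unfolding \<alpha>_def by (rule fract_euler_prod_eq_0) (use that in \<open>auto simp: fract_euler_diff d\<eta> fract_euler_fract_ratio_other J_def\<close>)
  have "fract_euler i (eigv m i p) = - (\<Sum>l\<in>J. fract_ratio i l * fract_ratio l i * \<alpha> l)"
    unfolding G1 by (simp add: fract_euler_diff fract_euler_sum fract_euler_mult d\<alpha> fract_euler_prod_eq_0 d\<eta> cong: sum.cong)
      (intro sum.cong refl, auto simp: J_def fract_euler_fract_ratio)
  moreover have "(\<Sum>l\<in>J. fract_ratio i l * eigv m l p) = \<eta> i * (\<Sum>l\<in>J. fract_ratio i l * \<alpha> l) - (\<Sum>l\<in>J. fract_ratio i l * fract_ratio l i * \<alpha> l)"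
    by (simp add: G2 sum_distrib_left sum_subtractf[symmetric] algebra_simps cong: sum.cong)
  ultimately have "fract_euler i (eigv m i p) - (\<Sum>l\<in>J. fract_ratio i l * eigv m l p) = - \<eta> i * (\<Sum>l\<in>J. fract_ratio i l * \<alpha> l)"
    by simp
  also have "\<dots> = \<eta> i * eigv m i p - (\<eta> i * prod \<eta> J)" by (simp add: G1 algebra_simps)
  also have "\<eta> i * prod \<eta> J = prod \<eta> {..<N}"
    unfolding J_def using i by (subst prod.remove[symmetric]) auto
  \<comment> \<open>A permutation \<open>p\<close> takes the value \<open>m\<close> somewhere, so
    one factor vanishes. This removes the inhomogeneous term and leaves an eigenvector
    equation.\<close>
  also have "\<dots> = 0"
  proof -
    obtain j where "j < N" "p j = m" using p m by (metis lessThan_iff permutes_inverses(1) permutes_in_image permutes_inv)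
    then show ?thesis by (auto simp: \<eta>_def intro!: prod_zero)
  qed
  finally have "fract_euler i (eigv m i p) - (\<Sum>l\<in>J. fract_ratio i l * eigv m l p) = \<eta> i * eigv m i p" by simp
  then have "(fract_euler i (eigv m i p) - (\<Sum>l\<in>J. fract_ratio i l * eigv m l p)) * umon p = \<eta> i * eigv m i p * umon p" by simp
  then show ?thesis
    by (simp add: fract_euler_mult fract_euler_umon[OF i] \<eta>_def algebra_simps sum_distrib_left J_def)
qed

definition lagw :: "nat \<Rightarrow> mfps fract" where
  "lagw m = 1 / (\<Prod>r\<in>{..<N} - {m}. fnode m - fnode r)"

text \<open>The constant vector is the combination of the eigenvectors with the Lagrange
  coefficients \<open>lagw m\<close>: each \<open>eigv m i p\<close> is a monic polynomial in the
  node \<open>fnode m\<close>, with roots \<open>fnode (p j) + fract_ratio i j\<close>.\<close>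

lemma sum_lagw_G: "i < N \<Longrightarrow> (\<Sum>m<N. lagw m * eigv m i p) = 1"
  using lagrange_leading_coeff[of "{..<N}" fnode "{..<N} - {i}" "\<lambda>j. fnode (p j) + fract_ratio i j"] fnode_inj
  by (simp add: lagw_def eigv_def diff_diff_eq)

text \<open>This is where the weights of q = 1 originate. Of the two products in
  \<open>sum_prod_partial_fraction\<close> the first vanishes, since \<open>p\<close> hits
  \<open>m\<close>, and the second has its factors lowered by 1; neither contains the variables any
  more.\<close>

lemma sum_eigv:
  assumes p: "p permutes {..<N}" and m: "m < N"
  shows "(\<Sum>i<N. eigv m i p) = (\<Prod>r\<in>{..<N} - {m}. fnode m - fnode r - 1)"
proof -
  obtain s where s: "s < N" "p s = m" using p m by (metis lessThan_iff permutes_inverses(1) permutes_in_image permutes_inv)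
  have "(\<Sum>i<N. eigv m i p) = (\<Prod>j<N. fnode m - fnode (p j)) - (\<Prod>j<N. fnode m - fnode (p j) - 1)"
    using sum_prod_partial_fraction[of "{..<N}" fract_coord "\<lambda>j. fnode m - fnode (p j)"]
    by (simp add: eigv_def fract_ratio_def inj_on_def)
  also have "(\<Prod>j<N. fnode m - fnode (p j)) = 0" using s by (auto intro!: prod_zero)
  also have "(\<Prod>j<N. fnode m - fnode (p j) - 1) = (\<Prod>j<N. fnode m - fnode j - 1)"
    using prod.permute[OF p, of "\<lambda>j. fnode m - fnode j - 1"] by (simp add: o_def)
  also have "\<dots> = - (\<Prod>r\<in>{..<N} - {m}. fnode m - fnode r - 1)"
    using m by (subst prod.remove[where x = m]) auto
  finally show ?thesis by simp
qed

lemma emb_alt: "emb (alt N x) = (\<Sum>p | p permutes {..<N}. of_int (sign p) * umon p)"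
proof -
  have "emb (of_int (sign p)) = of_int (sign p)" for p :: "nat \<Rightarrow> nat"
    by (cases rule: sign_cases[of p]) simp_all
  then show ?thesis by (simp add: alt_def emb_sum umon_def)
qed

text \<open>At k = 0 the vector (Q, ..., Q) is expanded in eigenvectors, and each application
  multiplies the m-th part by \<open>fnode m\<close>. Component i of the next power involves all
  components of the previous one, so the induction runs over all i together; symmetry of
  \<open>Q\<close> supplies the exchange relation required by \<open>emb_dunkl\<close>.\<close>

lemma emb_dunkl_pow:
  assumes Q: "symm N Q" "vdm N * Q = alt N x" and i: "i < N"
  shows "emb (vdm N * (dunkl N i ^^ k) Q)
    = (\<Sum>p | p permutes {..<N}. \<Sum>m<N. of_int (sign p) * (lagw m * fnode m ^ k) * (eigv m i p * umon p))"
  using i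
proof (induction k arbitrary: i)
  case 0
  have "(\<Sum>m<N. of_int (sign p) * lagw m * (eigv m i p * umon p)) = of_int (sign p) * (\<Sum>m<N. lagw m * eigv m i p) * umon p" for p
    by (simp add: sum_distrib_left sum_distrib_right mult_ac)
  then show ?case using sum_lagw_G[OF 0] by (simp add: Q(2) emb_alt)
next
  case (Suc k)
  note i = \<open>i < N\<close>
  let ?P = "{p. p permutes {..<N}}"
  let ?c = "\<lambda>p m. of_int (sign p) * (lagw m * fnode m ^ k)"
  have dc: "fract_euler i (?c p m * z) = ?c p m * fract_euler i z" for p m z
  proof -
    have fnk: "fnode m ^ k = fract_const (of_int (x m) ^ k)" by (simp add: fnode_def fract_const_power)
    have lagwk: "lagw m = fract_const (1 / (\<Prod>r\<in>{..<N} - {m}. of_int (x m) - of_int (x r)))"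
      by (simp add: lagw_def fract_const_divide fract_const_prod fract_const_hom fnode_def)
    have "of_int (sign p) = fract_const (of_int (sign p))"
      by (cases rule: sign_cases[of p]) (simp_all add: fract_const_def mconst_uminus)
    then show ?thesis unfolding fnk lagwk by (simp only: fract_const_hom(5)[symmetric] fract_euler_mult fract_euler_fract_const) simp
  qed
  have "emb (vdm N * dunkl N i ((dunkl N i ^^ k) Q))
     = fract_euler i (emb (vdm N * (dunkl N i ^^ k) Q)) - (\<Sum>j\<in>{..<N} - {i}. fract_ratio i j * emb (vdm N * (dunkl N j ^^ k) Q))"
    by (rule emb_dunkl) (use i Q(1) in \<open>auto simp: mswap_dunkl_pow symm_mswap\<close>)
  also have "\<dots> = (\<Sum>p\<in>?P. \<Sum>m<N. ?c p m * fract_euler i (eigv m i p * umon p))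
     - (\<Sum>j\<in>{..<N} - {i}. fract_ratio i j * (\<Sum>p\<in>?P. \<Sum>m<N. ?c p m * (eigv m j p * umon p)))"
    using Suc.IH i by (simp add: fract_euler_sum dc del: to_fract_mult)
  also have "(\<Sum>j\<in>{..<N} - {i}. fract_ratio i j * (\<Sum>p\<in>?P. \<Sum>m<N. ?c p m * (eigv m j p * umon p)))
     = (\<Sum>p\<in>?P. \<Sum>m<N. ?c p m * (\<Sum>j\<in>{..<N} - {i}. fract_ratio i j * (eigv m j p * umon p)))"
    unfolding sum_distrib_left
    by (subst sum_rotate) (intro sum.cong refl, simp add: mult_ac)
  also have "(\<Sum>p\<in>?P. \<Sum>m<N. ?c p m * fract_euler i (eigv m i p * umon p)) - \<dots>
     = (\<Sum>p\<in>?P. \<Sum>m<N. ?c p m * (fract_euler i (eigv m i p * umon p) - (\<Sum>j\<in>{..<N} - {i}. fract_ratio i j * (eigv m j p * umon p))))"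
    by (simp add: sum_subtractf right_diff_distrib)
  also have "\<dots> = (\<Sum>p\<in>?P. \<Sum>m<N. ?c p m * (fnode m * (eigv m i p * umon p)))"
    by (intro sum.cong refl) (simp add: eigv_eigen i)
  finally show ?case by (simp add: mult_ac)
qed

text \<open>Summing over the components frees the coefficients of their dependence on the
  permutation, by \<open>sum_eigv\<close>, so the signed monomials reassemble to the alternant,
  which is \<open>vdm N * Q\<close>.\<close>

theorem sum_dunkl_pow_eigen:
  assumes Q: "symm N Q" "vdm N * Q = alt N x"
  shows "(\<Sum>i<N. (dunkl N i ^^ k) Q) = mconst (\<Sum>m<N. (\<Prod>r\<in>{..<N} - {m}.
     (of_int (x m - x r) - 1) / of_int (x m - x r)) * of_int (x m) ^ k) * Q" (is "_ = mconst ?E * Q")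
proof -
  let ?P = "{p. p permutes {..<N}}"
  have E: "fract_const ?E = (\<Sum>m<N. lagw m * fnode m ^ k * (\<Prod>r\<in>{..<N} - {m}. fnode m - fnode r - 1))"
    by (simp add: fract_const_sum fract_const_prod fract_const_hom fract_const_divide fract_const_power fnode_def lagw_def prod_dividef mult_ac)
  have "emb (vdm N * (\<Sum>i<N. (dunkl N i ^^ k) Q)) = (\<Sum>i<N. emb (vdm N * (dunkl N i ^^ k) Q))"
    by (simp only: sum_distrib_left emb_sum)
  also have "\<dots> = (\<Sum>i<N. \<Sum>p\<in>?P. \<Sum>m<N. of_int (sign p) * (lagw m * fnode m ^ k) * (eigv m i p * umon p))"
    using emb_dunkl_pow[OF Q] by simp
  also have "\<dots> = (\<Sum>p\<in>?P. \<Sum>m<N. of_int (sign p) * (lagw m * fnode m ^ k) * ((\<Sum>i<N. eigv m i p) * umon p))"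
    unfolding sum_distrib_left sum_distrib_right by (rule sum_rotate)
  also have "\<dots> = (\<Sum>p\<in>?P. \<Sum>m<N. of_int (sign p) * (lagw m * fnode m ^ k) * ((\<Prod>r\<in>{..<N} - {m}. fnode m - fnode r - 1) * umon p))"
    by (intro sum.cong refl) (simp add: sum_eigv)
  also have "\<dots> = fract_const ?E * emb (alt N x)"
    unfolding E emb_alt sum_distrib_left sum_distrib_right
    by (intro sum.cong refl) (simp add: mult_ac)
  also have "\<dots> = emb (vdm N * (mconst ?E * Q))"
    unfolding Q(2)[symmetric] by (simp add: fract_const_def mult_ac)
  finally show ?thesis using vdm_ne_0[of N] by (simp del: to_fract_mult)
qed

end
end

subsection \<open>Asymptotics of the conjugated operators\<close>

text \<open>With g i = d_i F, this is the conjugate of dunkl N i / N by exp (N F).\<close>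

definition dunkl_conj :: "nat \<Rightarrow> (nat \<Rightarrow> mfps) \<Rightarrow> nat \<Rightarrow> mfps \<Rightarrow> mfps" where
  "dunkl_conj N g i f = ucoord i * (g i * f + mconst (1 / of_nat N) * (mderiv i f + (\<Sum>j\<in>{..<N} - {i}. mddiff i j f)))"

lemma mderiv_mconst_mult [simp]: "mderiv i (mconst z * f) = mconst z * mderiv i f"
  by (simp add: mderiv_mult)

lemma mddiff_mconst_mult: "i \<noteq> j \<Longrightarrow> mddiff i j (mconst z * f) = mconst z * mddiff i j f"
  by (rule mddiff_mult_sym) auto

lemma dunkl_mconst_mult: "dunkl N i (mconst z * f) = mconst z * dunkl N i f"
proof -
  have "(\<Sum>j\<in>{..<N} - {i}. mddiff i j (mconst z * f)) = mconst z * (\<Sum>j\<in>{..<N} - {i}. mddiff i j f)"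
    unfolding sum_distrib_left by (rule sum.cong) (auto simp: mddiff_mconst_mult)
  then show ?thesis by (simp add: dunkl_def distrib_left mult.left_commute)
qed

text \<open>A symmetric \<open>S\<close> passes through the divided differences, and its derivative
  contributes N g S. Extracting the factor N leaves 1/N in front of everything that acts on
  \<open>f\<close>.\<close>

lemma dunkl_mult_exp:
  assumes "symm N S" "mderiv i S = mconst (of_nat N) * (g i * S)" "i < N"
  shows "dunkl N i (S * f) = mconst (of_nat N) * (S * dunkl_conj N g i f)"
proof -
  have "(\<Sum>j\<in>{..<N} - {i}. mddiff i j (S * f)) = S * (\<Sum>j\<in>{..<N} - {i}. mddiff i j f)"
    unfolding sum_distrib_left by (rule sum.cong) (use assms in \<open>auto intro!: mddiff_mult_sym simp: symm_mswap\<close>)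
  moreover have "mconst (of_nat N) * mconst (1 / of_nat N) = 1"
    using assms(3) by (simp flip: mconst_mult)
  moreover have "mconst (of_nat N) * (S * dunkl_conj N g i f) = ucoord i * (mconst (of_nat N) * (g i * S) * f
      + S * ((mconst (of_nat N) * mconst (1 / of_nat N)) * (mderiv i f + (\<Sum>j\<in>{..<N} - {i}. mddiff i j f))))"
    unfolding dunkl_conj_def by (simp only: distrib_left mult_ac)
  ultimately show ?thesis
    by (simp add: dunkl_def mderiv_mult assms(2) distrib_left)
qed

lemma dunkl_pow_mult_exp:
  assumes "symm N S" "mderiv i S = mconst (of_nat N) * (g i * S)" "i < N"
  shows "(dunkl N i ^^ k) (mconst z * (S * f)) = mconst (z * of_nat N ^ k) * (S * (dunkl_conj N g i ^^ k) f)"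
proof (induction k)
  case (Suc k)
  have "dunkl N i (mconst w * (S * h)) = mconst (w * of_nat N) * (S * dunkl_conj N g i h)" for w h
    by (simp only: dunkl_mconst_mult dunkl_mult_exp[where g = g, OF assms] mconst_mult mult.assoc)
  with Suc show ?case by (simp add: mult.assoc mult.commute[of "of_nat N"])
qed simp

lemma mswap_dunkl_conj:
  assumes "a < N" "b < N" "i < N" and g: "mswap a b (g i) = g (tr a b i)"
  shows "mswap a b (dunkl_conj N g i f) = dunkl_conj N g (tr a b i) (mswap a b f)"
proof -
  have "(\<Sum>j\<in>{..<N} - {i}. mswap a b (mddiff i j f)) = (\<Sum>j\<in>{..<N} - {tr a b i}. mddiff (tr a b i) j (mswap a b f))"
    by (rule sum.reindex_bij_witness[where i = "tr a b" and j = "tr a b"])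
      (use assms in \<open>auto simp: mswap_mddiff tr_image_lessThan\<close>, metis transpose_involutory)
  then show ?thesis by (simp add: dunkl_conj_def mswap_mderiv mswap_sum g)
qed

lemma mswap_dunkl_conj_pow:
  assumes "a < N" "b < N" "i < N" and g: "\<And>i. i < N \<Longrightarrow> mswap a b (g i) = g (tr a b i)"
  shows "mswap a b ((dunkl_conj N g i ^^ n) f) = (dunkl_conj N g (tr a b i) ^^ n) (mswap a b f)"
  by (induction n) (auto simp: mswap_dunkl_conj assms)

definition coef_lim :: "(nat \<Rightarrow> mfps) \<Rightarrow> mfps \<Rightarrow> bool" where
  "coef_lim G h \<longleftrightarrow> (\<forall>M. (\<lambda>N. coef (G N) M) \<longlonglongrightarrow> coef h M)"

lemma coef_limD: "coef_lim G h \<Longrightarrow> (\<lambda>N. coef (G N) M) \<longlonglongrightarrow> coef h M"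
  by (simp add: coef_lim_def)

lemma coef_lim_const: "coef_lim (\<lambda>_. h) h"
  by (simp add: coef_lim_def)

lemma coef_lim_add: "coef_lim G h \<Longrightarrow> coef_lim G' h' \<Longrightarrow> coef_lim (\<lambda>N. G N + G' N) (h + h')"
  by (auto simp: coef_lim_def intro: tendsto_add)

lemma coef_lim_mult: "coef_lim G h \<Longrightarrow> coef_lim G' h' \<Longrightarrow> coef_lim (\<lambda>N. G N * G' N) (h * h')"
  by (auto simp: coef_lim_def coef_mult intro!: tendsto_sum tendsto_mult)

text \<open>This is (h - h|_{w_i = 0}) / w_i. It is what a divided difference in u_i and u_j becomes
  at w_j = 0 when h does not depend on w_j.\<close>

definition shift :: "nat \<Rightarrow> mfps \<Rightarrow> mfps" where
  "shift i h = Abs_mfps (\<lambda>M. coef h (add_mset i M))"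

lemma coef_shift: "coef (shift i h) M = coef h (add_mset i M)"
  by (simp add: shift_def)

definition supp_on :: "nat set \<Rightarrow> mfps \<Rightarrow> bool" where
  "supp_on A h \<longleftrightarrow> (\<forall>M. coef h M \<noteq> 0 \<longrightarrow> set_mset M \<subseteq> A)"

lemma supp_on_add: "supp_on A f \<Longrightarrow> supp_on A g \<Longrightarrow> supp_on A (f + g)"
  unfolding supp_on_def
proof (intro allI impI)
  fix M
  assume *: "\<forall>M. coef f M \<noteq> 0 \<longrightarrow> set_mset M \<subseteq> A" "\<forall>M. coef g M \<noteq> 0 \<longrightarrow> set_mset M \<subseteq> A" "coef (f + g) M \<noteq> 0"
  then have "coef f M \<noteq> 0 \<or> coef g M \<noteq> 0" by auto
  with * show "set_mset M \<subseteq> A" by blast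
qed

lemma supp_on_mult:
  assumes "supp_on A f" "supp_on A g"
  shows "supp_on A (f * g)"
  unfolding supp_on_def
proof (intro allI impI)
  fix M assume "coef (f * g) M \<noteq> 0"
  then have "(\<Sum>B | B \<subseteq># M. coef f B * coef g (M - B)) \<noteq> 0" by (simp add: coef_mult)
  then obtain B where "B \<in> {B. B \<subseteq># M}" "coef f B * coef g (M - B) \<noteq> 0"
    by (rule sum.not_neutral_contains_not_neutral)
  then have B: "B \<subseteq># M" "coef f B \<noteq> 0" "coef g (M - B) \<noteq> 0" by auto
  then have "set_mset B \<subseteq> A" "set_mset (M - B) \<subseteq> A" using assms by (auto simp: supp_on_def)
  moreover have "set_mset M = set_mset B \<union> set_mset (M - B)"
    using B(1) by (metis set_mset_union subset_mset.add_diff_inverse)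
  ultimately show "set_mset M \<subseteq> A" by simp
qed

lemma supp_on_shift: "supp_on A f \<Longrightarrow> supp_on A (shift i f)"
  unfolding supp_on_def coef_shift by (metis insert_subset set_mset_add_mset_insert)

lemma supp_on_1: "supp_on A 1" and supp_on_mvar: "i \<in> A \<Longrightarrow> supp_on A (mvar i)"
  by (auto simp: supp_on_def coef_one coef_mvar split: if_splits)

text \<open>The limit of \<open>dunkl_conj\<close>: a single derivative disappears under the factor
  1/N, while the average of the divided differences tends to \<open>shift i h\<close>.\<close>

definition dunkl_lim :: "(nat \<Rightarrow> mfps) \<Rightarrow> nat \<Rightarrow> mfps \<Rightarrow> mfps" where
  "dunkl_lim \<psi> i h = ucoord i * (\<psi> i * h + shift i h)"

text \<open>By symmetry all but finitely many of the divided differences have the same coefficient,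
  so that the average of N of them converges.\<close>

lemma coef_lim_average_mddiff:
  assumes A: "finite A" "i \<in> A" and G: "coef_lim G h" and h: "supp_on A h"
    and sym: "\<And>N a b. a < N \<Longrightarrow> b < N \<Longrightarrow> a \<notin> A \<Longrightarrow> b \<notin> A \<Longrightarrow> mswap a b (G N) = G N"
  shows "coef_lim (\<lambda>N. mconst (1 / of_nat N) * (mderiv i (G N) + (\<Sum>j\<in>{..<N} - {i}. mddiff i j (G N)))) (shift i h)"
  unfolding coef_lim_def
proof
  fix M
  define B where "B = A \<union> set_mset M"
  have "finite B" using A by (simp add: B_def)
  then obtain s where s: "s \<notin> B" using ex_new_if_finite[of B] infinite_UNIV_nat by blast
  obtain N0 where N0: "\<And>b. b \<in> insert s B \<Longrightarrow> b < N0"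
    using \<open>finite B\<close> finite_nat_set_iff_bounded[of "insert s B"] by auto
  \<comment> \<open>The common value of the coefficient at \<open>M\<close> for all j outside
    \<open>B\<close>, expressed through one representative s. Its second term tends to 0, because h
    does not involve w_s.\<close>
  define c where "c N = coef (G N) (add_mset i M) - coef (G N) (image_mset (tr i s) (add_mset i M))" for N
  have inv0: "(\<lambda>N. 1 / of_nat N :: complex) \<longlonglongrightarrow> 0"
    using lim_inverse_n[where 'a = complex] by (simp add: divide_inverse)
  have fresh: "coef (mddiff i j (G N)) M = c N" if "j < N" "j \<notin> B" "N \<ge> N0" for j N
  proof -
    have "i \<noteq> j" "j \<notin># M" "j \<notin> A" "s \<notin># M" "s \<notin> A" "s < N" "s \<noteq> i"
      using that A s N0[of s] by (auto simp: B_def)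
    have "image_mset (tr i j) (add_mset i M) = image_mset (tr j s) (image_mset (tr i s) (add_mset i M))"
      unfolding multiset.map_comp
      by (rule image_mset_cong) (use \<open>j \<notin># M\<close> \<open>s \<notin># M\<close> \<open>i \<noteq> j\<close> \<open>s \<noteq> i\<close> in \<open>auto simp: Transposition.transpose_def\<close>)
    then have "coef (G N) (image_mset (tr i j) (add_mset i M)) = coef (mswap j s (G N)) (image_mset (tr i s) (add_mset i M))"
      by (simp add: coef_mswap)
    also have "mswap j s (G N) = G N"
      using sym[of j N s] that \<open>j \<notin> A\<close> \<open>s < N\<close> \<open>s \<notin> A\<close> by simp
    finally show ?thesis using \<open>j \<notin># M\<close> by (simp add: coef_mddiff c_def coef_mswap not_in_iff)
  qed
  have c: "c \<longlonglongrightarrow> coef h (add_mset i M)"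
  proof -
    have "coef h (image_mset (tr i s) (add_mset i M)) = 0"
      using h s by (auto simp: supp_on_def B_def)
    then show ?thesis using tendsto_diff[OF coef_limD[OF G, of "add_mset i M"] coef_limD[OF G, of "image_mset (tr i s) (add_mset i M)"]]
      by (simp add: c_def[abs_def])
  qed
  have ddl: "(\<lambda>N. coef (mddiff i j (G N)) M) \<longlonglongrightarrow> coef (mddiff i j h) M" for j
    unfolding coef_mddiff coef_simps coef_mswap by (intro tendsto_sum tendsto_diff coef_limD[OF G])
  \<comment> \<open>Everything that stays bounded: the derivative, the finitely many exceptional
    indices in \<open>B\<close>, and the correction for counting \<open>c N\<close> too often. The
    factor 1/N removes it.\<close>
  define d where "d N = coef (mderiv i (G N)) M + (\<Sum>j\<in>B - {i}. coef (mddiff i j (G N)) M) - of_nat (card B) * c N" for N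
  have "d \<longlonglongrightarrow> coef (mderiv i h) M + (\<Sum>j\<in>B - {i}. coef (mddiff i j h) M) - of_nat (card B) * coef h (add_mset i M)"
    unfolding d_def coef_mderiv by (intro tendsto_intros ddl c coef_limD[OF G])
  from tendsto_mult[OF inv0 this] have "(\<lambda>N. 1 / of_nat N * d N) \<longlonglongrightarrow> 0"
    by simp
  then have lim: "(\<lambda>N. c N + 1 / of_nat N * d N) \<longlonglongrightarrow> coef h (add_mset i M)"
    using tendsto_add[OF c] by force
  have ev: "\<forall>\<^sub>F N in sequentially. c N + 1 / of_nat N * d N
     = coef (mconst (1 / of_nat N) * (mderiv i (G N) + (\<Sum>j\<in>{..<N} - {i}. mddiff i j (G N)))) M"
    using eventually_ge_at_top[of "Suc N0"]
  proof eventually_elim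
    case (elim N)
    have sub: "B \<subseteq> {..<N}" using N0 elim by fastforce
    have iB: "i \<in> B" using A by (simp add: B_def)
    have "{..<N} - {i} = (B - {i}) \<union> ({..<N} - B)" using sub iB by auto
    then have "(\<Sum>j\<in>{..<N} - {i}. coef (mddiff i j (G N)) M)
       = (\<Sum>j\<in>B - {i}. coef (mddiff i j (G N)) M) + (\<Sum>j\<in>{..<N} - B. coef (mddiff i j (G N)) M)"
      using \<open>finite B\<close> by (simp only:) (rule sum.union_disjoint, auto)
    also have "(\<Sum>j\<in>{..<N} - B. coef (mddiff i j (G N)) M) = (\<Sum>j\<in>{..<N} - B. c N)"
      by (rule sum.cong) (use elim fresh in auto)
    also have "\<dots> = (of_nat N - of_nat (card B)) * c N"
      using sub card_mono[OF _ sub] by (simp add: card_Diff_subset \<open>finite B\<close> of_nat_diff)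
    finally show ?case
      unfolding coef_mconst_mult coef_simps coef_sum using elim by (simp add: d_def field_simps)
  qed
  show "(\<lambda>N. coef (mconst (1 / of_nat N) * (mderiv i (G N) + (\<Sum>j\<in>{..<N} - {i}. mddiff i j (G N)))) M) \<longlonglongrightarrow> coef (shift i h) M"
    unfolding coef_shift by (rule Lim_transform_eventually[OF lim ev])
qed

text \<open>The three claims need a joint induction: convergence of the next average requires that
  the limit involves only the variables in \<open>A\<close> and that the approximants are symmetric
  in all others.\<close>

lemma coef_lim_dunkl_conj_pow:
  assumes A: "finite A" "i \<in> A" and G: "coef_lim G h" and h: "supp_on A h"
    and sym: "\<And>N a b. a < N \<Longrightarrow> b < N \<Longrightarrow> a \<notin> A \<Longrightarrow> b \<notin> A \<Longrightarrow> mswap a b (G N) = G N"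
    and g: "\<And>i. coef_lim (\<lambda>N. g N i) (\<psi> i)" "\<And>i. supp_on {i} (\<psi> i)"
    and gsym: "\<And>N a b i. a < N \<Longrightarrow> b < N \<Longrightarrow> i < N \<Longrightarrow> mswap a b (g N i) = g N (tr a b i)"
  shows "coef_lim (\<lambda>N. (dunkl_conj N (g N) i ^^ n) (G N)) ((dunkl_lim \<psi> i ^^ n) h)
    \<and> supp_on A ((dunkl_lim \<psi> i ^^ n) h)
    \<and> (\<forall>N>i. \<forall>a<N. \<forall>b<N. a \<notin> A \<longrightarrow> b \<notin> A \<longrightarrow> mswap a b ((dunkl_conj N (g N) i ^^ n) (G N)) = (dunkl_conj N (g N) i ^^ n) (G N))"
proof (induction n)
  case 0
  then show ?case using G h sym by simp
next
  case (Suc n)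
  \<comment> \<open>The induction hypothesis gives symmetry only for N > i, whereas
    \<open>coef_lim_average_mddiff\<close> asks for it for all N; replacing the initial terms by 0
    does not change the limit.\<close>
  define G' where "G' N = (if i < N then (dunkl_conj N (g N) i ^^ n) (G N) else 0)" for N
  have \<psi>: "supp_on A (\<psi> i)" using g(2)[of i] A(2) by (auto simp: supp_on_def)
  have ev: "\<forall>\<^sub>F N in sequentially. (dunkl_conj N (g N) i ^^ n) (G N) = G' N"
    using eventually_gt_at_top[of i] by eventually_elim (simp add: G'_def)
  have G': "coef_lim G' ((dunkl_lim \<psi> i ^^ n) h)"
    unfolding coef_lim_def
  proof
    fix M
    show "(\<lambda>N. coef (G' N) M) \<longlonglongrightarrow> coef ((dunkl_lim \<psi> i ^^ n) h) M"
      by (rule Lim_transform_eventually[OF coef_limD[OF Suc.IH[THEN conjunct1]]])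
        (use ev in eventually_elim, simp)
  qed
  have symG': "mswap a b (G' N) = G' N" if "a < N" "b < N" "a \<notin> A" "b \<notin> A" for N a b
    using Suc.IH that by (auto simp: G'_def)
  have "coef_lim (\<lambda>N. dunkl_conj N (g N) i (G' N)) (dunkl_lim \<psi> i ((dunkl_lim \<psi> i ^^ n) h))"
    unfolding dunkl_conj_def dunkl_lim_def[of _ _ "(dunkl_lim \<psi> i ^^ n) h"]
    by (intro coef_lim_mult coef_lim_const coef_lim_add g G' coef_lim_average_mddiff[OF A G' _ symG']) (use Suc.IH in auto)
  then have 1: "coef_lim (\<lambda>N. (dunkl_conj N (g N) i ^^ Suc n) (G N)) (dunkl_lim \<psi> i ((dunkl_lim \<psi> i ^^ n) h))"
    unfolding coef_lim_def
  proof (intro allI)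
    fix M
    assume *: "\<forall>M. (\<lambda>N. coef (dunkl_conj N (g N) i (G' N)) M) \<longlonglongrightarrow> coef (dunkl_lim \<psi> i ((dunkl_lim \<psi> i ^^ n) h)) M"
    show "(\<lambda>N. coef ((dunkl_conj N (g N) i ^^ Suc n) (G N)) M) \<longlonglongrightarrow> coef (dunkl_lim \<psi> i ((dunkl_lim \<psi> i ^^ n) h)) M"
      by (rule Lim_transform_eventually[OF *[rule_format]]) (use ev in eventually_elim, simp)
  qed
  have 2: "supp_on A (dunkl_lim \<psi> i ((dunkl_lim \<psi> i ^^ n) h))"
    unfolding dunkl_lim_def[of _ _ "(dunkl_lim \<psi> i ^^ n) h"]
    using Suc.IH \<psi> A(2) by (intro supp_on_mult supp_on_add supp_on_1 supp_on_mvar supp_on_shift) auto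
  have 3: "mswap a b ((dunkl_conj N (g N) i ^^ Suc n) (G N)) = (dunkl_conj N (g N) i ^^ Suc n) (G N)"
    if "i < N" "a < N" "b < N" "a \<notin> A" "b \<notin> A" for N a b
  proof -
    have "tr a b i = i" using that A(2) by (intro transpose_apply_other) auto
    then show ?thesis using that Suc.IH gsym[of a N b i] by (simp add: mswap_dunkl_conj)
  qed
  show ?case using 1 2 3 by simp
qed

section \<open>Series in a single variable\<close>

definition mfps_of_fps :: "nat \<Rightarrow> real fps \<Rightarrow> mfps" where
  "mfps_of_fps i f = Abs_mfps (\<lambda>M. if set_mset M \<subseteq> {i} then of_real (fps_nth f (size M)) else 0)"

lemma coef_mfps_of_fps: "coef (mfps_of_fps i f) M = (if set_mset M \<subseteq> {i} then of_real (fps_nth f (size M)) else 0)"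
  by (simp add: mfps_of_fps_def)

lemma mfps_of_fps_add: "mfps_of_fps i (f + g) = mfps_of_fps i f + mfps_of_fps i g"
  by (rule mfps_eqI) (auto simp: coef_mfps_of_fps)

lemma mfps_of_fps_1: "mfps_of_fps i 1 = 1"
  by (rule mfps_eqI) (auto simp: coef_mfps_of_fps coef_one)

lemma mfps_of_fps_mult: "mfps_of_fps i (f * g) = mfps_of_fps i f * mfps_of_fps i g"
proof (rule mfps_eqI)
  fix M
  show "coef (mfps_of_fps i (f * g)) M = coef (mfps_of_fps i f * mfps_of_fps i g) M"
  proof (cases "set_mset M \<subseteq> {i}")
    case True
    then obtain n where M: "M = replicate_mset n i" by (metis set_mset_subset_singletonD)
    have "coef (mfps_of_fps i f * mfps_of_fps i g) M = (\<Sum>r=0..n. coef (mfps_of_fps i f) (replicate_mset r i) * coef (mfps_of_fps i g) (M - replicate_mset r i))"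
      unfolding coef_mult
    proof (rule sum.reindex_bij_witness[where i = "\<lambda>r. replicate_mset r i" and j = size])
      fix A assume A: "A \<in> {A. A \<subseteq># M}"
      then show "replicate_mset (size A) i = A"
        by (metis size_replicate_mset set_mset_subset_singletonD[OF subset_trans[OF set_mset_mono True]] mem_Collect_eq)
      then show "coef (mfps_of_fps i f) (replicate_mset (size A) i) * coef (mfps_of_fps i g) (M - replicate_mset (size A) i)
          = coef (mfps_of_fps i f) A * coef (mfps_of_fps i g) (M - A)" by simp
      show "size A \<in> {0..n}" using A size_mset_mono[of A M] by (simp add: M)
    qed (auto simp: M subseteq_mset_def)
    also have "\<dots> = (\<Sum>r=0..n. of_real (fps_nth f r * fps_nth g (n - r)))"
    proof (rule sum.cong)
      fix r assume "r \<in> {0..n}"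
      have "M - replicate_mset r i = replicate_mset (n - r) i" by (auto simp: M multiset_eq_iff)
      then show "coef (mfps_of_fps i f) (replicate_mset r i) * coef (mfps_of_fps i g) (M - replicate_mset r i)
          = of_real (fps_nth f r * fps_nth g (n - r))" by (auto simp: coef_mfps_of_fps)
    qed simp
    finally show ?thesis by (simp add: coef_mfps_of_fps M fps_mult_nth)
  next
    case False
    have "coef (mfps_of_fps i f * mfps_of_fps i g) M = 0"
      unfolding coef_mult
    proof (rule sum.neutral, rule ballI)
      fix A assume "A \<in> {A. A \<subseteq># M}"
      then have "set_mset M = set_mset A \<union> set_mset (M - A)"
        by (metis mem_Collect_eq set_mset_union subset_mset.add_diff_inverse)
      then show "coef (mfps_of_fps i f) A * coef (mfps_of_fps i g) (M - A) = 0"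
        using False by (auto simp: coef_mfps_of_fps)
    qed
    then show ?thesis using False by (simp add: coef_mfps_of_fps)
  qed
qed

lemma ucoord_eq_mfps_of_fps: "ucoord i = mfps_of_fps i (1 + fps_X)"
proof -
  have "mvar i = mfps_of_fps i fps_X"
  proof (rule mfps_eqI)
    fix M show "coef (mvar i) M = coef (mfps_of_fps i fps_X) M"
      by (auto simp: coef_mvar coef_mfps_of_fps fps_X_nth dest!: size_1_singleton_mset[unfolded One_nat_def])
  qed
  then show ?thesis by (simp add: mfps_of_fps_add mfps_of_fps_1)
qed

definition dunkl_lim1 :: "real fps \<Rightarrow> real fps \<Rightarrow> real fps" where
  "dunkl_lim1 \<psi> f = (1 + fps_X) * (\<psi> * f + fps_shift 1 f)"

text \<open>Removing one power of w_i is linear over series free of w_i. The identity is checked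
  after multiplication by \<open>mvar i\<close>, which can then be cancelled.\<close>

lemma shift_mfps_of_fps_mult:
  assumes "supp_on A h" "i \<notin> A"
  shows "shift i (mfps_of_fps i f * h) = mfps_of_fps i (fps_shift 1 f) * h"
proof -
  \<comment> \<open>\<open>z G\<close> sets w_i = 0 in G, so \<open>shift i G\<close> is the
    quotient of \<open>G - z G\<close> by \<open>mvar i\<close>.\<close>
  define z where "z G = Abs_mfps (\<lambda>M. if i \<in># M then 0 else coef G M)" for G
  have z: "mvar i * shift i G = G - z G" for G
    by (rule mfps_eqI) (auto simp: coef_mvar_mult coef_shift z_def)
  have 1: "z (mfps_of_fps i f * h) = mconst (of_real (fps_nth f 0)) * h"
  proof (rule mfps_eqI)
    fix M
    show "coef (z (mfps_of_fps i f * h)) M = coef (mconst (of_real (fps_nth f 0)) * h) M"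
    proof (cases "i \<in># M")
      case True
      then have "coef h M = 0" using assms by (auto simp: supp_on_def)
      then show ?thesis using True by (simp add: z_def)
    next
      case False
      have "coef (mfps_of_fps i f * h) M = (\<Sum>A\<in>{{#}}. coef (mfps_of_fps i f) A * coef h (M - A))"
        unfolding coef_mult
      proof (rule sum.mono_neutral_right)
        show "\<forall>A\<in>{A. A \<subseteq># M} - {{#}}. coef (mfps_of_fps i f) A * coef h (M - A) = 0"
        proof
          fix A assume "A \<in> {A. A \<subseteq># M} - {{#}}"
          then obtain x where "x \<in># A" "A \<subseteq># M" by (auto elim: multiset_nonemptyE)
          then have "x \<in># M" by (auto dest: mset_subset_eqD)
          then have "\<not> set_mset A \<subseteq> {i}" using False \<open>x \<in># A\<close> by auto
          then show "coef (mfps_of_fps i f) A * coef h (M - A) = 0" by (simp add: coef_mfps_of_fps)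
        qed
      qed auto
      then show ?thesis using False by (simp add: z_def coef_mfps_of_fps)
    qed
  qed
  have 2: "mvar i * mfps_of_fps i (fps_shift 1 f) = mfps_of_fps i f - mconst (of_real (fps_nth f 0))"
  proof (rule mfps_eqI)
    fix M show "coef (mvar i * mfps_of_fps i (fps_shift 1 f)) M = coef (mfps_of_fps i f - mconst (of_real (fps_nth f 0))) M"
    proof (cases "i \<in># M")
      case True
      then obtain M' where "M = add_mset i M'" by (metis mset_add)
      then show ?thesis by (simp add: coef_mvar_mult coef_mfps_of_fps coef_mconst)
    next
      case False
      then show ?thesis
        by (cases "M = {#}") (auto simp: coef_mvar coef_mvar_mult coef_mfps_of_fps coef_mconst elim!: multiset_nonemptyE)
    qed
  qed
  have "mvar i * shift i (mfps_of_fps i f * h) = mvar i * (mfps_of_fps i (fps_shift 1 f) * h)"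
    unfolding z 1 mult.assoc[symmetric] 2 by (simp add: algebra_simps)
  moreover have "mvar i \<noteq> 0" by (auto dest!: arg_cong[where f = "\<lambda>f. coef f {#i#}"] simp: coef_mvar)
  ultimately show ?thesis by simp
qed

lemma dunkl_lim_mfps_of_fps_mult:
  assumes "supp_on A h" "i \<notin> A"
  shows "dunkl_lim (\<lambda>i. mfps_of_fps i \<psi>) i (mfps_of_fps i f * h) = mfps_of_fps i (dunkl_lim1 \<psi> f) * h"
  unfolding dunkl_lim_def dunkl_lim1_def shift_mfps_of_fps_mult[OF assms] ucoord_eq_mfps_of_fps by (simp only: mfps_of_fps_add mfps_of_fps_mult mfps_of_fps_1 algebra_simps)

text \<open>With \<open>h\<close> a series in another variable, this is the asymptotic independence
  of the operators for two distinct indices.\<close>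

lemma dunkl_lim_pow_mfps_of_fps_mult:
  assumes "supp_on A h" "i \<notin> A"
  shows "(dunkl_lim (\<lambda>i. mfps_of_fps i \<psi>) i ^^ n) (mfps_of_fps i f * h) = mfps_of_fps i ((dunkl_lim1 \<psi> ^^ n) f) * h"
  by (induction n) (simp_all add: dunkl_lim_mfps_of_fps_mult[OF assms])

lemma supp_on_mfps_of_fps: "supp_on {i} (mfps_of_fps i f)"
  by (auto simp: supp_on_def coef_mfps_of_fps split: if_splits)

subsection \<open>Taylor series of functions on a polydisc\<close>

text \<open>One radius bounds all coordinates, also those beyond N, so that partial derivatives in
  every index can be handled alike.\<close>

definition polydisc :: "real \<Rightarrow> (nat \<Rightarrow> complex) set" where
  "polydisc r = {u. \<forall>i. cmod (u i - 1) < r}"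

lemma polydisc_upd: "u \<in> polydisc r \<Longrightarrow> cmod (t - 1) < r \<Longrightarrow> u(i := t) \<in> polydisc r"
  by (simp add: polydisc_def)

lemma polydisc_mono: "r' \<le> r \<Longrightarrow> polydisc r' \<subseteq> polydisc r"
  by (auto simp: polydisc_def intro: less_le_trans)

lemma ones_in_polydisc: "r > 0 \<Longrightarrow> ones \<in> polydisc r"
  by (simp add: polydisc_def ones_def)

text \<open>Holomorphy in each variable separately: every argument below fixes all coordinates but
  one.\<close>

definition cdiff :: "real \<Rightarrow> ((nat \<Rightarrow> complex) \<Rightarrow> complex) \<Rightarrow> bool" where
  "cdiff r f \<longleftrightarrow> (\<forall>u\<in>polydisc r. \<forall>i. (\<lambda>t. f (u(i := t))) field_differentiable at (u i))"

lemma eventually_polydisc_upd: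
  assumes "u \<in> polydisc r"
  shows "\<forall>\<^sub>F t in nhds (u i). u(i := t) \<in> polydisc r"
proof -
  have "\<forall>\<^sub>F t in nhds (u i). t \<in> ball 1 r"
    using assms by (intro eventually_nhds_in_open) (auto simp: polydisc_def dist_norm norm_minus_commute)
  then show ?thesis
    by eventually_elim (use assms in \<open>auto simp: polydisc_def dist_norm norm_minus_commute\<close>)
qed

lemma pdiff_cong:
  assumes "\<And>u. u \<in> polydisc r \<Longrightarrow> f u = g u" "u \<in> polydisc r"
  shows "pdiff i f u = pdiff i g u"
  unfolding pdiff_def
proof (rule deriv_cong_ev)
  show "\<forall>\<^sub>F t in nhds (u i). f (u(i := t)) = g (u(i := t))"
    using eventually_polydisc_upd[OF assms(2), of i] by eventually_elim (use assms(1) in auto)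
qed simp

lemma cdiff_cong:
  assumes "\<And>u. u \<in> polydisc r \<Longrightarrow> f u = g u" "cdiff r f"
  shows "cdiff r g"
  unfolding cdiff_def
proof (intro ballI allI)
  fix u i assume u: "u \<in> polydisc r"
  have ev: "\<forall>\<^sub>F t in nhds (u i). f (u(i := t)) = g (u(i := t))"
    using eventually_polydisc_upd[OF u] by eventually_elim (use assms(1) in auto)
  obtain D where "((\<lambda>t. f (u(i := t))) has_field_derivative D) (at (u i))"
    using assms(2) u by (auto simp: cdiff_def field_differentiable_def)
  then show "(\<lambda>t. g (u(i := t))) field_differentiable at (u i)"
    using DERIV_cong_ev[OF refl ev refl] by (auto simp: field_differentiable_def)
qed

text \<open>Says that c is the Taylor series at 1^N of f up to order n. The recursion over partial derivatives
  takes the place of a theory of holomorphic functions of several variables.\<close>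

primrec taylor :: "nat \<Rightarrow> real \<Rightarrow> ((nat \<Rightarrow> complex) \<Rightarrow> complex) \<Rightarrow> mfps \<Rightarrow> bool" where
  "taylor 0 r f c \<longleftrightarrow> cdiff r f \<and> f ones = coef c {#}"
| "taylor (Suc n) r f c \<longleftrightarrow> cdiff r f \<and> f ones = coef c {#} \<and> (\<forall>i. taylor n r (pdiff i f) (mderiv i c))"

lemma taylor_cdiff: "taylor n r f c \<Longrightarrow> cdiff r f" and taylor_ones: "taylor n r f c \<Longrightarrow> f ones = coef c {#}"
  by (cases n; simp)+

lemma taylor_cong:
  "taylor n r f c \<Longrightarrow> r > 0 \<Longrightarrow> (\<And>u. u \<in> polydisc r \<Longrightarrow> f u = g u) \<Longrightarrow> taylor n r g c"
proof (induction n arbitrary: f g c)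
  case 0
  then show ?case using cdiff_cong[of r f g] ones_in_polydisc[of r] by auto
next
  case (Suc n)
  have "taylor n r (pdiff i g) (mderiv i c)" for i
    by (rule Suc.IH[of "pdiff i f"]) (use Suc.prems pdiff_cong[of r f g] in auto)
  then show ?case using Suc.prems cdiff_cong[of r f g] ones_in_polydisc[of r] by auto
qed

lemma cdiff_add: "cdiff r f \<Longrightarrow> cdiff r g \<Longrightarrow> cdiff r (\<lambda>u. f u + g u)"
  and cdiff_mult: "cdiff r f \<Longrightarrow> cdiff r g \<Longrightarrow> cdiff r (\<lambda>u. f u * g u)"
  by (auto simp: cdiff_def intro!: field_differentiable_add field_differentiable_mult)

lemma pdiff_add: "cdiff r f \<Longrightarrow> cdiff r g \<Longrightarrow> u \<in> polydisc r \<Longrightarrow> pdiff i (\<lambda>u. f u + g u) u = pdiff i f u + pdiff i g u"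
  by (simp add: cdiff_def pdiff_def)

lemma pdiff_mult: "cdiff r f \<Longrightarrow> cdiff r g \<Longrightarrow> u \<in> polydisc r \<Longrightarrow>
   pdiff i (\<lambda>u. f u * g u) u = pdiff i f u * g u + f u * pdiff i g u"
  by (simp add: cdiff_def pdiff_def fun_upd_triv)

lemma taylor_Suc_imp: "taylor (Suc n) r f c \<Longrightarrow> taylor n r f c"
  by (induction n arbitrary: f c) auto

lemma taylor_add: "taylor n r f c \<Longrightarrow> taylor n r g d \<Longrightarrow> r > 0 \<Longrightarrow> taylor n r (\<lambda>u. f u + g u) (c + d)"
proof (induction n arbitrary: f g c d)
  case (Suc n)
  have "taylor n r (pdiff i (\<lambda>u. f u + g u)) (mderiv i (c + d))" for i
    unfolding mderiv_add
    by (rule taylor_cong[OF Suc.IH[of "pdiff i f" "mderiv i c" "pdiff i g" "mderiv i d"]])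
      (use Suc.prems pdiff_add[of r f g] in auto)
  then show ?case using Suc.prems by (auto simp: cdiff_add)
qed (auto simp: cdiff_add)

lemma taylor_mult: "taylor n r f c \<Longrightarrow> taylor n r g d \<Longrightarrow> r > 0 \<Longrightarrow> taylor n r (\<lambda>u. f u * g u) (c * d)"
proof (induction n arbitrary: f g c d)
  case (Suc n)
  have "taylor n r (pdiff i (\<lambda>u. f u * g u)) (mderiv i (c * d))" for i
    unfolding mderiv_mult
  proof (rule taylor_cong)
    show "taylor n r (\<lambda>u. pdiff i f u * g u + f u * pdiff i g u) (mderiv i c * d + c * mderiv i d)"
      using Suc.prems taylor_Suc_imp[of n] by (intro taylor_add Suc.IH) auto
  qed (use Suc.prems pdiff_mult[of r f g] in auto)
  then show ?case using Suc.prems by (auto simp: cdiff_mult)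
qed (auto simp: cdiff_mult)

lemma taylor_const: "taylor n r (\<lambda>_. z) (mconst z)"
proof (induction n arbitrary: z)
  case (Suc n)
  have "pdiff i (\<lambda>_. z) = (\<lambda>_. 0)" for i by (simp add: pdiff_def)
  then show ?case using Suc[of 0] by (simp add: cdiff_def coef_mconst)
qed (simp add: cdiff_def coef_mconst)

lemma taylor_powi: "0 < r \<Longrightarrow> r \<le> 1 \<Longrightarrow> taylor n r (\<lambda>u. u i powi k) (mpowi i k)"
proof (induction n arbitrary: k)
  have nz: "u i \<noteq> 0" if "u \<in> polydisc r" "r \<le> 1" for u i
    using that by (auto simp: polydisc_def dest!: spec[of _ i])
  have der: "((\<lambda>t. (u(j := t)) i powi k) has_field_derivative (if i = j then of_int k * u i powi (k - 1) else 0)) (at (u j))"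
    if "u \<in> polydisc r" "r \<le> 1" for u j k
  proof (cases "i = j")
    case True
    then show ?thesis using nz[OF that, of j] by (auto intro!: derivative_eq_intros)
  qed auto
  have cd: "cdiff r (\<lambda>u. u i powi k)" if "r \<le> 1" for k
    unfolding cdiff_def field_differentiable_def using der that by blast
  case 0
  then show ?case using cd by (simp add: ones_def coef_mpowi)
  case (Suc n)
  have "taylor n r (pdiff j (\<lambda>u. u i powi k)) (mderiv j (mpowi i k))" for j
  proof (cases "i = j")
    case True
    have "of_int k * u j powi (k - 1) = pdiff j (\<lambda>u. u j powi k) u" if "u \<in> polydisc r" for u
      using DERIV_imp_deriv[OF der[OF that, of j k]] True Suc.prems by (simp add: pdiff_def)
    moreover have "taylor n r (\<lambda>u. of_int k * u j powi (k - 1)) (mconst (of_int k) * mpowi j (k - 1))"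
      using Suc True by (intro taylor_mult taylor_const) simp_all
    ultimately show ?thesis unfolding mderiv_mpowi True if_P[OF refl]
      using Suc.prems by - (rule taylor_cong[where f = "\<lambda>u. of_int k * u j powi (k - 1)"], simp_all)
  next
    case False
    show ?thesis unfolding mderiv_mpowi if_not_P[OF False]
      using taylor_const[of n r 0] Suc.prems False by (simp add: pdiff_def)
  qed
  then show ?case using cd Suc.prems by (simp add: ones_def coef_mpowi)
qed

lemma taylor_coord: "0 < r \<Longrightarrow> r \<le> 1 \<Longrightarrow> taylor n r (\<lambda>u. u i) (ucoord i)"
  using taylor_powi[of r n i 1] by (simp add: mpowi_1)

lemma taylor_sum:
  assumes "r > 0" "\<And>x. x \<in> A \<Longrightarrow> taylor n r (f x) (c x)"
  shows "taylor n r (\<lambda>u. \<Sum>x\<in>A. f x u) (\<Sum>x\<in>A. c x)"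
  using assms(2)
proof (induction A rule: infinite_finite_induct)
  case (insert x A)
  then show ?case using taylor_add[of n r "f x" "c x"] assms(1) by simp
qed (use taylor_const[of n r 0] in auto)

lemma taylor_prod:
  assumes "r > 0" "\<And>x. x \<in> A \<Longrightarrow> taylor n r (f x) (c x)"
  shows "taylor n r (\<lambda>u. \<Prod>x\<in>A. f x u) (\<Prod>x\<in>A. c x)"
  using assms(2)
proof (induction A rule: infinite_finite_induct)
  case (insert x A)
  then show ?case using taylor_mult[of n r "f x" "c x"] assms(1) by simp
qed (use taylor_const[of n r 1] in auto)

lemma taylor_mono: "taylor n r f c \<Longrightarrow> r' \<le> r \<Longrightarrow> taylor n r' f c"
proof (induction n arbitrary: f c)
  case 0
  then show ?case using polydisc_mono[of r' r] by (auto simp: cdiff_def)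
next
  case (Suc n)
  then show ?case using polydisc_mono[of r' r] by (auto simp: cdiff_def)
qed

abbreviation mderivs :: "nat list \<Rightarrow> mfps \<Rightarrow> mfps" where "mderivs is c \<equiv> foldr mderiv is c"

lemma pdiffs_snoc: "pdiffs (is @ [i]) f = pdiffs is (pdiff i f)"
  by (simp add: pdiffs_def)

lemma pdiffs_Cons: "pdiffs (i # is) f = pdiff i (pdiffs is f)" and pdiffs_Nil: "pdiffs [] f = f"
  by (simp_all add: pdiffs_def)

lemma taylor_pdiffs: "taylor n r f c \<Longrightarrow> length is \<le> n \<Longrightarrow> cdiff r (pdiffs is f) \<and> pdiffs is f ones = coef (mderivs is c) {#}"
proof (induction "is" arbitrary: n f c rule: rev_induct)
  case Nil
  then show ?case using taylor_cdiff taylor_ones by (auto simp: pdiffs_def)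
next
  case (snoc i "is")
  then obtain m where n: "n = Suc m" by (cases n) auto
  have "cdiff r (pdiffs is (pdiff i f)) \<and> pdiffs is (pdiff i f) ones = coef (mderivs is (mderiv i c)) {#}"
    by (rule snoc.IH[of m]) (use snoc.prems n in auto)
  then show ?case by (simp add: pdiffs_snoc)
qed

lemma taylorI:
  assumes "\<And>is. cdiff r (pdiffs is f) \<and> pdiffs is f ones = coef (mderivs is c) {#}"
  shows "taylor n r f c"
  using assms
proof (induction n arbitrary: f c)
  case 0
  then show ?case using 0[of "[]"] by (simp add: pdiffs_def)
next
  case (Suc n)
  have "taylor n r (pdiff i f) (mderiv i c)" for i
    by (rule Suc.IH) (use Suc.prems[of "_ @ [i]"] in \<open>auto simp: pdiffs_snoc\<close>)
  then show ?case using Suc.prems[of "[]"] by (simp add: pdiffs_def)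
qed

text \<open>At \<open>M = {#}\<close> this is the product of the factorials of the multiplicities of
  the indices, that is, the factor between a mixed derivative and a Taylor coefficient.\<close>

primrec dfact :: "nat list \<Rightarrow> nat multiset \<Rightarrow> complex" where
  "dfact [] M = 1"
| "dfact (i # is) M = of_nat (Suc (count M i)) * dfact is (add_mset i M)"

lemma dfact_ne_0 [simp]: "dfact is M \<noteq> 0"
  by (induction "is" arbitrary: M) (auto simp del: of_nat_Suc)

lemma coef_mderivs: "coef (mderivs is c) M = dfact is M * coef c (M + mset is)"
  by (induction "is" arbitrary: M) (auto simp: coef_mderiv)

lemma coef_mderivs_empty: "coef (mderivs is c) {#} = dfact is {#} * coef c (mset is)"
  by (simp add: coef_mderivs)

lemma dfact_replicate: "dfact (replicate k i) (replicate_mset m i) * fact m = fact (m + k)"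
proof (induction k arbitrary: m)
  case (Suc k)
  show ?case using Suc[of "Suc m"] by (simp add: mult_ac)
qed simp

text \<open>Through this lemma identities between functions become identities between formal
  series.\<close>

lemma taylor_unique:
  assumes "\<And>n. taylor n r f c" "\<And>n. taylor n r f d"
  shows "c = d"
proof (rule mfps_eqI)
  fix M :: "nat multiset"
  obtain "is" where M: "M = mset is" by (metis ex_mset)
  show "coef c M = coef d M"
    using taylor_pdiffs[OF assms(1)[of "length is"], of "is"] taylor_pdiffs[OF assms(2)[of "length is"], of "is"]
    by (simp add: coef_mderivs_empty M)
qed

text \<open>Weierstrass' theorem in the variable of index i, made uniform in the other variables by
  Cauchy's estimate. Discs of half the gap between the radii stay inside the larger polydisc; the
  bound \<open>e * \<rho> / 2\<close> there gives e/2 for the derivative.\<close>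

lemma uniform_limit_pdiff:
  assumes ul: "uniform_limit (polydisc r) f S F" and cd: "\<And>x. cdiff r (f x)" and F: "F \<noteq> bot" and r: "r' < r"
  shows "cdiff r' S \<and> uniform_limit (polydisc r') (\<lambda>x. pdiff i (f x)) (pdiff i S) F"
proof -
  define \<rho> where "\<rho> = (r - r') / 2"
  have \<rho>: "\<rho> > 0" using r by (simp add: \<rho>_def)
  have inP: "u(i := t) \<in> polydisc r" if "u \<in> polydisc r'" "t \<in> cball (u i) \<rho>" for u i t
  proof (rule polydisc_upd)
    show "u \<in> polydisc r" using that r polydisc_mono[of r' r] by auto
    have "cmod (t - 1) \<le> cmod (t - u i) + cmod (u i - 1)" using norm_triangle_ineq[of "t - u i" "u i - 1"] by simp
    also have "\<dots> < \<rho> + r'" using that by (intro add_le_less_mono) (auto simp: polydisc_def dist_norm norm_minus_commute)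
    also have "\<dots> < r" using r by (simp add: \<rho>_def field_simps)
    finally show "cmod (t - 1) < r" .
  qed
  have holf: "(\<lambda>t. f x (u(i := t))) holomorphic_on (cball (u i) \<rho>)" if "u \<in> polydisc r'" for u i x
    unfolding holomorphic_on_def
  proof
    fix t assume "t \<in> cball (u i) \<rho>"
    then have "(\<lambda>s. f x ((u(i := t))(i := s))) field_differentiable at ((u(i := t)) i)"
      using cd[of x] inP[OF that] unfolding cdiff_def by blast
    then show "(\<lambda>s. f x (u(i := s))) field_differentiable at t within cball (u i) \<rho>"
      by (auto intro: field_differentiable_at_within)
  qed
  have S: "continuous_on (cball (u i) \<rho>) (\<lambda>t. S (u(i := t))) \<and> (\<lambda>t. S (u(i := t))) holomorphic_on ball (u i) \<rho>"
    if u: "u \<in> polydisc r'" for u i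
  proof -
    have ul': "uniform_limit (cball (u i) \<rho>) (\<lambda>x t. f x (u(i := t))) (\<lambda>t. S (u(i := t))) F"
      unfolding uniform_limit_iff
    proof (intro allI impI)
      fix e :: real assume "e > 0"
      then have "\<forall>\<^sub>F x in F. \<forall>u\<in>polydisc r. dist (f x u) (S u) < e"
        using ul unfolding uniform_limit_iff by simp
      then show "\<forall>\<^sub>F x in F. \<forall>t\<in>cball (u i) \<rho>. dist (f x (u(i := t))) (S (u(i := t))) < e"
        by eventually_elim (use inP[OF u] in simp)
    qed
    have ev: "\<forall>\<^sub>F x in F. continuous_on (cball (u i) \<rho>) (\<lambda>t. f x (u(i := t))) \<and> (\<lambda>t. f x (u(i := t))) holomorphic_on ball (u i) \<rho>"
      using holomorphic_on_imp_continuous_on[OF holf[OF u]] holomorphic_on_subset[OF holf[OF u] ball_subset_cball]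
      by (intro always_eventually) simp
    show ?thesis by (rule holomorphic_uniform_limit[OF ev ul' F]) simp
  qed
  have dS: "(\<lambda>t. S (u(i := t))) field_differentiable at (u i)" if "u \<in> polydisc r'" for u i
    using S[OF that, of i] \<rho> holomorphic_on_imp_differentiable_at[of _ "ball (u i) \<rho>"] by auto
  have "uniform_limit (polydisc r') (\<lambda>x. pdiff i (f x)) (pdiff i S) F"
    unfolding uniform_limit_iff
  proof (intro allI impI)
    fix e :: real assume "e > 0"
    then have "e * \<rho> / 2 > 0" using \<rho> by simp
    then have "\<forall>\<^sub>F x in F. \<forall>u\<in>polydisc r. dist (f x u) (S u) < e * \<rho> / 2"
      using ul unfolding uniform_limit_iff by blast
    then show "\<forall>\<^sub>F x in F. \<forall>u\<in>polydisc r'. dist (pdiff i (f x) u) (pdiff i S u) < e"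
    proof eventually_elim
      case (elim x)
      show ?case
      proof
        fix u assume u: "u \<in> polydisc r'"
        define h where "h t = f x (u(i := t)) - S (u(i := t))" for t
        have df: "(\<lambda>t. f x (u(i := t))) field_differentiable at (u i)"
          using cd[of x] u r polydisc_mono[of r' r] by (auto simp: cdiff_def)
        have "cmod ((deriv ^^ 1) h (u i)) \<le> fact 1 * (e * \<rho> / 2) / \<rho> ^ 1"
        proof (rule Cauchy_inequality)
          show "h holomorphic_on ball (u i) \<rho>"
            unfolding h_def using holomorphic_on_subset[OF holf[OF u] ball_subset_cball] S[OF u]
            by (intro holomorphic_on_diff) simp_all
          show "continuous_on (cball (u i) \<rho>) h"
            unfolding h_def using holomorphic_on_imp_continuous_on[OF holf[OF u]] S[OF u]
            by (intro continuous_on_diff) simp_all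
          show "cmod (h t) \<le> e * \<rho> / 2" if "cmod (u i - t) = \<rho>" for t
            using elim[rule_format, OF inP[OF u, of t i]] that by (simp add: h_def dist_norm)
        qed (rule \<rho>)
        also have "deriv h (u i) = pdiff i (f x) u - pdiff i S u"
          using df dS[OF u, of i] by (simp add: h_def[abs_def] pdiff_def)
        then have "(deriv ^^ 1) h (u i) = pdiff i (f x) u - pdiff i S u" by simp
        finally show "dist (pdiff i (f x) u) (pdiff i S u) < e"
          using \<rho> \<open>e > 0\<close> by (simp add: dist_norm)
      qed
    qed
  qed
  then show ?thesis using dS by (simp add: cdiff_def)
qed

text \<open>Each derivative costs some radius. Since the target radius is arbitrary below
  \<open>r\<close>, intermediate radii can be inserted at every step, and any number of derivatives
  converges on the same smaller polydisc.\<close>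

lemma uniform_limit_pdiffs:
  assumes ul: "uniform_limit (polydisc r) f S F" and cd: "\<And>x is. cdiff r (pdiffs is (f x))" and F: "F \<noteq> bot" and r: "r' < r"
  shows "cdiff r' (pdiffs is S) \<and> uniform_limit (polydisc r') (\<lambda>x. pdiffs is (f x)) (pdiffs is S) F"
  using r
proof (induction "is" arbitrary: r')
  case Nil
  then show ?case using uniform_limit_pdiff[OF ul _ F Nil] cd[of "[]"] 
     uniform_limit_on_subset[OF ul polydisc_mono[of r' r]] by (auto simp: pdiffs_Nil)
next
  case (Cons i "is")
  obtain r1 where r1: "r' < r1" "r1 < r" using dense Cons.prems by blast
  obtain r2 where r2: "r' < r2" "r2 < r1" using dense r1 by blast
  have cd1: "cdiff r1 (pdiffs js (f x))" for js x
    using cd[of js x] polydisc_mono[of r1 r] r1 by (auto simp: cdiff_def)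
  have cd2: "cdiff r2 (pdiffs js (f x))" for js x
    using cd1[of js x] polydisc_mono[of r2 r1] r2 by (auto simp: cdiff_def)
  have 1: "uniform_limit (polydisc r2) (\<lambda>x. pdiffs (i # is) (f x)) (pdiffs (i # is) S) F"
    unfolding pdiffs_Cons using uniform_limit_pdiff[where f = "\<lambda>x. pdiffs is (f x)" and S = "pdiffs is S" and r = r1 and r' = r2 and i = i and F = F]
      Cons.IH[OF r1(2)] r2(2) F cd1 by blast
  then have "cdiff r' (pdiffs (i # is) S)"
    using uniform_limit_pdiff[OF 1 cd2 F r2(1)] by simp
  then show ?case using uniform_limit_on_subset[OF 1 polydisc_mono[of r' r2]] r2 by auto
qed

lemma taylor_uniform_limit:
  assumes ul: "uniform_limit (polydisc r) f S F" and t: "\<And>x n. taylor n r (f x) (c x)" and F: "F \<noteq> bot"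
    and r: "0 < r'" "r' < r"
  shows "\<exists>d. (\<forall>n. taylor n r' S d) \<and> (\<forall>M. ((\<lambda>x. coef (c x) M) \<longlongrightarrow> coef d M) F)"
proof -
  have cd: "cdiff r (pdiffs is (f x))" for "is" x
    using taylor_pdiffs[OF t[of "length is"]] by auto
  note ulis = uniform_limit_pdiffs[OF ul cd F r(2)]
  have lim: "((\<lambda>x. dfact is {#} * coef (c x) (mset is)) \<longlongrightarrow> pdiffs is S ones) F" for "is"
  proof -
    have "((\<lambda>x. pdiffs is (f x) ones) \<longlongrightarrow> pdiffs is S ones) F"
      using tendsto_uniform_limitI[OF conjunct2[OF ulis[of "is"]] ones_in_polydisc[OF r(1)]] by simp
    then show ?thesis using taylor_pdiffs[OF t[of "length is"]] by (simp add: coef_mderivs_empty)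
  qed
  \<comment> \<open>A monomial is differentiated in sorted order. That any other order gives the
    same value follows from uniqueness of limits, because the coefficients of the approximants
    depend only on the multiset of indices.\<close>
  define d where "d = Abs_mfps (\<lambda>M. pdiffs (sorted_list_of_multiset M) S ones / dfact (sorted_list_of_multiset M) {#})"
  have d: "((\<lambda>x. coef (c x) M) \<longlongrightarrow> coef d M) F" for M
    using tendsto_divide[OF lim[of "sorted_list_of_multiset M"] tendsto_const[of "dfact (sorted_list_of_multiset M) {#}"]]
    by (simp add: d_def)
  have "pdiffs is S ones = coef (mderivs is d) {#}" for "is"
  proof (rule tendsto_unique[OF F lim])
    show "((\<lambda>x. dfact is {#} * coef (c x) (mset is)) \<longlongrightarrow> coef (mderivs is d) {#}) F"
      unfolding coef_mderivs_empty by (intro tendsto_mult tendsto_const d)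
  qed
  then have "taylor n r' S d" for n
    using ulis by (intro taylorI) auto
  then show ?thesis using d by blast
qed

text \<open>Geometric series in 1 - c. Its n-th power has no monomials of size below n, so each
  coefficient of the inverse is a finite sum.\<close>

lemma mfps_unit_exists:
  assumes "coef c {#} = 1"
  shows "\<exists>I. c * I = (1 :: mfps)"
proof -
  define d where "d = 1 - c"
  have d0: "coef d {#} = 0" using assms by (simp add: d_def coef_one)
  have van: "coef (d ^ n) M = 0" if "n > size M" for n M
    using that
  proof (induction n arbitrary: M)
    case (Suc n)
    have "coef d A * coef (d ^ n) (M - A) = 0" if "A \<subseteq># M" for A
    proof (cases "A = {#}")
      case False
      then have "size A > 0" "size A \<le> size M" using that by (auto simp: nonempty_has_size size_mset_mono)
      then have "size (M - A) < n" using Suc.prems that by (simp add: size_Diff_submset)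
      then show ?thesis using Suc.IH by simp
    qed (simp add: d0)
    then show ?case unfolding power_Suc coef_mult by (intro sum.neutral) simp
  qed simp
  define I where "I = Abs_mfps (\<lambda>M. \<Sum>n\<le>size M. coef (d ^ n) M)"
  have I: "coef I A = coef (\<Sum>n\<le>k. d ^ n) A" if "size A \<le> k" for A k
    unfolding coef_sum I_def coef_Abs_mfps
    by (rule sum.mono_neutral_left) (use that in \<open>auto simp: van\<close>)
  have "c * I = 1"
  proof (rule mfps_eqI)
    fix M
    have "coef (c * I) M = coef (c * (\<Sum>n\<le>size M. d ^ n)) M"
      unfolding coef_mult by (intro sum.cong refl) (auto simp: I size_Diff_submset)
    also have "c * (\<Sum>n\<le>size M. d ^ n) = 1 - d ^ Suc (size M)"
      using sum_gp_basic[of d "size M"] by (simp add: d_def)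
    finally show "coef (c * I) M = coef 1 M" using van[of M "Suc (size M)"] by simp
  qed
  then show ?thesis by blast
qed

text \<open>Formal Poincare lemma: the coefficient at a monomial is found by integrating in its
  smallest variable, and closedness makes every other variable give the same value.\<close>

lemma mfps_poincare:
  assumes "\<And>i j. mderiv i (g j) = mderiv j (g i)"
  shows "\<exists>f. coef f {#} = z \<and> (\<forall>i. mderiv i f = g i)"
proof -
  define f where "f = Abs_mfps (\<lambda>M. if M = {#} then z else
     let i = Min (set_mset M) in coef (g i) (M - {#i#}) / of_nat (count M i))"
  have compat: "coef (g i) (M - {#i#}) / of_nat (count M i) = coef (g j) (M - {#j#}) / of_nat (count M j)"
    if "i \<in># M" "j \<in># M" for i j M
  proof (cases "i = j")
    case False
    obtain M1 where M1: "M = add_mset i M1" using multi_member_split[OF \<open>i \<in># M\<close>] by blast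
    then have "j \<in># M1" using that False by simp
    then obtain M' where M': "M1 = add_mset j M'" using multi_member_split[of j M1] by blast
    have "of_nat (Suc (count M' i)) * coef (g j) (add_mset i M') = of_nat (Suc (count M' j)) * coef (g i) (add_mset j M')"
      using arg_cong[OF assms[of i j], of "\<lambda>f. coef f M'"] unfolding coef_mderiv .
    moreover have "M - {#i#} = add_mset j M'" "M - {#j#} = add_mset i M'"
      "count M i = Suc (count M' i)" "count M j = Suc (count M' j)"
      using False by (simp_all add: M1 M')
    ultimately show ?thesis by (simp add: frac_eq_eq mult.commute del: of_nat_Suc)
  qed simp
  have "mderiv i f = g i" for i
  proof (rule mfps_eqI)
    fix M
    have "Min (set_mset (add_mset i M)) \<in># add_mset i M" by (intro Min_in) auto
    from compat[OF this, of i] show "coef (mderiv i f) M = coef (g i) M"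
      by (simp add: coef_mderiv f_def Let_def del: of_nat_Suc)
  qed
  then show ?thesis by (intro exI[of _ f]) (simp add: f_def)
qed

text \<open>Instead of composing with the logarithm series, the logarithmic derivatives are expanded
  and integrated by \<open>mfps_poincare\<close>. The bound on S - 1 keeps S in the right
  half-plane, where \<open>Ln\<close> is holomorphic. The differential equation is the formal
  version of S = exp (N F).\<close>

lemma taylor_log:
  assumes t: "\<And>n. taylor n r S c" and r: "r > 0" and S1: "S ones = 1"
    and near: "\<And>u. u \<in> polydisc r \<Longrightarrow> cmod (S u - 1) < 1" and N: "N > 0"
  shows "\<exists>d. (\<forall>n. taylor n r (\<lambda>u. Ln (S u) / of_nat N) d) \<and> (\<forall>i. mderiv i c = mconst (of_nat N) * (mderiv i d * c))"
proof -
  have c0: "coef c {#} = 1" using taylor_ones[OF t[of 0]] S1 by simp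
  obtain I where I: "c * I = 1" using mfps_unit_exists[OF c0] by blast
  have nz: "S u \<notin> \<real>\<^sub>\<le>\<^sub>0" "S u \<noteq> 0" if "u \<in> polydisc r" for u
  proof -
    have "0 < Re (S u)" using near[OF that] abs_Re_le_cmod[of "S u - 1"] unfolding minus_complex.simps one_complex.simps by linarith
    then show "S u \<notin> \<real>\<^sub>\<le>\<^sub>0" "S u \<noteq> 0" by (auto simp: complex_nonpos_Reals_iff)
  qed
  have dS: "((\<lambda>t. S (u(i := t))) has_field_derivative pdiff i S u) (at (u i))" if "u \<in> polydisc r" for u i
    using taylor_cdiff[OF t[of 0]] that unfolding cdiff_def pdiff_def by (intro field_differentiable_derivI) blast
  have dI: "((\<lambda>t. 1 / S (u(i := t))) has_field_derivative - (pdiff i S u * (1 / S u * (1 / S u)))) (at (u i))"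
    if "u \<in> polydisc r" for u i
    using DERIV_divide[OF DERIV_const[of 1] dS[OF that, of i]] nz[OF that] by simp
  have pI: "mderiv i I = - (mderiv i c * (I * I))" for i
  proof -
    have "mderiv i c * I + c * mderiv i I = 0" using arg_cong[OF I, of "mderiv i"] by (simp add: mderiv_mult)
    moreover have "I * (mderiv i c * I) + (c * I) * mderiv i I = I * (mderiv i c * I + c * mderiv i I)"
      by (simp only: algebra_simps)
    ultimately have "I * (mderiv i c * I) + mderiv i I = 0" by (simp add: I)
    then show ?thesis by (simp add: add_eq_0_iff mult_ac)
  qed
  have I0: "coef I {#} = 1" using arg_cong[OF I, of "\<lambda>f. coef f {#}"] c0 by (simp add: coef_one)
  have cdI: "cdiff r (\<lambda>u. 1 / S u)" unfolding cdiff_def field_differentiable_def by (intro ballI allI exI, rule dI)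
  \<comment> \<open>The derivative of 1/S is a product of S' and powers of 1/S, so the expansion to
    order n yields the one to order n + 1.\<close>
  have tI: "taylor n r (\<lambda>u. 1 / S u) I" for n
  proof (induction n)
    case (Suc n)
    have "taylor n r (pdiff i (\<lambda>u. 1 / S u)) (mderiv i I)" for i
    proof (rule taylor_cong)
      have "taylor n r (pdiff i S) (mderiv i c)" using t[of "Suc n"] by simp
      then have "taylor n r (\<lambda>u. (-1) * (pdiff i S u * (1 / S u * (1 / S u)))) (mconst (-1) * (mderiv i c * (I * I)))"
        by (intro taylor_mult taylor_const Suc r)
      then show "taylor n r (\<lambda>u. (-1) * (pdiff i S u * (1 / S u * (1 / S u)))) (mderiv i I)"
        by (simp only: pI mconst_uminus mconst_1 mult_minus1)
      show "(-1) * (pdiff i S u * (1 / S u * (1 / S u))) = pdiff i (\<lambda>u. 1 / S u) u" if "u \<in> polydisc r" for u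
        using DERIV_imp_deriv[OF dI[OF that, of i]] by (simp add: pdiff_def)
    qed (rule r)
    then show ?case using cdI S1 I0 by simp
  qed (use cdI S1 I0 in simp)
  define g where "g i = mconst (1 / of_nat N) * (mderiv i c * I)" for i
  have "mderiv i (g j) = mderiv j (g i)" for i j
    unfolding g_def mderiv_mconst_mult mderiv_mult pI mderiv_commute[of i j] by (simp add: mult_ac)
  then obtain d where d: "coef d {#} = 0" "\<And>i. mderiv i d = g i" using mfps_poincare[of g 0] by blast
  have dL: "((\<lambda>t. Ln (S (u(i := t))) / of_nat N) has_field_derivative (1 / of_nat N) * (pdiff i S u * (1 / S u))) (at (u i))"
    if "u \<in> polydisc r" for u i
    using DERIV_cdivide[OF DERIV_chain2[OF has_field_derivative_Ln dS[OF that, of i]], of "of_nat N"] nz[OF that]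
    by (simp add: divide_inverse mult_ac)
  have cdL: "cdiff r (\<lambda>u. Ln (S u) / of_nat N)" unfolding cdiff_def field_differentiable_def by (intro ballI allI exI, rule dL)
  have "taylor n r (\<lambda>u. Ln (S u) / of_nat N) d" for n
  proof (cases n)
    case (Suc m)
    have "taylor m r (pdiff i (\<lambda>u. Ln (S u) / of_nat N)) (mderiv i d)" for i
    proof (rule taylor_cong)
      show "taylor m r (\<lambda>u. (1 / of_nat N) * (pdiff i S u * (1 / S u))) (mderiv i d)"
      proof -
        have "taylor m r (pdiff i S) (mderiv i c)" using t[of "Suc m"] by simp
        then show ?thesis unfolding d(2) g_def by (intro taylor_mult taylor_const tI r)
      qed
      show "(1 / of_nat N) * (pdiff i S u * (1 / S u)) = pdiff i (\<lambda>u. Ln (S u) / of_nat N) u" if "u \<in> polydisc r" for u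
        using DERIV_imp_deriv[OF dL[OF that, of i]] by (simp add: pdiff_def)
    qed (rule r)
    then show ?thesis using cdL S1 d(1) Suc by simp
  qed (use cdL S1 d(1) in simp)
  moreover have "mderiv i c = mconst (of_nat N) * (mderiv i d * c)" for i
  proof -
    have "mconst (of_nat N) * (mderiv i d * c) = (mconst (of_nat N) * mconst (1 / of_nat N)) * (mderiv i c * (c * I))"
      by (simp only: d(2) g_def mult_ac)
    also have "mconst (of_nat N) * mconst (1 / of_nat N) = 1" using N by (simp flip: mconst_mult)
    finally show ?thesis by (simp add: I)
  qed
  ultimately show ?thesis by blast
qed

subsection \<open>Schur functions as Laurent polynomials\<close>

text \<open>The divided difference of x^n at the points u_0, ..., u_m.\<close>

fun ndd :: "(nat \<Rightarrow> complex) \<Rightarrow> nat \<Rightarrow> nat \<Rightarrow> complex" where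
  "ndd u 0 n = u 0 ^ n"
| "ndd u (Suc m) 0 = 0"
| "ndd u (Suc m) (Suc n) = ndd u m n + u (Suc m) * ndd u (Suc m) n"

lemma newton_interpolation: "u i ^ n = (\<Sum>m\<le>i. ndd u m n * (\<Prod>k<m. u i - u k))"
proof (induction n)
  case 0
  have "ndd u m 0 = (if m = 0 then 1 else 0)" for m by (cases m) auto
  then have "(\<Sum>m\<le>i. ndd u m 0 * (\<Prod>k<m. u i - u k)) = (\<Sum>m\<le>i. if m = 0 then 1 else 0)"
    by (intro sum.cong) auto
  then show ?case by simp
next
  case (Suc n)
  define \<omega> where "\<omega> m = (\<Prod>k<m. u i - u k)" for m
  have "(\<Sum>m\<le>i. ndd u m (Suc n) * \<omega> m)
     = u 0 * ndd u 0 n * \<omega> 0 + (\<Sum>m<i. (ndd u m n + u (Suc m) * ndd u (Suc m) n) * \<omega> (Suc m))"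
    by (simp add: sum.atMost_shift)
  also have "\<dots> = (u 0 * ndd u 0 n * \<omega> 0 + (\<Sum>m<i. u (Suc m) * ndd u (Suc m) n * \<omega> (Suc m))) + (\<Sum>m<i. ndd u m n * \<omega> (Suc m))"
    by (simp add: distrib_right sum.distrib)
  also have "u 0 * ndd u 0 n * \<omega> 0 + (\<Sum>m<i. u (Suc m) * ndd u (Suc m) n * \<omega> (Suc m)) = (\<Sum>m\<le>i. u m * ndd u m n * \<omega> m)"
    by (simp add: sum.atMost_shift)
  also have "(\<Sum>m<i. ndd u m n * \<omega> (Suc m)) = (\<Sum>m\<le>i. ndd u m n * \<omega> (Suc m))"
    by (simp add: lessThan_Suc_atMost[symmetric] \<omega>_def)
  also have "(\<Sum>m\<le>i. u m * ndd u m n * \<omega> m) + (\<Sum>m\<le>i. ndd u m n * \<omega> (Suc m)) = u i * (\<Sum>m\<le>i. ndd u m n * \<omega> m)"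
    unfolding sum_distrib_left sum.distrib[symmetric]
    by (intro sum.cong refl) (simp add: \<omega>_def algebra_simps)
  finally show ?case using Suc by (simp add: \<omega>_def)
qed

lemma ndd_ones: "ndd ones m n = of_nat (n choose m)"
  by (induction ones m n rule: ndd.induct) (auto simp: ones_def)

lemma ndd_eq_0: "n < m \<Longrightarrow> ndd u m n = 0" and ndd_diag: "ndd u m m = 1"
proof -
  show 1: "n < m \<Longrightarrow> ndd u m n = 0" for m n
    by (induction u m n rule: ndd.induct) auto
  show "ndd u m m = 1" by (induction m) (auto simp: 1)
qed

definition ndd_mat :: "nat \<Rightarrow> (nat \<Rightarrow> nat) \<Rightarrow> (nat \<Rightarrow> complex) \<Rightarrow> complex mat" where
  "ndd_mat N e u = mat N N (\<lambda>(m, j). ndd u m (e j))"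

text \<open>The sign (-1)^(N(N-1)/2) acquired when all differences in the Vandermonde product are
  reversed.\<close>

definition vsign :: "nat \<Rightarrow> complex" where
  "vsign N = (\<Prod>i<N. \<Prod>k<i. - 1)"

lemma vsign_square: "vsign N * vsign N = 1"
  by (simp add: vsign_def prod.distrib[symmetric])

lemma vsign_ne_0: "vsign N \<noteq> 0"
  using vsign_square[of N] by auto

lemma vandermonde_flip: "(\<Prod>i<N. \<Prod>k<i. u i - u k) = vsign N * vandermonde N u"
proof -
  have "(\<Prod>i<N. \<Prod>k<i. u i - u k) = (\<Prod>i<N. \<Prod>k<i. (- 1) * (u k - u i))"
    by (intro prod.cong refl) simp
  also have "\<dots> = vsign N * (\<Prod>i<N. \<Prod>k<i. u k - u i)"
    by (simp only: prod.distrib vsign_def)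
  also have "(\<Prod>i<N. \<Prod>k<i. u k - u i) = (\<Prod>(i, k)\<in>Sigma {..<N} (\<lambda>i. {..<i}). u k - u i)"
    by (simp add: prod.Sigma)
  also have "\<dots> = (\<Prod>(i, j)\<in>Sigma {..<N} (\<lambda>i. {i<..<N}). u i - u j)"
    by (rule prod.reindex_bij_witness[where i = "\<lambda>(a, b). (b, a)" and j = "\<lambda>(a, b). (b, a)"]) auto
  also have "\<dots> = vandermonde N u"
    by (simp add: prod.Sigma vandermonde_def)
  finally show ?thesis .
qed

lemma det_mat_lessThan:
  "det (mat N N f) = (\<Sum>p | p permutes {..<N}. of_int (sign p) * (\<Prod>i<N. f (i, p i)))"
proof -
  have "p i < N" if "p permutes {..<N}" "i < N" for p i
    using permutes_in_image[OF that(1), of i] that(2) by simp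
  then show ?thesis
    unfolding det_def'[OF mat_carrier] atLeast0LessThan by (intro sum.cong) auto
qed

text \<open>Newton interpolation factors the matrix of powers as a lower triangular matrix times
  \<open>ndd_mat\<close>; the diagonal of the triangular factor multiplies to the Vandermonde
  determinant up to \<open>vsign N\<close>.\<close>

lemma det_powers:
  "(\<Sum>p | p permutes {..<N}. of_int (sign p) * (\<Prod>i<N. u i ^ e (p i)))
    = vsign N * vandermonde N u * det (ndd_mat N e u)"
proof -
  define A where "A = mat N N (\<lambda>(i, j). u i ^ e j)"
  define L where "L = mat N N (\<lambda>(i, m). if m \<le> i then \<Prod>k<m. u i - u k else 0)"
  have "A = L * ndd_mat N e u"
  proof (rule eq_matI)
    fix i j assume "i < dim_row (L * ndd_mat N e u)" "j < dim_col (L * ndd_mat N e u)"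
    then have ij: "i < N" "j < N" by (auto simp: L_def ndd_mat_def)
    have "(L * ndd_mat N e u) $$ (i, j) = (\<Sum>m<N. (if m \<le> i then \<Prod>k<m. u i - u k else 0) * ndd u m (e j))"
      using ij by (simp add: L_def ndd_mat_def scalar_prod_def atLeast0LessThan)
    also have "\<dots> = (\<Sum>m\<le>i. ndd u m (e j) * (\<Prod>k<m. u i - u k))"
      using ij by (intro sum.mono_neutral_cong_right) auto
    finally show "A $$ (i, j) = (L * ndd_mat N e u) $$ (i, j)"
      using ij newton_interpolation[of u i "e j"] by (simp add: A_def)
  qed (auto simp: A_def L_def ndd_mat_def)
  then have "det A = det L * det (ndd_mat N e u)"
    using det_mult[of L N "ndd_mat N e u"] by (simp add: L_def ndd_mat_def)
  moreover have "det L = vsign N * vandermonde N u"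
  proof -
    have "det L = prod_list (diag_mat L)"
      by (rule det_lower_triangular[of N]) (auto simp: L_def)
    also have "\<dots> = (\<Prod>i<N. \<Prod>k<i. u i - u k)"
      by (simp add: L_def prod_list_diag_prod atLeast0LessThan)
    finally show ?thesis by (simp add: vandermonde_flip)
  qed
  moreover have "det A = (\<Sum>p | p permutes {..<N}. of_int (sign p) * (\<Prod>i<N. u i ^ e (p i)))"
    unfolding A_def det_mat_lessThan by simp
  ultimately show ?thesis by simp
qed

text \<open>At 1^N the entries are binomial coefficients of the exponents. A kernel vector of the
  transpose would be a polynomial of degree below N, written in the basis of binomials, with the N
  distinct roots e j. It is therefore zero, and its values at 0, 1, 2, ... force the coefficients to
  vanish one after the other.\<close>

lemma det_ndd_ones_ne_0:
  assumes inj: "inj_on e {..<N}"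
  shows "det (ndd_mat N e ones) \<noteq> 0"
proof
  assume "det (ndd_mat N e ones) = 0"
  then have "det (transpose_mat (ndd_mat N e ones)) = 0"
    using det_transpose[of "ndd_mat N e ones" N] by (simp add: ndd_mat_def)
  then obtain v where v: "v \<in> carrier_vec N" "v \<noteq> 0\<^sub>v N" "transpose_mat (ndd_mat N e ones) *\<^sub>v v = 0\<^sub>v N"
    using det_0_iff_vec_prod_zero_field[of "transpose_mat (ndd_mat N e ones)" N] by (auto simp: ndd_mat_def)
  define B where "B m = (\<Prod>k<m. [:- of_nat k, 1 :: complex:])" for m
  define P where "P = (\<Sum>m<N. Polynomial.smult (v $ m / fact m) (B m))"
  have Pn: "poly P (of_nat n) = (\<Sum>m<N. v $ m * of_nat (n choose m))" for n
    unfolding P_def poly_sum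
  proof (intro sum.cong refl)
    fix m
    have "of_nat (n choose m) = (\<Prod>i=0..<m. of_nat n - of_nat i) / (fact m :: complex)"
      by (simp add: binomial_gbinomial gbinomial_prod_rev)
    moreover have "poly (B m) (of_nat n) = (\<Prod>i=0..<m. of_nat n - of_nat i)"
      by (simp add: B_def poly_prod atLeast0LessThan)
    ultimately show "poly (Polynomial.smult (v $ m / fact m) (B m)) (of_nat n) = v $ m * of_nat (n choose m)"
      by simp
  qed
  have degB: "degree (B m) = m" for m
    by (simp add: B_def degree_prod_sum_eq)
  have "P = 0"
  proof (cases "N = 0")
    case False
    show ?thesis
    proof (rule poly_eqI_degree[where A = "(\<lambda>j. of_nat (e j)) ` {..<N}"])
      fix x assume "x \<in> (\<lambda>j. of_nat (e j) :: complex) ` {..<N}"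
      then obtain j where j: "j < N" "x = of_nat (e j)" by auto
      have "(transpose_mat (ndd_mat N e ones) *\<^sub>v v) $ j = (\<Sum>m<N. of_nat (e j choose m) * v $ m)"
        using j v(1) by (simp add: ndd_mat_def scalar_prod_def atLeast0LessThan ndd_ones)
      then show "poly P x = poly 0 x" using j v(3) by (simp add: Pn mult.commute)
    next
      have "card ((\<lambda>j. of_nat (e j) :: complex) ` {..<N}) = N"
        using inj by (subst card_image) (auto simp: inj_on_def)
      moreover have "degree P \<le> N - 1"
        unfolding P_def by (rule degree_sum_le) (auto intro!: order_trans[OF degree_smult_le] simp: degB)
      ultimately show "degree P < card ((\<lambda>j. of_nat (e j) :: complex) ` {..<N})"
        "degree (0 :: complex poly) < card ((\<lambda>j. of_nat (e j) :: complex) ` {..<N})"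
        using False by auto
    qed
  qed (simp add: P_def)
  have "v $ n = 0" if "n < N" for n
    using that
  proof (induction n rule: less_induct)
    case (less n)
    have "0 = (\<Sum>m<N. v $ m * of_nat (n choose m))" using Pn[of n] \<open>P = 0\<close> by simp
    also have "\<dots> = (\<Sum>m\<in>{n}. v $ m * of_nat (n choose m))"
      by (rule sum.mono_neutral_right) (use less in \<open>auto simp: linorder_neq_iff binomial_eq_0\<close>)
    finally show ?case by simp
  qed
  then have "v = 0\<^sub>v N" using v(1) by (intro eq_vecI) auto
  with v(2) show False by simp
qed

definition nodes :: "int list \<Rightarrow> nat \<Rightarrow> int" where
  "nodes l j = l ! j + int (length l) - 1 - int j"

definition kshift :: "int list \<Rightarrow> int" where
  "kshift l = (\<Sum>j<length l. \<bar>nodes l j\<bar>)"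

lemma kshift: "j < length l \<Longrightarrow> nodes l j + kshift l \<ge> 0"
  unfolding kshift_def using member_le_sum[of j "{..<length l}" "\<lambda>j. \<bar>nodes l j\<bar>"] by auto

text \<open>Dividing the determinant by the Vandermonde determinant row by row (Newton interpolation) gives a
  Laurent polynomial that agrees with the Schur function also where the Vandermonde determinant vanishes.
  The shift makes all exponents nonnegative.\<close>

definition schur_lp :: "int list \<Rightarrow> (nat \<Rightarrow> complex) \<Rightarrow> complex" where
  "schur_lp l u = vsign (length l) * (\<Prod>i<length l. u i powi (- kshift l))
     * det (ndd_mat (length l) (\<lambda>j. nat (nodes l j + kshift l)) u)"

lemma schur_num_eq:
  assumes nz: "\<And>i. i < length l \<Longrightarrow> u i \<noteq> 0"
  shows "schur_num l u = vandermonde (length l) u * schur_lp l u"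
proof -
  let ?N = "length l" and ?e = "\<lambda>j. nat (nodes l j + kshift l)"
  have "schur_num l u = (\<Sum>p | p permutes {..<?N}. of_int (sign p) * (\<Prod>i<?N. u i powi nodes l (p i)))"
    by (simp add: schur_num_def nodes_def Let_def)
  also have "\<dots> = (\<Sum>p | p permutes {..<?N}. of_int (sign p) * (\<Prod>i<?N. u i powi (- kshift l) * u i ^ ?e (p i)))"
  proof (intro sum.cong refl arg_cong2[where f = "(*)"] prod.cong)
    fix p i assume "p \<in> {p. p permutes {..<?N}}" "i \<in> {..<?N}"
    then have "p i < ?N" "u i \<noteq> 0" using nz by (auto simp: permutes_in_image[of _ "{..<length l}", simplified])
    then have "u i ^ ?e (p i) = u i powi (nodes l (p i) + kshift l)"
      using kshift[of "p i" l] by (simp add: power_int_def)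
    then show "u i powi nodes l (p i) = u i powi (- kshift l) * u i ^ ?e (p i)"
      using \<open>u i \<noteq> 0\<close> by (simp flip: power_int_add)
  qed
  also have "\<dots> = (\<Prod>i<?N. u i powi (- kshift l)) * (\<Sum>p | p permutes {..<?N}. of_int (sign p) * (\<Prod>i<?N. u i ^ ?e (p i)))"
    by (simp add: prod.distrib sum_distrib_left mult_ac)
  finally show ?thesis unfolding det_powers[where e = ?e] schur_lp_def by (simp only: mult_ac)
qed

text \<open>The limit in the definition of \<open>schur\<close> is meaningful only along a
  nontrivial filter. The line u + s (0, 1, 2, ...) leaves the zero set of the Vandermonde
  determinant for all small s other than 0.\<close>

lemma at_within_vandermonde_ne_bot:
  assumes V: "vandermonde N u = 0"
  shows "at u within {v. vandermonde N v \<noteq> 0} \<noteq> bot"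
proof
  assume bot: "at u within {v. vandermonde N v \<noteq> 0} = bot"
  define g where "g s = (\<lambda>i. u i + s * of_nat i)" for s :: complex
  have "continuous_on UNIV g" unfolding g_def
    by (intro continuous_on_coordinatewise_then_product continuous_intros)
  then have "isCont g 0" by (simp add: continuous_on_eq_continuous_at)
  then have lim: "(g \<longlongrightarrow> u) (at 0)" unfolding isCont_def by (simp add: g_def)
  have "\<forall>\<^sub>F s in at 0. g s i - g s j \<noteq> 0" if "i < j" for i j
  proof (cases "u i = u j")
    case True
    have "\<forall>\<^sub>F s in at (0 :: complex). s \<noteq> 0" by (simp add: eventually_at_filter)
    then show ?thesis by eventually_elim (use that True in \<open>auto simp: g_def\<close>)
  next
    case False
    have "((\<lambda>s. g s i - g s j) \<longlongrightarrow> u i - u j) (at 0)"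
      unfolding g_def by (auto intro!: tendsto_eq_intros)
    then show ?thesis using False by (intro tendsto_imp_eventually_ne) auto
  qed
  then have "\<forall>\<^sub>F s in at 0. \<forall>i\<in>{..<N}. \<forall>j\<in>{i<..<N}. g s i - g s j \<noteq> 0"
    by (intro eventually_ball_finite ballI) auto
  then have "\<forall>\<^sub>F s in at 0. g s \<in> {v. vandermonde N v \<noteq> 0} \<and> g s \<noteq> u"
    by eventually_elim (use V in \<open>auto simp: vandermonde_def\<close>)
  with lim have "filterlim g (at u within {v. vandermonde N v \<noteq> 0}) (at 0)"
    by (simp add: filterlim_at)
  then have "filterlim g bot (at (0 :: complex))" by (simp add: bot)
  then show False by (simp add: filterlim_def bot_unique filtermap_bot_iff)
qed

lemma tendsto_det_ndd:
  assumes "\<And>i. ((\<lambda>v. f v i) \<longlongrightarrow> u i) F"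
  shows "((\<lambda>v. det (ndd_mat N e (f v))) \<longlongrightarrow> det (ndd_mat N e u)) F"
proof -
  have "((\<lambda>v. ndd (f v) m n) \<longlongrightarrow> ndd u m n) F" for m n
  proof (induction m arbitrary: n)
    case (Suc m)
    note IH = Suc
    show ?case
    proof (induction n)
      case (Suc n)
      then show ?case using IH[of n] by (auto intro!: tendsto_intros assms)
    qed simp
  qed (auto intro!: tendsto_intros assms)
  then show ?thesis
    unfolding ndd_mat_def det_mat_lessThan by (auto intro!: tendsto_sum tendsto_mult tendsto_const tendsto_prod)
qed

lemma tendsto_schur_lp:
  assumes "\<And>i. ((\<lambda>v. f v i) \<longlongrightarrow> u i) F" "\<And>i. i < length l \<Longrightarrow> u i \<noteq> 0"
  shows "((\<lambda>v. schur_lp l (f v)) \<longlongrightarrow> schur_lp l u) F"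
  unfolding schur_lp_def using assms by (intro tendsto_intros tendsto_det_ndd tendsto_power_int) auto

lemma schur_eq_lp:
  assumes nz: "\<And>i. i < length l \<Longrightarrow> u i \<noteq> 0"
  shows "schur l u = schur_lp l u"
proof (cases "vandermonde (length l) u = 0")
  case False
  then show ?thesis using schur_num_eq[OF nz] by (simp add: schur_def)
next
  case True
  let ?F = "at u within {v. vandermonde (length l) v \<noteq> 0}"
  have coord: "((\<lambda>v. v i) \<longlongrightarrow> u i) ?F" for i
  proof -
    have "continuous_on UNIV (\<lambda>v :: nat \<Rightarrow> complex. v i)" by simp
    then have "((\<lambda>v. v i) \<longlongrightarrow> u i) (at u)" by (simp add: continuous_on_def)
    then show ?thesis by (rule tendsto_within_subset) simp
  qed
  have "\<forall>\<^sub>F v in ?F. \<forall>i\<in>{..<length l}. v i \<noteq> 0"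
    using nz by (intro eventually_ball_finite) (auto intro!: tendsto_imp_eventually_ne[OF coord])
  moreover have "\<forall>\<^sub>F v in ?F. vandermonde (length l) v \<noteq> 0"
    by (simp add: eventually_at_filter)
  ultimately have ev: "\<forall>\<^sub>F v in ?F. schur_lp l v = schur_num l v / vandermonde (length l) v"
  proof eventually_elim
    case (elim v)
    then have "schur_num l v = vandermonde (length l) v * schur_lp l v"
      by (intro schur_num_eq) auto
    then show ?case using elim by simp
  qed
  have "((\<lambda>v. schur_num l v / vandermonde (length l) v) \<longlongrightarrow> schur_lp l u) ?F"
    by (rule Lim_transform_eventually[OF tendsto_schur_lp[OF coord nz] ev])
  then have "Lim ?F (\<lambda>v. schur_num l v / vandermonde (length l) v) = schur_lp l u"
    by (intro tendsto_Lim at_within_vandermonde_ne_bot True)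
  then show ?thesis using True by (simp add: schur_def)
qed

lemma polydisc_ne_0: "u \<in> polydisc r \<Longrightarrow> r \<le> 1 \<Longrightarrow> u i \<noteq> 0"
  by (auto simp: polydisc_def dest!: spec[of _ i])

lemma nodes_inj:
  assumes "l \<in> signatures N"
  shows "inj_on (nodes l) {..<N}"
proof -
  have "l ! j \<le> l ! i" if "i < j" "j < N" for i j
    using assms that by (auto simp: signatures_def sorted_wrt_iff_nth_less)
  then have *: "nodes l j < nodes l i" if "i < j" "j < N" for i j
    using that by (fastforce simp: nodes_def)
  show ?thesis by (rule linorder_inj_onI) (use * in force)+
qed

lemma schur_ones_ne_0:
  assumes "l \<in> signatures N"
  shows "schur l ones \<noteq> 0"
proof -
  have N: "length l = N" using assms by (simp add: signatures_def)
  have "inj_on (\<lambda>j. nat (nodes l j + kshift l)) {..<N}"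
  proof (rule inj_onI)
    fix i j assume ij: "i \<in> {..<N}" "j \<in> {..<N}" "nat (nodes l i + kshift l) = nat (nodes l j + kshift l)"
    then have "nodes l i = nodes l j" using kshift[of i l] kshift[of j l] N by simp
    then show "i = j" using nodes_inj[OF assms] ij by (auto dest: inj_onD)
  qed
  then show ?thesis
    using det_ndd_ones_ne_0 by (subst schur_eq_lp) (auto simp: schur_lp_def N vsign_ne_0 ones_def)
qed


lemma taylor_ndd: "0 < r \<Longrightarrow> r \<le> 1 \<Longrightarrow> \<exists>c. \<forall>n. taylor n r (\<lambda>u. ndd u m k) c"
proof (induction m arbitrary: k)
  case 0
  then have "\<forall>n. taylor n r (\<lambda>u. ndd u 0 k) (mpowi 0 (int k))"
    using taylor_powi[of r _ 0 "int k"] by simp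
  then show ?case by blast
next
  case (Suc m)
  show ?case
  proof (induction k)
    case 0
    show ?case using taylor_const[of _ r 0] by (intro exI[of _ "mconst 0"]) simp
  next
    case (Suc k)
    obtain c where c: "\<And>n. taylor n r (\<lambda>u. ndd u m k) c" using Suc.prems Suc.IH \<open>\<And>k. 0 < r \<Longrightarrow> r \<le> 1 \<Longrightarrow> \<exists>c. \<forall>n. taylor n r (\<lambda>u. ndd u m k) c\<close>[of k] \<open>0 < r\<close> \<open>r \<le> 1\<close> by blast
    obtain d where d: "\<And>n. taylor n r (\<lambda>u. ndd u (Suc m) k) d" using Suc.IH by blast
    have "taylor n r (\<lambda>u. ndd u (Suc m) (Suc k)) (c + ucoord (Suc m) * d)" for n
      unfolding ndd.simps using \<open>0 < r\<close> \<open>r \<le> 1\<close> by (intro taylor_add taylor_mult taylor_coord c d)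
    then show ?case by blast
  qed
qed

lemma taylor_schur_lp:
  assumes r: "0 < r" "r \<le> 1"
  shows "\<exists>c. \<forall>n. taylor n r (schur_lp l) c"
proof -
  obtain c where c: "\<And>m k n. taylor n r (\<lambda>u. ndd u m k) (c m k)"
    using taylor_ndd[OF r] by metis
  let ?N = "length l" and ?e = "\<lambda>j. nat (nodes l j + kshift l)"
  have "taylor n r (schur_lp l) (mconst (vsign ?N) * (\<Prod>i<?N. mpowi i (- kshift l)) *
     (\<Sum>p | p permutes {..<?N}. mconst (of_int (sign p)) * (\<Prod>i<?N. c i (?e (p i)))))" for n
    unfolding schur_lp_def[abs_def] ndd_mat_def det_mat_lessThan prod.case
    by (intro taylor_mult taylor_const taylor_sum taylor_prod taylor_powi c r)
  then show ?thesis by blast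
qed

lemma mconst_of_int_sign: "mconst (of_int (sign p)) = of_int (sign p)"
  by (cases rule: sign_cases[of p]) (simp_all add: mconst_uminus)

lemma taylor_alternant:
  assumes r: "0 < r" "r \<le> 1"
  shows "taylor n r (\<lambda>u. \<Sum>p | p permutes {..<N}. of_int (sign p) * (\<Prod>i<N. u i powi x (p i))) (alt N x)"
  unfolding alt_def mconst_of_int_sign[symmetric]
  by (intro taylor_mult taylor_const taylor_sum taylor_prod taylor_powi r)

lemma taylor_vandermonde:
  assumes r: "0 < r" "r \<le> 1"
  shows "taylor n r (vandermonde N) (vdm N)"
proof -
  have "taylor n r (\<lambda>u. u i - u j) (ucoord i - ucoord j)" for i j
    using taylor_add[OF taylor_coord[OF r, of n i] taylor_mult[OF taylor_const[of n r "-1"] taylor_coord[OF r, of n j]]] r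
    by (simp add: mconst_uminus)
  then show ?thesis unfolding vandermonde_def[abs_def] vdm_def by (intro taylor_prod r)
qed

text \<open>For the exponents 0, ..., N - 1 the matrix \<open>ndd_mat\<close> is triangular with
  ones on the diagonal. In the form of an alternant, \<open>vdm\<close> visibly changes sign under
  exchanges.\<close>

lemma vdm_eq_alt: "vdm N = mconst (vsign N) * alt N int"
proof (rule taylor_unique)
  fix n
  show "taylor n 1 (vandermonde N) (vdm N)" by (rule taylor_vandermonde) auto
  have 1: "det (ndd_mat N (\<lambda>j. j) u) = 1" for u
  proof -
    have "det (ndd_mat N (\<lambda>j. j) u) = prod_list (diag_mat (ndd_mat N (\<lambda>j. j) u))"
      by (rule det_upper_triangular[of _ N]) (auto simp: ndd_mat_def upper_triangular_def ndd_eq_0)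
    then show ?thesis by (simp add: prod_list_diag_prod ndd_mat_def ndd_diag)
  qed
  have "vandermonde N u = vsign N * (\<Sum>p | p permutes {..<N}. of_int (sign p) * (\<Prod>i<N. u i powi int (p i)))" for u
    using det_powers[where N = N and u = u and e = "\<lambda>j. j"] vsign_square[of N] by (simp add: 1 flip: mult.assoc)
  then have "vandermonde N = (\<lambda>u. vsign N * (\<Sum>p | p permutes {..<N}. of_int (sign p) * (\<Prod>i<N. u i powi int (p i))))"
    by (rule ext)
  moreover have "taylor n 1 (\<lambda>u. vsign N * (\<Sum>p | p permutes {..<N}. of_int (sign p) * (\<Prod>i<N. u i powi int (p i))))
      (mconst (vsign N) * alt N int)"
    by (intro taylor_mult taylor_const taylor_alternant) auto
  ultimately show "taylor n 1 (vandermonde N) (mconst (vsign N) * alt N int)" by simp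
qed

lemma mswap_alt:
  assumes "a < N" "b < N" "a \<noteq> b"
  shows "mswap a b (alt N x) = - alt N x"
proof -
  have t: "tr a b permutes {..<N}" using assms by (intro permutes_swap_id) auto
  have "mswap a b (alt N x) = (\<Sum>p | p permutes {..<N}. of_int (sign p) * (\<Prod>i<N. mpowi (tr a b i) (x (p i))))"
    by (simp add: alt_def mswap_sum mswap_prod mconst_of_int_sign[symmetric])
  also have "\<dots> = (\<Sum>p | p permutes {..<N}. - of_int (sign (p \<circ> tr a b)) * (\<Prod>i<N. mpowi i (x ((p \<circ> tr a b) i))))"
  proof (intro sum.cong refl arg_cong2[where f = "(*)"])
    fix p assume "p \<in> {p. p permutes {..<N}}"
    then have "permutation p" using permutation_permutes by blast
    then show "of_int (sign p) = - (of_int (sign (p \<circ> tr a b)) :: mfps)"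
      using assms by (simp add: sign_compose permutation_swap_id sign_swap_id)
    show "(\<Prod>i<N. mpowi (tr a b i) (x (p i))) = (\<Prod>i<N. mpowi i (x ((p \<circ> tr a b) i)))"
      using prod.permute[OF t, of "\<lambda>i. mpowi i (x ((p \<circ> tr a b) i))"] by (simp add: o_def)
  qed
  also have "\<dots> = (\<Sum>p | p permutes {..<N}. - of_int (sign p) * (\<Prod>i<N. mpowi i (x (p i))))"
    by (rule sum.reindex_bij_witness[where i = "\<lambda>p. p \<circ> tr a b" and j = "\<lambda>p. p \<circ> tr a b"])
      (auto simp: o_assoc[symmetric] intro: permutes_compose[OF t])
  finally show ?thesis by (simp add: alt_def sum_negf)
qed

text \<open>Links the analytic Schur function to the formal eigenvalue relation. The power N^(k+1)
  collects the average over the indices and the scaling of the nodes by 1/N.\<close>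

theorem normalized_schur_taylor:
  assumes l: "l \<in> signatures N" and r: "0 < r" "r \<le> 1" and N: "N > 0"
  shows "\<exists>c. (\<forall>n. taylor n r (\<lambda>u. schur l u / schur l ones) c) \<and> coef c {#} = 1 \<and> symm N c \<and>
    (\<forall>k. (\<Sum>i<N. (dunkl N i ^^ k) c) = mconst (of_real (real N ^ Suc k * PP_moment 1 l k)) * c)"
proof -
  have len: "length l = N" using l by (simp add: signatures_def)
  define z where "z = 1 / schur l ones"
  have z: "z \<noteq> 0" using schur_ones_ne_0[OF l] by (simp add: z_def)
  obtain d where d: "\<And>n. taylor n r (schur_lp l) d" using taylor_schur_lp[OF r] by blast
  \<comment> \<open>Both series expand the numerator determinant, as a product with the Vandermonde
    determinant and directly, so they agree by uniqueness.\<close>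
  have vd: "vdm N * d = alt N (nodes l)"
  proof (rule taylor_unique)
    fix n
    show "taylor n r (\<lambda>u. vandermonde N u * schur_lp l u) (vdm N * d)"
      by (intro taylor_mult taylor_vandermonde d r)
    show "taylor n r (\<lambda>u. vandermonde N u * schur_lp l u) (alt N (nodes l))"
    proof (rule taylor_cong[OF taylor_alternant])
      fix u assume "u \<in> polydisc r"
      then show "(\<Sum>p | p permutes {..<N}. of_int (sign p) * (\<Prod>i<N. u i powi nodes l (p i))) = vandermonde N u * schur_lp l u"
        using schur_num_eq[of l u] polydisc_ne_0[of u r] r by (simp add: schur_num_def nodes_def len Let_def)
    qed (use r in auto)
  qed
  have symd: "symm N d"
    unfolding symm_def
  proof (intro allI impI)
    fix a b assume ab: "a < N" "b < N"
    show "mswap a b d = d"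
    proof (cases "a = b")
      case True
      then show ?thesis by (intro mfps_eqI) (simp add: coef_mswap)
    next
      case False
      \<comment> \<open>Both the alternant and \<open>vdm N\<close> change sign, so their quotient
        is invariant after cancellation.\<close>
      have "mswap a b (vdm N) = - vdm N" by (simp add: vdm_eq_alt mswap_alt ab False)
      moreover have "mswap a b (vdm N * d) = - (vdm N * d)" by (simp only: vd mswap_alt ab False not_False_eq_True)
      ultimately have "vdm N * mswap a b d = vdm N * d" by simp
      then show ?thesis using vdm_ne_0 by simp
    qed
  qed
  define c where "c = mconst z * d"
  have tc: "taylor n r (\<lambda>u. schur l u / schur l ones) c" for n
  proof (rule taylor_cong)
    show "taylor n r (\<lambda>u. z * schur_lp l u) c"
      unfolding c_def by (intro taylor_mult taylor_const d r)
    show "z * schur_lp l u = schur l u / schur l ones" if "u \<in> polydisc r" for u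
      using schur_eq_lp[of l u] polydisc_ne_0[OF that] r by (simp add: z_def)
  qed (rule r)
  have c0: "coef c {#} = 1"
    using taylor_ones[OF tc[of 0]] schur_ones_ne_0[OF l] by simp
  have symc: "symm N c" using symd by (simp add: symm_def c_def)
  have Ypow: "(dunkl N i ^^ k) (mconst z * f) = mconst z * (dunkl N i ^^ k) f" for i k f
    by (induction k) (simp_all add: dunkl_mconst_mult)
  have ev: "(\<Sum>m<N. (\<Prod>s\<in>{..<N} - {m}. (of_int (nodes l m - nodes l s) - 1) / of_int (nodes l m - nodes l s))
      * of_int (nodes l m) ^ k) = complex_of_real (real N ^ Suc k * PP_moment 1 l k)" for k
  proof -
    have "real N ^ Suc k * PP_moment 1 l k = (\<Sum>m<N. PP_weight 1 l m * real_of_int (nodes l m) ^ k)"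
      using N by (simp add: PP_moment_def len nodes_def power_divide sum_distrib_left mult_ac)
    moreover have "PP_weight 1 l m = (\<Prod>s\<in>{..<N} - {m}. (of_int (nodes l m - nodes l s) - 1) / of_int (nodes l m - nodes l s))" for m
    proof -
      have "(l ! m - int m) - (l ! s - int s) = nodes l m - nodes l s" for s by (simp add: nodes_def)
      then show ?thesis unfolding PP_weight_def Let_def len by simp
    qed
    ultimately show ?thesis by simp
  qed
  have "(\<Sum>i<N. (dunkl N i ^^ k) c) = mconst (of_real (real N ^ Suc k * PP_moment 1 l k)) * c" for k
    unfolding c_def Ypow sum_distrib_left[symmetric] sum_dunkl_pow_eigen[OF nodes_inj[OF l] symd vd] ev
    by (rule mult.left_commute)
  then show ?thesis using tc c0 symc by blast
qed

subsection \<open>Expansion of the Schur generating function\<close>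

lemma has_sum_pmf: "(pmf p has_sum measure_pmf.prob p A) A"
proof -
  have s: "Infinite_Set_Sum.abs_summable_on (pmf p) A" by (rule pmf_abs_summable)
  then have "pmf p summable_on A"
    using abs_summable_equivalent[of "pmf p" A] by simp
  moreover have "infsum (pmf p) A = measure_pmf.prob p A"
    using infsetsum_infsum[OF s] by (simp add: measure_pmf_conv_infsetsum)
  ultimately show ?thesis using has_sum_infsum by fastforce
qed

lemma has_sum_finite_sum:
  fixes f :: "'b \<Rightarrow> 'a \<Rightarrow> 'c :: {topological_comm_monoid_add}"
  assumes "\<And>j. j \<in> J \<Longrightarrow> (f j has_sum s j) A"
  shows "((\<lambda>x. \<Sum>j\<in>J. f j x) has_sum (\<Sum>j\<in>J. s j)) A"
  using assms by (induction J rule: infinite_finite_induct) (auto intro!: has_sum_add)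

text \<open>Coefficientwise form of g = sum_l w_l f_l. Each coefficient of
  \<open>dunkl N i f\<close> is a finite combination of coefficients of f, so the operators pass
  through the infinite sum without further convergence arguments.\<close>

definition mixes :: "('a \<Rightarrow> complex) \<Rightarrow> ('a \<Rightarrow> mfps) \<Rightarrow> mfps \<Rightarrow> bool" where
  "mixes w f g \<longleftrightarrow> (\<forall>M. ((\<lambda>l. w l * coef (f l) M) has_sum coef g M) UNIV)"

lemma mixesD: "mixes w f g \<Longrightarrow> ((\<lambda>l. w l * coef (f l) M) has_sum coef g M) UNIV"
  by (simp add: mixes_def)

lemma mixes_add: "mixes w f g \<Longrightarrow> mixes w f' g' \<Longrightarrow> mixes w (\<lambda>l. f l + f' l) (g + g')"
  unfolding mixes_def by (auto simp: distrib_left intro: has_sum_add)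

lemma mixes_sum: "(\<And>j. j \<in> J \<Longrightarrow> mixes w (f j) (g j)) \<Longrightarrow> mixes w (\<lambda>l. \<Sum>j\<in>J. f j l) (\<Sum>j\<in>J. g j)"
  unfolding mixes_def coef_sum sum_distrib_left by (auto intro!: has_sum_finite_sum)

lemma mixes_ucoord: 
  assumes "mixes w f g"
  shows "mixes w (\<lambda>l. ucoord i * f l) (ucoord i * g)"
proof -
  have "mixes w (\<lambda>l. mvar i * f l) (mvar i * g)"
    using assms unfolding mixes_def coef_mvar_mult by (auto simp: has_sum_0)
  then show ?thesis using mixes_add[OF assms] by (simp add: distrib_right)
qed

lemma mixes_mderiv: "mixes w f g \<Longrightarrow> mixes w (\<lambda>l. mderiv i (f l)) (mderiv i g)"
  unfolding mixes_def coef_mderiv mult.left_commute[of "w _"] by (intro allI has_sum_cmult_right) simp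

lemma has_sum_diff:
  fixes f g :: "'a \<Rightarrow> complex"
  assumes "(f has_sum a) A" "(g has_sum b) A"
  shows "((\<lambda>x. f x - g x) has_sum (a - b)) A"
  using has_sum_add[OF assms(1) has_sum_cmult_right[OF assms(2), of "-1"]] by simp

lemma mixes_mddiff: "mixes w f g \<Longrightarrow> mixes w (\<lambda>l. mddiff i j (f l)) (mddiff i j g)"
  unfolding mixes_def coef_mddiff sum_distrib_left coef_simps coef_mswap right_diff_distrib
  by (auto intro!: has_sum_finite_sum has_sum_diff)

lemma mixes_dunkl: "mixes w f g \<Longrightarrow> mixes w (\<lambda>l. dunkl N i (f l)) (dunkl N i g)"
  unfolding dunkl_def by (intro mixes_ucoord mixes_add mixes_mderiv mixes_sum mixes_mddiff)

lemma mixes_dunkl_pow: "mixes w f g \<Longrightarrow> mixes w (\<lambda>l. (dunkl N i ^^ k) (f l)) ((dunkl N i ^^ k) g)"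
  by (induction k) (auto intro: mixes_dunkl)

text \<open>Neighbourhoods uniform in all coordinates, matching the domain in \<open>taylor\<close>;
  those of the product topology restrict only finitely many coordinates.\<close>

definition near_ones :: "(nat \<Rightarrow> complex) filter" where
  "near_ones = (INF r\<in>{0<..}. principal (polydisc r))"

lemma eventually_near_ones: "eventually P near_ones \<longleftrightarrow> (\<exists>r>0. \<forall>u\<in>polydisc r. P u)"
  unfolding near_ones_def
proof (subst eventually_INF_base)
  fix a b :: real assume "a \<in> {0<..}" "b \<in> {0<..}"
  then show "\<exists>x\<in>{0<..}. principal (polydisc x) \<le> inf (principal (polydisc a)) (principal (polydisc b))"
    using polydisc_mono by (intro bexI[of _ "min a b"]) (auto simp: polydisc_def)
qed (auto simp: eventually_principal)

lemma tendsto_coord_near_ones: "((\<lambda>u. u i) \<longlongrightarrow> ones i) near_ones"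
  unfolding tendsto_iff eventually_near_ones by (auto simp: polydisc_def dist_norm ones_def)

lemma dunkl_add: "dunkl N i (f + g) = dunkl N i f + dunkl N i g"
proof -
  have "(\<Sum>j\<in>{..<N} - {i}. mddiff i j (f + g)) = (\<Sum>j\<in>{..<N} - {i}. mddiff i j f) + (\<Sum>j\<in>{..<N} - {i}. mddiff i j g)"
    unfolding sum.distrib[symmetric] by (rule sum.cong) (auto simp: mddiff_add)
  then show ?thesis by (simp add: dunkl_def algebra_simps)
qed

lemma dunkl_pow_mconst_mult: "(dunkl N i ^^ k) (mconst z * f) = mconst z * (dunkl N i ^^ k) f"
  by (induction k) (simp_all add: dunkl_mconst_mult)

lemma dunkl_pow_sum: "(dunkl N i ^^ k) (sum f A) = (\<Sum>x\<in>A. (dunkl N i ^^ k) (f x))"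
proof -
  have a: "(dunkl N i ^^ k) (f + g) = (dunkl N i ^^ k) f + (dunkl N i ^^ k) g" for f g
    by (induction k) (auto simp: dunkl_add)
  have z: "(dunkl N i ^^ k) 0 = 0" using dunkl_pow_mconst_mult[where N = N and i = i and k = k and z = 0 and f = 0] by simp
  show ?thesis by (induction A rule: infinite_finite_induct) (auto simp: a z)
qed

text \<open>Applying the two operator sums to the series of the generating function multiplies the
  part of each signature by two eigenvalues. As all normalized Schur functions have constant term 1,
  the constant term of the result is the expectation of the product of the two moments.\<close>

theorem SGF_expansion:
  assumes N: "N > 0" and supp: "set_pmf R \<subseteq> signatures N"
    and unif: "\<exists>\<epsilon>>0. uniform_limit {u. \<forall>i<N. cmod (u i - 1) < \<epsilon>}
                 (\<lambda>F u. \<Sum>l\<in>F. schur_term R l u) (SGF R) (finite_subsets_at_top UNIV)"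
  shows "\<exists>S F r. r > 0 \<and> (\<forall>n. taylor n r (\<lambda>u. Ln (SGF R u) / of_nat N) F) \<and> symm N S \<and> coef S {#} = 1 \<and>
     (\<forall>i. mderiv i S = mconst (of_nat N) * (mderiv i F * S)) \<and>
     (\<forall>k k'. ((\<lambda>l. pmf R l * (PP_moment 1 l k * PP_moment 1 l k')) has_sum
        Re (coef (\<Sum>i<N. (dunkl N i ^^ k) (\<Sum>j<N. (dunkl N j ^^ k') S)) {#} / of_nat N ^ (k + k' + 2))) UNIV)"
proof -
  obtain \<epsilon> where \<epsilon>: "\<epsilon> > 0" and ul0: "uniform_limit {u. \<forall>i<N. cmod (u i - 1) < \<epsilon>}
       (\<lambda>F u. \<Sum>l\<in>F. schur_term R l u) (SGF R) (finite_subsets_at_top UNIV)" using unif by blast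
  define r where "r = min \<epsilon> 1"
  have r: "0 < r" "r \<le> 1" "r \<le> \<epsilon>" using \<epsilon> by (auto simp: r_def)
  have ul: "uniform_limit (polydisc r) (\<lambda>F u. \<Sum>l\<in>F. schur_term R l u) (SGF R) (finite_subsets_at_top UNIV)"
    by (rule uniform_limit_on_subset[OF ul0]) (use r in \<open>auto simp: polydisc_def intro: less_le_trans\<close>)
  define good where "good l c \<longleftrightarrow> (\<forall>n. taylor n r (\<lambda>u. schur l u / schur l ones) c) \<and> coef c {#} = 1 \<and> symm N c \<and>
    (\<forall>k. (\<Sum>i<N. (dunkl N i ^^ k) c) = mconst (of_real (real N ^ Suc k * PP_moment 1 l k)) * c)" for l c
  have "\<forall>l. \<exists>c. l \<in> signatures N \<longrightarrow> good l c"
    unfolding good_def using normalized_schur_taylor[OF _ r(1,2) N] by blast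
  then obtain c where c: "\<And>l. l \<in> signatures N \<Longrightarrow> good l (c l)" by metis
  define w where "w l = complex_of_real (pmf R l)" for l
  have w0: "l \<in> signatures N" if "w l \<noteq> 0" for l
    using that supp by (auto simp: w_def set_pmf_eq)
  have t1: "taylor n r (schur_term R l) (mconst (w l) * c l)" for n l
  proof (cases "w l = 0")
    case True
    then have "schur_term R l = (\<lambda>_. 0)" by (auto simp: schur_term_def w_def)
    then show ?thesis using True taylor_const[of n r 0] by simp
  next
    case False
    then have "taylor n r (\<lambda>u. schur l u / schur l ones) (c l)" using c[OF w0] by (simp add: good_def)
    then show ?thesis
      unfolding schur_term_def[abs_def] w_def by (intro taylor_mult taylor_const r)
  qed
  have t: "taylor n r (\<lambda>u. \<Sum>l\<in>F. schur_term R l u) (\<Sum>l\<in>F. mconst (w l) * c l)" for n F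
    by (intro taylor_sum t1 r)
  obtain S where S: "\<And>n. taylor n (r / 2) (SGF R) S"
    and lim: "\<And>M. ((\<lambda>F. coef (\<Sum>l\<in>F. mconst (w l) * c l) M) \<longlongrightarrow> coef S M) (finite_subsets_at_top UNIV)"
    using taylor_uniform_limit[OF ul t finite_subsets_at_top_neq_bot, of "r / 2"] r by auto
  have mix: "mixes w c S"
    unfolding mixes_def has_sum_def using lim by (simp add: coef_sum)
  have S0: "coef S {#} = 1"
  proof -
    have "((\<lambda>l. w l * coef (c l) {#}) has_sum 1) UNIV"
    proof -
      have "w l * coef (c l) {#} = complex_of_real (pmf R l)" for l
        using c[OF w0, of l] by (cases "w l = 0") (auto simp: good_def w_def)
      then show ?thesis using has_sum_of_real[OF has_sum_pmf[of R UNIV], where 'a = complex] by simp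
    qed
    then show ?thesis using has_sum_unique[OF mixesD[OF mix]] by blast
  qed
  have symS: "symm N S"
    unfolding symm_def
  proof (intro allI impI mfps_eqI)
    fix a b M assume ab: "a < N" "b < N"
    have "w l * coef (c l) (image_mset (tr a b) M) = w l * coef (c l) M" for l
    proof (cases "w l = 0")
      case False
      then have "mswap a b (c l) = c l" using c[OF w0, of l] ab by (auto simp: good_def symm_def)
      then show ?thesis by (metis coef_mswap)
    qed simp
    then have "((\<lambda>l. w l * coef (c l) M) has_sum coef S (image_mset (tr a b) M)) UNIV"
      using mixesD[OF mix, of "image_mset (tr a b) M"] by (simp only:)
    then show "coef (mswap a b S) M = coef S M"
      using has_sum_unique mixesD[OF mix, of M] unfolding coef_mswap by blast
  qed
  \<comment> \<open>\<open>Ln\<close> needs the generating function to be close to 1. One finite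
    partial sum within 1/4 uniformly, together with its continuity at 1^N, gives a distance below
    3/4.\<close>
  have "\<exists>\<delta>>0. \<forall>u\<in>polydisc \<delta>. cmod (SGF R u - 1) < 1"
  proof -
    have "\<forall>\<^sub>F F in finite_subsets_at_top UNIV. \<forall>u\<in>polydisc r. dist (\<Sum>l\<in>F. schur_term R l u) (SGF R u) < 1/4"
      by (rule uniform_limitD[OF ul]) simp
    from eventually_happens'[OF finite_subsets_at_top_neq_bot this]
    obtain F where F: "\<And>u. u \<in> polydisc r \<Longrightarrow> dist (\<Sum>l\<in>F. schur_term R l u) (SGF R u) < 1/4"
      by blast
    have ev1: "\<forall>\<^sub>F u in near_ones. schur_lp l u = schur l u" for l
      unfolding eventually_near_ones
      by (intro exI[of _ 1] conjI ballI) (use polydisc_ne_0[of _ 1] in \<open>auto simp: schur_eq_lp\<close>)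
    have "(schur_lp l \<longlongrightarrow> schur_lp l ones) near_ones" for l
      by (rule tendsto_schur_lp[OF tendsto_coord_near_ones]) (simp add: ones_def)
    moreover have "schur_lp l ones = schur l ones" for l by (simp add: schur_eq_lp ones_def)
    ultimately have lims: "(schur l \<longlongrightarrow> schur l ones) near_ones" for l
      using Lim_transform_eventually[OF _ ev1[of l]] by simp
    have "(schur_term R l \<longlongrightarrow> schur_term R l ones) near_ones" for l
      unfolding schur_term_def[abs_def] divide_inverse by (intro tendsto_mult tendsto_const lims)
    then have "((\<lambda>u. \<Sum>l\<in>F. schur_term R l u) \<longlongrightarrow> (\<Sum>l\<in>F. schur_term R l ones)) near_ones"
      by (intro tendsto_sum)
    then have "\<forall>\<^sub>F u in near_ones. dist (\<Sum>l\<in>F. schur_term R l u) (\<Sum>l\<in>F. schur_term R l ones) < 1/4"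
      by (rule tendstoD) simp
    then obtain \<delta> where \<delta>: "\<delta> > 0" "\<And>u. u \<in> polydisc \<delta> \<Longrightarrow> dist (\<Sum>l\<in>F. schur_term R l u) (\<Sum>l\<in>F. schur_term R l ones) < 1/4"
      unfolding eventually_near_ones by blast
    have "cmod (SGF R u - 1) < 1" if "u \<in> polydisc (min \<delta> r)" for u
    proof -
      have "u \<in> polydisc \<delta>" "u \<in> polydisc r" "ones \<in> polydisc r"
        using that polydisc_mono[of "min \<delta> r" \<delta>] polydisc_mono[of "min \<delta> r" r] ones_in_polydisc[OF r(1)] by auto
      moreover have "SGF R ones = 1" using taylor_ones[OF S[of 0]] S0 by simp
      ultimately have "dist (SGF R u) 1 < 1/4 + 1/4 + 1/4"
        using F[of u] F[of ones] \<delta>(2)[of u]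
          dist_triangle[of "SGF R u" 1 "\<Sum>l\<in>F. schur_term R l u"]
          dist_triangle[of "\<Sum>l\<in>F. schur_term R l u" 1 "\<Sum>l\<in>F. schur_term R l ones"]
        by (simp add: dist_commute)
      then show ?thesis by (simp add: dist_norm)
    qed
    then show ?thesis using \<delta>(1) r(1) by (intro exI[of _ "min \<delta> r"]) auto
  qed
  then obtain \<delta> where \<delta>: "\<delta> > 0" "\<And>u. u \<in> polydisc \<delta> \<Longrightarrow> cmod (SGF R u - 1) < 1" by blast
  define r2 where "r2 = min \<delta> (r / 2)"
  have r2: "r2 > 0" "r2 \<le> \<delta>" "r2 \<le> r / 2" using \<delta>(1) r by (auto simp: r2_def)
  obtain F where F: "\<And>n. taylor n r2 (\<lambda>u. Ln (SGF R u) / of_nat N) F" "\<And>i. mderiv i S = mconst (of_nat N) * (mderiv i F * S)"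
  proof -
    have S1: "SGF R ones = 1" using taylor_ones[OF S[of 0]] S0 by simp
    have nr: "cmod (SGF R u - 1) < 1" if "u \<in> polydisc r2" for u
      using \<delta>(2) polydisc_mono[OF r2(2)] that by blast
    show ?thesis using taylor_log[OF taylor_mono[OF S r2(3)] r2(1) S1 nr N] that by blast
  qed
  have hs: "((\<lambda>l. pmf R l * (PP_moment 1 l k * PP_moment 1 l k')) has_sum
        Re (coef (\<Sum>i<N. (dunkl N i ^^ k) (\<Sum>j<N. (dunkl N j ^^ k') S)) {#} / of_nat N ^ (k + k' + 2))) UNIV" for k k'
  proof -
    have "mixes w (\<lambda>l. \<Sum>i<N. (dunkl N i ^^ k) (\<Sum>j<N. (dunkl N j ^^ k') (c l))) (\<Sum>i<N. (dunkl N i ^^ k) (\<Sum>j<N. (dunkl N j ^^ k') S))"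
      by (intro mixes_sum mixes_dunkl_pow mix)
    then have "((\<lambda>l. w l * coef (\<Sum>i<N. (dunkl N i ^^ k) (\<Sum>j<N. (dunkl N j ^^ k') (c l))) {#}) has_sum
       coef (\<Sum>i<N. (dunkl N i ^^ k) (\<Sum>j<N. (dunkl N j ^^ k') S)) {#}) UNIV" by (rule mixesD)
    from has_sum_cmult_right[OF this, of "1 / of_nat N ^ (k + k' + 2)"]
    have 1: "((\<lambda>l. 1 / of_nat N ^ (k + k' + 2) * (w l * coef (\<Sum>i<N. (dunkl N i ^^ k) (\<Sum>j<N. (dunkl N j ^^ k') (c l))) {#})) has_sum
       coef (\<Sum>i<N. (dunkl N i ^^ k) (\<Sum>j<N. (dunkl N j ^^ k') S)) {#} / of_nat N ^ (k + k' + 2)) UNIV" by simp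
    have 2: "1 / of_nat N ^ (k + k' + 2) * (w l * coef (\<Sum>i<N. (dunkl N i ^^ k) (\<Sum>j<N. (dunkl N j ^^ k') (c l))) {#})
      = complex_of_real (pmf R l * (PP_moment 1 l k * PP_moment 1 l k'))" for l
    proof (cases "w l = 0")
      case False
      then have g: "good l (c l)" using c w0 by blast
      then have "(\<Sum>i<N. (dunkl N i ^^ k) (\<Sum>j<N. (dunkl N j ^^ k') (c l)))
         = mconst (of_real (real N ^ Suc k' * PP_moment 1 l k')) * (mconst (of_real (real N ^ Suc k * PP_moment 1 l k)) * c l)"
        by (simp only: good_def dunkl_pow_mconst_mult sum_distrib_left[symmetric])
      then have "coef (\<Sum>i<N. (dunkl N i ^^ k) (\<Sum>j<N. (dunkl N j ^^ k') (c l))) {#}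
          = of_real (real N ^ Suc k' * PP_moment 1 l k') * of_real (real N ^ Suc k * PP_moment 1 l k)"
        using g by (simp add: good_def coef_mconst)
      then show ?thesis using N by (simp add: w_def power_add power2_eq_square)
    qed (simp add: w_def)
    show ?thesis using has_sum_Re[OF 1] unfolding 2 by simp
  qed
  show ?thesis using r2(1) F symS S0 hs by blast
qed

subsection \<open>Convergence for q = 1\<close>

lemma coef_mswap_empty [simp]: "coef (mswap a b f) {#} = coef f {#}"
  by (simp add: coef_mswap)

lemma dunkl_dunkl_pow_mult_exp:
  assumes S: "symm N S" "\<And>i. mderiv i S = mconst (of_nat N) * (g i * S)" and "i < N" "j < N"
  shows "(dunkl N i ^^ k) ((dunkl N j ^^ k') S) = mconst (of_nat N ^ (k + k')) * (S * (dunkl_conj N g i ^^ k) ((dunkl_conj N g j ^^ k') 1))"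
  using dunkl_pow_mult_exp[where N = N and S = S and i = j and g = g and k = k' and z = 1 and f = 1]
    dunkl_pow_mult_exp[where N = N and S = S and i = i and g = g and k = k and z = "of_nat N ^ k'" and f = "(dunkl_conj N g j ^^ k') 1"] assms
  by (simp add: power_add mult.commute)

text \<open>Exchanging variables permutes the operators and fixes constant terms, so a pair of
  indices matters only through being equal or distinct. The double sum over N^2 pairs thus reduces
  to two numbers.\<close>

lemma dunkl_conj_dunkl_conj_pow_coef_symmetric:
  fixes g :: "nat \<Rightarrow> mfps" and k k' N :: nat
  assumes gsym: "\<And>a b i. a < N \<Longrightarrow> b < N \<Longrightarrow> i < N \<Longrightarrow> mswap a b (g i) = g (tr a b i)"
    and ij: "i < N" "j < N"
  defines "t \<equiv> \<lambda>i j. coef ((dunkl_conj N g i ^^ k) ((dunkl_conj N g j ^^ k') 1)) {#}"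
  shows "t i j = (if i = j then t 0 0 else t 0 1)"
proof -
  have mswap: "t a b = t (tr c d a) (tr c d b)" if "a < N" "b < N" "c < N" "d < N" for a b c d
  proof -
    have "coef (mswap c d ((dunkl_conj N g a ^^ k) ((dunkl_conj N g b ^^ k') 1))) {#} = t (tr c d a) (tr c d b)"
      using that by (simp add: mswap_dunkl_conj_pow gsym t_def)
    then show ?thesis by (simp add: t_def)
  qed
  have N: "0 < N" using ij by simp
  show ?thesis
  proof (cases "i = j")
    case True
    then show ?thesis using mswap[of i i 0 i] ij N by simp
  next
    case False
    then have "1 < N" using ij by linarith
    define j' where "j' = tr 0 i j"
    have j': "j' \<noteq> 0" "j' < N" using False ij by (auto simp: j'_def Transposition.transpose_def)
    have "t i j = t 0 j'" using mswap[of i j 0 i] ij N by (simp add: j'_def)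
    also have "t 0 j' = t 0 1" using mswap[of 0 j' 1 j'] j' N \<open>1 < N\<close> by simp
    finally show ?thesis using False by simp
  qed
qed

lemma sum_offdiag:
  assumes "\<And>i j. i < N \<Longrightarrow> j < N \<Longrightarrow> f i j = (if i = j then x else y)"
  shows "(\<Sum>i<N. \<Sum>j<N. f i j) = (of_nat N * x + of_nat N * (of_nat N - 1) * y :: 'a :: comm_ring_1)"
proof -
  have "(\<Sum>j<N. f i j) = x + (of_nat N - 1) * y" if "i < N" for i
  proof -
    have "(\<Sum>j<N. f i j) = (\<Sum>j<N. y + (if i = j then x - y else 0))"
      by (rule sum.cong) (use assms that in auto)
    also have "\<dots> = of_nat N * y + (x - y)" using that by (simp add: sum.distrib)
    finally show ?thesis by (simp add: algebra_simps)
  qed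
  then have "(\<Sum>i<N. \<Sum>j<N. f i j) = (\<Sum>i<N. x + (of_nat N - 1) * y)" by (intro sum.cong) auto
  then show ?thesis by (simp add: algebra_simps)
qed

definition psi_fps :: "(nat \<Rightarrow> real) \<Rightarrow> real fps" where
  "psi_fps a = Abs_fps (\<lambda>k. a (Suc k) / fact k)"

definition limit_moment :: "(nat \<Rightarrow> real) \<Rightarrow> nat \<Rightarrow> real" where
  "limit_moment a k = fps_nth ((dunkl_lim1 (psi_fps a) ^^ k) 1) 0"

context
  fixes \<rho> :: "nat \<Rightarrow> int list pmf" and a :: "nat \<Rightarrow> real"
  assumes supp: "\<And>N. set_pmf (\<rho> N) \<subseteq> signatures N"
    and unif: "\<And>N. \<exists>\<epsilon>>0. uniform_limit {u. \<forall>i<N. cmod (u i - 1) < \<epsilon>}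
                 (\<lambda>F u. \<Sum>l\<in>F. schur_term (\<rho> N) l u) (SGF (\<rho> N))
                 (finite_subsets_at_top UNIV)"
    and diag: "\<And>k i0. k \<ge> 1 \<Longrightarrow>
        (\<lambda>N. pdiffs (replicate k i0) (\<lambda>u. Ln (SGF (\<rho> N) u) / of_nat N) ones)
          \<longlonglongrightarrow> complex_of_real (a k)"
    and mixed: "\<And>is. card (set is) \<ge> 2 \<Longrightarrow>
        (\<lambda>N. pdiffs is (\<lambda>u. Ln (SGF (\<rho> N) u) / of_nat N) ones) \<longlonglongrightarrow> 0"
begin

theorem PP1_second_moments:
  "\<exists>m. (\<forall>N>0. ((\<lambda>l. pmf (\<rho> N) l * (PP_moment 1 l k * PP_moment 1 l k')) has_sum m N) UNIV) \<and>
     m \<longlonglongrightarrow> limit_moment a k * limit_moment a k'"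
proof -
  define expansion where "expansion N S F r \<longleftrightarrow> (\<forall>n. taylor n r (\<lambda>u. Ln (SGF (\<rho> N) u) / of_nat N) F) \<and> symm N S \<and> coef S {#} = 1 \<and>
     (\<forall>i. mderiv i S = mconst (of_nat N) * (mderiv i F * S)) \<and>
     (\<forall>k k'. ((\<lambda>l. pmf (\<rho> N) l * (PP_moment 1 l k * PP_moment 1 l k')) has_sum
        Re (coef (\<Sum>i<N. (dunkl N i ^^ k) (\<Sum>j<N. (dunkl N j ^^ k') S)) {#} / of_nat N ^ (k + k' + 2))) UNIV)" for N :: nat and S F :: mfps and r :: real
  have "\<forall>N. \<exists>S F r. N > 0 \<longrightarrow> expansion N S F r"
    unfolding expansion_def using SGF_expansion[OF _ supp unif] by blast
  then obtain S F r where ex: "\<And>N. N > 0 \<Longrightarrow> expansion N (S N) (F N) (r N)" by metis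
  have SF: "\<And>N n. N > 0 \<Longrightarrow> taylor n (r N) (\<lambda>u. Ln (SGF (\<rho> N) u) / of_nat N) (F N)"
    "\<And>N. N > 0 \<Longrightarrow> symm N (S N)" "\<And>N. N > 0 \<Longrightarrow> coef (S N) {#} = 1"
    "\<And>N i. N > 0 \<Longrightarrow> mderiv i (S N) = mconst (of_nat N) * (mderiv i (F N) * S N)"
    "\<And>N k k'. N > 0 \<Longrightarrow> ((\<lambda>l. pmf (\<rho> N) l * (PP_moment 1 l k * PP_moment 1 l k')) has_sum
        Re (coef (\<Sum>i<N. (dunkl N i ^^ k) (\<Sum>j<N. (dunkl N j ^^ k') (S N))) {#} / of_nat N ^ (k + k' + 2))) UNIV"
    using ex unfolding expansion_def by simp_all
  define g where "g N i = mderiv i (F N)" for N i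
  have S_ne: "S N \<noteq> 0" if "N > 0" for N
    using SF(3)[OF that] by auto
  have gsym: "mswap c d (g N i) = g N (tr c d i)" if "c < N" "d < N" "i < N" for N c d i
  proof -
    have N: "N > 0" using that by simp
    have sS: "mswap c d (S N) = S N" using SF(2)[OF N] that by (simp add: symm_mswap)
    \<comment> \<open>Exchanging indices in d_i S = N g_i S, with S symmetric, yields the equation
      of the exchanged index; cancelling S then transfers the symmetry to the g_i.\<close>
    have A: "mderiv (tr c d i) (S N) = mconst (of_nat N) * (mswap c d (g N i) * S N)"
      using arg_cong[OF SF(4)[OF N, of i], of "mswap c d"] by (simp add: mswap_mderiv sS g_def)
    have "mconst (of_nat N) * (mswap c d (g N i) * S N) = mconst (of_nat N) * (g N (tr c d i) * S N)"
      by (rule trans[OF A[symmetric] SF(4)[OF N, folded g_def]])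
    moreover have "mconst (of_nat N) \<noteq> 0" using N mconst_eq_iff[of "of_nat N" 0] by simp
    ultimately show ?thesis using S_ne[OF N] by simp
  qed
  have Flim: "(\<lambda>N. coef (F N) (mset is)) \<longlonglongrightarrow> z / dfact is {#}"
    if "(\<lambda>N. pdiffs is (\<lambda>u. Ln (SGF (\<rho> N) u) / of_nat N) ones) \<longlonglongrightarrow> z" for "is" z
  proof (rule Lim_transform_eventually)
    show "(\<lambda>N. pdiffs is (\<lambda>u. Ln (SGF (\<rho> N) u) / of_nat N) ones / dfact is {#}) \<longlonglongrightarrow> z / dfact is {#}"
      by (intro tendsto_divide that) auto
    show "\<forall>\<^sub>F N in sequentially. pdiffs is (\<lambda>u. Ln (SGF (\<rho> N) u) / of_nat N) ones / dfact is {#} = coef (F N) (mset is)"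
      using eventually_gt_at_top[of 0]
    proof eventually_elim
      case (elim N)
      show ?case using taylor_pdiffs[OF SF(1)[OF elim, of "length is"], of "is"] by (simp add: coef_mderivs_empty)
    qed
  qed
  have gconv: "coef_lim (\<lambda>N. g N i) (mfps_of_fps i (psi_fps a))" for i
    unfolding coef_lim_def
  proof
    fix M :: "nat multiset"
    show "(\<lambda>N. coef (g N i) M) \<longlonglongrightarrow> coef (mfps_of_fps i (psi_fps a)) M"
    proof (cases "set_mset M \<subseteq> {i}")
      case True
      define n where "n = size M"
      have M: "M = replicate_mset n i"
        using set_mset_subset_singletonD[OF True] by (auto simp: n_def)
      have "(\<lambda>N. coef (F N) (mset (replicate (Suc n) i))) \<longlonglongrightarrow> complex_of_real (a (Suc n)) / fact (Suc n)"
        using Flim[OF diag[of "Suc n" i]] dfact_replicate[of "Suc n" i 0] by simp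
      from tendsto_mult[OF tendsto_const[of "of_nat (Suc n)"] this]
      have "(\<lambda>N. coef (g N i) M) \<longlonglongrightarrow> of_nat (Suc n) * (complex_of_real (a (Suc n)) / fact (Suc n))"
        by (simp add: g_def coef_mderiv M)
      moreover have "of_nat (Suc n) * (complex_of_real (a (Suc n)) / fact (Suc n)) = coef (mfps_of_fps i (psi_fps a)) M"
        using True by (simp add: coef_mfps_of_fps psi_fps_def M del: of_nat_Suc)
      ultimately show ?thesis by simp
    next
      case False
      \<comment> \<open>A second index in a monomial of d_i F means a derivative of F in at least
        two different indices, which tends to 0 by \<open>mixed\<close>.\<close>
      then obtain j where j: "j \<in># M" "j \<noteq> i" by auto
      obtain js where js: "mset js = M" by (metis ex_mset)
      have "card {i, j} \<le> card (set (i # js))"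
        by (rule card_mono) (use j js in auto)
      then have "card (set (i # js)) \<ge> 2" using j by simp
      from Flim[OF mixed[OF this]] have "(\<lambda>N. coef (F N) (add_mset i M)) \<longlonglongrightarrow> 0" by (simp add: js)
      from tendsto_mult[OF tendsto_const[of "of_nat (Suc (count M i))"] this] show ?thesis
        using False by (simp add: g_def coef_mderiv coef_mfps_of_fps)
    qed
  qed
  define \<psi> where "\<psi> = (\<lambda>i. mfps_of_fps i (psi_fps a))"
  have g\<psi>: "\<And>i. coef_lim (\<lambda>N. g N i) (\<psi> i)" "\<And>i. supp_on {i} (\<psi> i)"
    using gconv by (simp_all add: \<psi>_def supp_on_mfps_of_fps)
  define t where "t N i j = coef ((dunkl_conj N (g N) i ^^ k) ((dunkl_conj N (g N) j ^^ k') 1)) {#}" for N i j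
  have sym1: "mswap c d 1 = 1" for c d by simp
  have C1: "coef_lim (\<lambda>N. (dunkl_conj N (g N) 1 ^^ k') 1) ((dunkl_lim \<psi> 1 ^^ k') 1)
    \<and> supp_on {0, 1} ((dunkl_lim \<psi> 1 ^^ k') 1)
    \<and> (\<forall>N>1. \<forall>a<N. \<forall>b<N. a \<notin> {0, 1} \<longrightarrow> b \<notin> {0, 1} \<longrightarrow> mswap a b ((dunkl_conj N (g N) 1 ^^ k') 1) = (dunkl_conj N (g N) 1 ^^ k') 1)"
    by (rule coef_lim_dunkl_conj_pow[OF _ _ coef_lim_const supp_on_1 _ g\<psi> gsym]) auto
  have "coef_lim (\<lambda>N. (dunkl_conj N (g N) 0 ^^ k) ((dunkl_conj N (g N) 1 ^^ k') 1)) ((dunkl_lim \<psi> 0 ^^ k) ((dunkl_lim \<psi> 1 ^^ k') 1))"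
  proof (rule conjunct1[OF coef_lim_dunkl_conj_pow[where A = "{0, 1}"]])
    show "mswap c d ((dunkl_conj N (g N) 1 ^^ k') 1) = (dunkl_conj N (g N) 1 ^^ k') 1"
      if "c < N" "d < N" "c \<notin> {0, 1}" "d \<notin> {0, 1}" for N c d
      using C1 that by auto
  qed (use C1 g\<psi> gsym in auto)
  then have t01: "(\<lambda>N. t N 0 1) \<longlonglongrightarrow> coef ((dunkl_lim \<psi> 0 ^^ k) ((dunkl_lim \<psi> 1 ^^ k') 1)) {#}"
    unfolding t_def by (rule coef_limD)
  have "(dunkl_lim \<psi> 1 ^^ k') 1 = mfps_of_fps 1 ((dunkl_lim1 (psi_fps a) ^^ k') 1)"
    using dunkl_lim_pow_mfps_of_fps_mult[where A = "{}" and h = 1 and i = 1 and \<psi> = "psi_fps a" and n = k' and f = 1] by (simp add: supp_on_1 mfps_of_fps_1 \<psi>_def)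
  moreover have "(dunkl_lim \<psi> 0 ^^ k) (mfps_of_fps 1 f) = mfps_of_fps 0 ((dunkl_lim1 (psi_fps a) ^^ k) 1) * mfps_of_fps 1 f" for f
    using dunkl_lim_pow_mfps_of_fps_mult[where A = "{1}" and h = "mfps_of_fps 1 f" and i = 0 and \<psi> = "psi_fps a" and n = k and f = 1] by (simp add: supp_on_mfps_of_fps mfps_of_fps_1 \<psi>_def)
  ultimately have lim01: "(\<lambda>N. t N 0 1) \<longlonglongrightarrow> complex_of_real (limit_moment a k * limit_moment a k')"
    using t01 by (simp add: coef_mfps_of_fps limit_moment_def)
  have C0: "coef_lim (\<lambda>N. (dunkl_conj N (g N) 0 ^^ k') 1) ((dunkl_lim \<psi> 0 ^^ k') 1)
    \<and> supp_on {0} ((dunkl_lim \<psi> 0 ^^ k') 1)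
    \<and> (\<forall>N>0. \<forall>a<N. \<forall>b<N. a \<notin> {0} \<longrightarrow> b \<notin> {0} \<longrightarrow> mswap a b ((dunkl_conj N (g N) 0 ^^ k') 1) = (dunkl_conj N (g N) 0 ^^ k') 1)"
    by (rule coef_lim_dunkl_conj_pow[OF _ _ coef_lim_const supp_on_1 _ g\<psi> gsym]) auto
  \<comment> \<open>The diagonal terms carry the factor 1/N, so it suffices that
    \<open>t N 0 0\<close> converges to some limit.\<close>
  have "coef_lim (\<lambda>N. (dunkl_conj N (g N) 0 ^^ k) ((dunkl_conj N (g N) 0 ^^ k') 1)) ((dunkl_lim \<psi> 0 ^^ k) ((dunkl_lim \<psi> 0 ^^ k') 1))"
  proof (rule conjunct1[OF coef_lim_dunkl_conj_pow[where A = "{0}"]])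
    show "mswap c d ((dunkl_conj N (g N) 0 ^^ k') 1) = (dunkl_conj N (g N) 0 ^^ k') 1"
      if "c < N" "d < N" "c \<notin> {0}" "d \<notin> {0}" for N c d
      using C0 that by auto
  qed (use C0 g\<psi> gsym in auto)
  then have t00: "(\<lambda>N. t N 0 0) \<longlonglongrightarrow> coef ((dunkl_lim \<psi> 0 ^^ k) ((dunkl_lim \<psi> 0 ^^ k') 1)) {#}"
    unfolding t_def by (rule coef_limD)
  have inv0: "(\<lambda>N. 1 / of_nat N :: complex) \<longlonglongrightarrow> 0"
    using lim_inverse_n[where 'a = complex] by (simp add: divide_inverse)
  have val: "coef (\<Sum>i<N. (dunkl N i ^^ k) (\<Sum>j<N. (dunkl N j ^^ k') (S N))) {#} / of_nat N ^ (k + k' + 2)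
      = 1 / of_nat N * t N 0 0 + (1 - 1 / of_nat N) * t N 0 1" if N: "N > 0" for N
  proof -
    have "coef (\<Sum>i<N. (dunkl N i ^^ k) (\<Sum>j<N. (dunkl N j ^^ k') (S N))) {#}
        = (\<Sum>i<N. \<Sum>j<N. coef ((dunkl N i ^^ k) ((dunkl N j ^^ k') (S N))) {#})"
      by (simp add: dunkl_pow_sum coef_sum)
    also have "\<dots> = (\<Sum>i<N. \<Sum>j<N. of_nat N ^ (k + k') * t N i j)"
    proof (intro sum.cong refl)
      fix i j assume "i \<in> {..<N}" "j \<in> {..<N}"
      then have "i < N" "j < N" by auto
      then show "coef ((dunkl N i ^^ k) ((dunkl N j ^^ k') (S N))) {#} = of_nat N ^ (k + k') * t N i j"
        using dunkl_dunkl_pow_mult_exp[OF SF(2)[OF N] SF(4)[OF N, folded g_def], of i j k k'] SF(3)[OF N]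
        by (simp add: t_def coef_mconst)
    qed
    also have "\<dots> = of_nat N ^ (k + k') * (\<Sum>i<N. \<Sum>j<N. t N i j)"
      by (simp add: sum_distrib_left)
    also have "(\<Sum>i<N. \<Sum>j<N. t N i j) = of_nat N * t N 0 0 + of_nat N * (of_nat N - 1) * t N 0 1"
      by (rule sum_offdiag) (unfold t_def, rule dunkl_conj_dunkl_conj_pow_coef_symmetric, use gsym in auto)
    finally show ?thesis using N by (simp add: power_add power2_eq_square field_simps)
  qed
  define m where "m N = Re (1 / of_nat N * t N 0 0 + (1 - 1 / of_nat N) * t N 0 1)" for N
  have "(\<lambda>N. 1 / of_nat N * t N 0 0 + (1 - 1 / of_nat N) * t N 0 1) \<longlonglongrightarrow>
     0 * coef ((dunkl_lim \<psi> 0 ^^ k) ((dunkl_lim \<psi> 0 ^^ k') 1)) {#} + (1 - 0) * complex_of_real (limit_moment a k * limit_moment a k')"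
    by (intro tendsto_intros inv0 t00 lim01)
  from tendsto_Re[OF this] have "m \<longlonglongrightarrow> limit_moment a k * limit_moment a k'"
    by (simp add: m_def[abs_def])
  moreover have "((\<lambda>l. pmf (\<rho> N) l * (PP_moment 1 l k * PP_moment 1 l k')) has_sum m N) UNIV" if "N > 0" for N
    using SF(5)[OF that, of k k'] unfolding val[OF that] m_def .
  ultimately show ?thesis by blast
qed

text \<open>The eigenvalue relation for k = 0, where the operator sum is N times the
  identity.\<close>

lemma PP1_moment_0: 
  assumes l: "l \<in> signatures N" and N: "N > 0"
  shows "PP_moment 1 l 0 = 1"
proof -
  obtain c where c: "coef c {#} = 1" "(\<Sum>i<N. (dunkl N i ^^ 0) c) = mconst (of_real (real N ^ Suc 0 * PP_moment 1 l 0)) * c"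
  proof -
    have "(0::real) < 1" "(1::real) \<le> 1" by auto
    from normalized_schur_taylor[OF l this N] that show ?thesis by blast
  qed
  have "coef (\<Sum>i<N. (dunkl N i ^^ 0) c) {#} = of_nat N"
    by (simp only: coef_sum funpow.simps id_apply c(1)) simp
  then have "of_nat N = complex_of_real (real N * PP_moment 1 l 0)"
    by (simp only: c coef_mconst_mult) simp
  then have "real N = real N * PP_moment 1 l 0" by (metis of_real_eq_iff of_real_of_nat_eq)
  then show ?thesis using N by simp
qed

theorem PP1_moment_conv:
  assumes "\<epsilon> > 0"
  shows "(\<lambda>N. measure_pmf.prob (\<rho> N) {l. \<bar>PP_moment 1 l k - limit_moment a k\<bar> > \<epsilon>}) \<longlonglongrightarrow> 0"
proof -
  define M where "M = limit_moment a k"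
  obtain m2 where m2: "\<And>N. N > 0 \<Longrightarrow> ((\<lambda>l. pmf (\<rho> N) l * (PP_moment 1 l k * PP_moment 1 l k)) has_sum m2 N) UNIV"
    "m2 \<longlonglongrightarrow> M * M" using PP1_second_moments[of k k] by (auto simp: M_def)
  \<comment> \<open>With second exponent 0 the extra factor is 1 on the support, so this is the
    first moment; the limit moment of order 0 is 1 as well.\<close>
  obtain m1 where m1: "\<And>N. N > 0 \<Longrightarrow> ((\<lambda>l. pmf (\<rho> N) l * (PP_moment 1 l k * PP_moment 1 l 0)) has_sum m1 N) UNIV"
    "m1 \<longlonglongrightarrow> M" using PP1_second_moments[of k 0] by (auto simp: M_def limit_moment_def)
  define v where "v N = m2 N - 2 * M * m1 N + M * M" for N
  have v: "((\<lambda>l. pmf (\<rho> N) l * (PP_moment 1 l k - M)\<^sup>2) has_sum v N) UNIV" if N: "N > 0" for N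
  proof -
    have "((\<lambda>l. pmf (\<rho> N) l * (PP_moment 1 l k * PP_moment 1 l k)
        + (- 2 * M) * (pmf (\<rho> N) l * (PP_moment 1 l k * PP_moment 1 l 0)) + M * M * pmf (\<rho> N) l)
        has_sum (m2 N + (- 2 * M) * m1 N + M * M * 1)) UNIV"
      using has_sum_pmf[of "\<rho> N" UNIV] by (intro has_sum_add has_sum_cmult_right m2 m1 N) simp
    moreover have "pmf (\<rho> N) l * (PP_moment 1 l k * PP_moment 1 l k)
        + (- 2 * M) * (pmf (\<rho> N) l * (PP_moment 1 l k * PP_moment 1 l 0)) + M * M * pmf (\<rho> N) l
       = pmf (\<rho> N) l * (PP_moment 1 l k - M)\<^sup>2" for l
    proof (cases "pmf (\<rho> N) l = 0")
      case False
      then have "PP_moment 1 l 0 = 1" using supp[of N] N by (intro PP1_moment_0) (auto simp: set_pmf_eq)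
      then show ?thesis by (simp add: power2_eq_square algebra_simps)
    qed simp
    ultimately show ?thesis by (simp add: v_def)
  qed
  have "v \<longlonglongrightarrow> M * M - 2 * M * M + M * M"
    unfolding v_def by (intro tendsto_intros m2 m1)
  then have "v \<longlonglongrightarrow> 0" by simp
  then have v0: "(\<lambda>N. v N / \<epsilon>\<^sup>2) \<longlonglongrightarrow> 0"
    using tendsto_divide[OF _ tendsto_const[of "\<epsilon>\<^sup>2"], of v 0] assms by simp
  have bound: "measure_pmf.prob (\<rho> N) {l. \<bar>PP_moment 1 l k - M\<bar> > \<epsilon>} \<le> v N / \<epsilon>\<^sup>2" if N: "N > 0" for N
  proof -
    let ?A = "{l. \<bar>PP_moment 1 l k - M\<bar> > \<epsilon>}"
    have "\<epsilon>\<^sup>2 * measure_pmf.prob (\<rho> N) ?A \<le> v N"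
    proof (rule has_sum_mono_neutral[OF has_sum_cmult_right[OF has_sum_pmf] v[OF N]])
      fix l assume "l \<in> ?A \<inter> UNIV"
      then have "\<epsilon>\<^sup>2 \<le> (PP_moment 1 l k - M)\<^sup>2" using assms by (intro abs_le_square_iff[THEN iffD1]) auto
      then show "\<epsilon>\<^sup>2 * pmf (\<rho> N) l \<le> pmf (\<rho> N) l * (PP_moment 1 l k - M)\<^sup>2"
        by (simp add: mult.commute mult_left_mono)
    qed auto
    then show ?thesis using assms by (simp add: field_simps)
  qed
  show ?thesis unfolding M_def[symmetric]
  proof (rule tendsto_sandwich[OF _ _ tendsto_const v0])
    show "\<forall>\<^sub>F N in sequentially. measure_pmf.prob (\<rho> N) {l. \<bar>PP_moment 1 l k - M\<bar> > \<epsilon>} \<le> v N / \<epsilon>\<^sup>2"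
      using eventually_gt_at_top[of 0] by eventually_elim (rule bound)
  qed simp
qed

end

subsection \<open>Lagrange inversion\<close>

unbundle no vec_syntax
no_notation Matrix.vec_index (infixl "$" 100)
unbundle fps_syntax

lemma fps_binomial_deriv': "fps_deriv (fps_binomial c) = fps_const c * fps_binomial (c - 1 :: real)"
  by (rule fps_ext) (simp add: gbinomial_absorption del: of_nat_Suc)

lemma fps_binomial_Suc: "fps_binomial (c + 1 :: real) = (1 + fps_X) * fps_binomial c"
  by (simp add: fps_binomial_add_mult fps_binomial_1 mult.commute)

lemma fps_compose_mult_nth:
  fixes A v K :: "real fps"
  assumes "v $ 0 = 0"
  shows "((A oo v) * K) $ p = (\<Sum>i\<le>p. A $ i * (v ^ i * K) $ p)"
proof -
  have z: "(v ^ i) $ j = 0" if "j < i" for i j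
    using that assms by (rule startsby_zero_power_prefix[rule_format, rotated])
  have c: "(A oo v) $ j = (\<Sum>i\<le>p. A $ i * (v ^ i) $ j)" if "j \<le> p" for j
    unfolding fps_compose_nth by (rule sum.mono_neutral_left) (use that z in auto)
  have "((A oo v) * K) $ p = (\<Sum>j=0..p. \<Sum>i\<le>p. A $ i * (v ^ i) $ j * K $ (p - j))"
    unfolding fps_mult_nth by (intro sum.cong refl) (simp add: c sum_distrib_right)
  also have "\<dots> = (\<Sum>i\<le>p. A $ i * (v ^ i * K) $ p)"
    unfolding fps_mult_nth sum_distrib_left by (subst sum.swap) (simp add: mult.assoc)
  finally show ?thesis .
qed

text \<open>H is rewritten as a series G in v, and coefficients are extracted by a formal residue:
  v^i v' \<phi>^(p+1) has coefficient 1 at p if i = p, and 0 for smaller i.\<close>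

lemma fps_lagrange_inversion:
  fixes H \<phi> v w :: "real fps"
  assumes v: "v * \<phi> = fps_X" and \<phi>0: "\<phi> $ 0 = 1" and w: "w $ 0 = 0" "w oo v = fps_X"
  shows "of_nat (Suc p) * (H oo w) $ Suc p = (fps_deriv H * \<phi> ^ Suc p) $ p"
proof -
  have v0: "v $ 0 = 0" and v1: "v $ 1 = 1"
    using arg_cong[OF v, of "\<lambda>f. f $ 0"] arg_cong[OF v, of "\<lambda>f. f $ 1"] \<phi>0 by (simp_all add: fps_mult_nth)
  define G where "G = H oo w"
  have H: "H = G oo v"
    using fps_compose_assoc[OF v0 w(1), of H] w(2) by (simp add: G_def)
  have dv: "fps_deriv v * \<phi> = 1 - v * fps_deriv \<phi>"
    using arg_cong[OF v, of fps_deriv] by (simp add: algebra_simps)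
  have key: "(v ^ i * (fps_deriv v * \<phi> ^ Suc p)) $ p = (if i = p then 1 else 0)" if "i \<le> p" for i
  proof -
    define j where "j = p - i"
    have p: "p = i + j" using that by (simp add: j_def)
    have "v ^ i * (fps_deriv v * \<phi> ^ Suc p) = (v * \<phi>) ^ i * (\<phi> ^ j * (fps_deriv v * \<phi>))"
      by (simp add: p power_add power_mult_distrib mult_ac)
    also have "\<dots> = fps_X ^ i * (\<phi> ^ j * (1 - v * fps_deriv \<phi>))"
      by (simp only: v dv)
    also have "\<dots> = fps_X ^ i * (\<phi> ^ j - \<phi> ^ j * v * fps_deriv \<phi>)"
      by (simp add: algebra_simps)
    finally have "(v ^ i * (fps_deriv v * \<phi> ^ Suc p)) $ p = (\<phi> ^ j - \<phi> ^ j * v * fps_deriv \<phi>) $ j"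
      by (simp add: p fps_X_power_mult_nth)
    also have "\<dots> = (if i = p then 1 else 0)"
    proof (cases j)
      case 0
      then show ?thesis using p v0 by simp
    next
      case (Suc s)
      \<comment> \<open>This is x (\<phi>^j)' / j, whose coefficient at j is that of \<phi>^j; hence
        the two terms cancel.\<close>
      have "\<phi> ^ j * v * fps_deriv \<phi> = fps_X * (\<phi> ^ s * fps_deriv \<phi>)"
        by (simp add: Suc v[symmetric] mult_ac)
      also have "\<dots> $ j = (\<phi> ^ s * fps_deriv \<phi>) $ s" by (simp add: Suc)
      also have "of_nat (Suc s) * \<dots> = fps_deriv (\<phi> ^ Suc s) $ s"
        by (simp add: fps_deriv_power mult.assoc del: power_Suc of_nat_Suc) (simp add: mult_ac fps_of_nat[symmetric] del: of_nat_Suc)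
      also have "\<dots> = of_nat (Suc s) * (\<phi> ^ j) $ j" by (simp add: Suc del: power_Suc of_nat_Suc)
      finally have "(\<phi> ^ j * v * fps_deriv \<phi>) $ j = (\<phi> ^ j) $ j" by (simp del: of_nat_Suc)
      then show ?thesis using Suc p by simp
    qed
    finally show ?thesis .
  qed
  have "(fps_deriv H * \<phi> ^ Suc p) $ p = ((fps_deriv G oo v) * (fps_deriv v * \<phi> ^ Suc p)) $ p"
    unfolding H fps_compose_deriv[OF v0] by (simp only: mult.assoc)
  also have "\<dots> = (\<Sum>i\<le>p. fps_deriv G $ i * (if i = p then 1 else 0))"
    unfolding fps_compose_mult_nth[OF v0] by (intro sum.cong refl) (simp only: key atMost_iff)
  also have "\<dots> = fps_deriv G $ p" by (simp add: if_distrib[of "\<lambda>x. _ * x"] cong: if_cong)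
  finally show ?thesis by (simp add: G_def)
qed

section \<open>The implicit series w and the limit moments\<close>

context
  fixes a :: "nat \<Rightarrow> real"
begin

definition phi :: "real fps" where "phi = (1 + fps_X) * (1 + fps_X * psi_fps a)"
definition vfps :: "real fps" where "vfps = fps_X * inverse phi"
text \<open>The solution of w = z phi(w).\<close>
definition wfps :: "real fps" where "wfps = fps_inv vfps"

lemma phi_0: "phi $ 0 = 1"
  by (simp add: phi_def)

lemma vfps_phi: "vfps * phi = fps_X"
  using inverse_mult_eq_1[of phi] by (simp add: vfps_def phi_0 mult.assoc)

lemma vfps_0: "vfps $ 0 = 0" and vfps_1: "vfps $ 1 = 1"
  by (simp_all add: vfps_def phi_0)

lemma wfps_0: "wfps $ 0 = 0"
  by (simp add: wfps_def fps_inv_def)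

lemma wfps_inv: "wfps oo vfps = fps_X" and wfps_inv_right: "vfps oo wfps = fps_X"
  unfolding wfps_def by (rule fps_inv fps_inv_right; simp add: vfps_0 vfps_1[simplified])+

lemma wfps_eq: "wfps = fps_X * (phi oo wfps)"
proof -
  have "(vfps * phi) oo wfps = fps_X * (phi oo wfps)"
    by (simp add: fps_compose_mult_distrib[OF wfps_0] wfps_inv_right)
  then show ?thesis by (simp add: vfps_phi wfps_0)
qed

text \<open>Kernel method: multiplied by x, the operator becomes multiplication by
  \<open>phi\<close> up to the boundary term f_0 (1 + x). Substituting w turns \<open>phi\<close>
  into w/z, so that iterates of the operator telescope.\<close>

lemma wfps_dunkl_lim1: "fps_X * (wfps * (dunkl_lim1 (psi_fps a) f oo wfps)) = wfps * (f oo wfps) - fps_const (f $ 0) * (fps_X * (1 + wfps))"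
proof -
  have "fps_X * fps_shift 1 f = f - fps_const (f $ 0)"
    by (rule fps_ext) (auto simp: fps_X_mult_nth)
  then have "fps_X * dunkl_lim1 (psi_fps a) f = phi * f - fps_const (f $ 0) * (1 + fps_X)"
  proof -
    assume s: "fps_X * fps_shift 1 f = f - fps_const (f $ 0)"
    have "fps_X * dunkl_lim1 (psi_fps a) f = (1 + fps_X) * (fps_X * psi_fps a * f + fps_X * fps_shift 1 f)"
      unfolding dunkl_lim1_def by (simp only: algebra_simps)
    then show ?thesis unfolding s phi_def by (simp add: algebra_simps)
  qed
  from arg_cong[OF this, of "\<lambda>f. f oo wfps"]
  have "wfps * (dunkl_lim1 (psi_fps a) f oo wfps) = (phi oo wfps) * (f oo wfps) - fps_const (f $ 0) * (1 + wfps)"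
    by (simp add: fps_compose_mult_distrib[OF wfps_0] fps_compose_sub_distrib fps_compose_add_distrib wfps_0)
  then have "fps_X * (wfps * (dunkl_lim1 (psi_fps a) f oo wfps)) = fps_X * (phi oo wfps) * (f oo wfps) - fps_const (f $ 0) * (fps_X * (1 + wfps))"
    by (simp only: right_diff_distrib mult_ac)
  then show ?thesis by (simp only: wfps_eq[symmetric])
qed

text \<open>Telescoping gives w = (1 + w) sum_{k<K} M_k z^(k+1) up to a remainder divisible by z^K.
  For K beyond the order considered the remainder is invisible.\<close>

lemma mom_limit_moment: "(1 + wfps) * (1 - mom_fps (limit_moment a)) = 1"
proof -
  define T where "T k = (dunkl_lim1 (psi_fps a) ^^ k) 1 oo wfps" for k
  define P where "P K = (\<Sum>k<K. fps_const (limit_moment a k) * fps_X ^ Suc k)" for K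
  have step: "fps_X * (wfps * T (Suc k)) = wfps * T k - fps_const (limit_moment a k) * (fps_X * (1 + wfps))" for k
    using wfps_dunkl_lim1[of "(dunkl_lim1 (psi_fps a) ^^ k) 1"] by (simp add: T_def limit_moment_def)
  have tel: "wfps - fps_X ^ K * (wfps * T K) = (1 + wfps) * P K" for K
  proof (induction K)
    case (Suc K)
    have "fps_X ^ Suc K * (wfps * T (Suc K)) = fps_X ^ K * (fps_X * (wfps * T (Suc K)))"
      by (simp add: mult_ac)
    also have "\<dots> = fps_X ^ K * (wfps * T K) - fps_const (limit_moment a K) * fps_X ^ Suc K * (1 + wfps)"
      unfolding step by (simp add: algebra_simps)
    finally have "wfps - fps_X ^ Suc K * (wfps * T (Suc K))
        = (wfps - fps_X ^ K * (wfps * T K)) + fps_const (limit_moment a K) * fps_X ^ Suc K * (1 + wfps)"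
      by (simp only: algebra_simps)
    also have "\<dots> = (1 + wfps) * (P K + fps_const (limit_moment a K) * fps_X ^ Suc K)"
      unfolding Suc by (simp only: distrib_left mult.commute[of "1 + wfps"])
    finally show ?case by (simp add: P_def)
  qed (simp add: P_def T_def)
  have "wfps = (1 + wfps) * mom_fps (limit_moment a)"
  proof (rule fps_ext)
    fix n
    have "mom_fps (limit_moment a) $ i = P (Suc n) $ i" if "i \<le> n" for i
    proof -
      have "P (Suc n) $ i = (\<Sum>k<Suc n. if Suc k = i then limit_moment a k else 0)"
        unfolding P_def fps_sum_nth by (intro sum.cong refl) (auto simp: fps_X_power_nth simp del: power_Suc)
      also have "\<dots> = (if i = 0 then 0 else limit_moment a (i - 1))"
        using that by (cases i) auto
      finally show ?thesis by (simp add: mom_fps_def)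
    qed
    then have "((1 + wfps) * mom_fps (limit_moment a)) $ n = ((1 + wfps) * P (Suc n)) $ n"
      unfolding fps_mult_nth by (intro sum.cong refl) auto
    also have "\<dots> = (wfps - fps_X ^ Suc n * (wfps * T (Suc n))) $ n" by (simp only: tel)
    also have "\<dots> = wfps $ n" by (simp add: fps_X_power_mult_nth del: power_Suc)
    finally show "wfps $ n = ((1 + wfps) * mom_fps (limit_moment a)) $ n" by simp
  qed
  then show ?thesis by (simp add: algebra_simps)
qed

definition Bw :: "real \<Rightarrow> real fps" where "Bw c = fps_binomial c oo wfps"

lemma Bw_minus_1: "Bw (- 1) = 1 - mom_fps (limit_moment a)"
proof -
  have "(1 + fps_X) * fps_binomial (- 1 :: real) = 1"
    using fps_binomial_Suc[of "-1"] by simp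
  from arg_cong[OF this, of "\<lambda>f. f oo wfps"] have "(1 + wfps) * Bw (- 1) = 1"
    by (simp add: fps_compose_mult_distrib[OF wfps_0] fps_compose_add_distrib wfps_0 Bw_def)
  moreover have "1 + wfps \<noteq> 0" using wfps_0 by (auto dest: arg_cong[where f = "\<lambda>f. f $ 0"])
  ultimately show ?thesis using mom_limit_moment mult_left_cancel by metis
qed

lemma Bw_deriv: "fps_deriv (Bw c) = Bw c * (fps_const c * (Bw (- 1) * fps_deriv wfps))"
proof -
  have "fps_binomial (c - 1) = fps_binomial c * fps_binomial (-1)"
    using fps_binomial_add_mult[of c "-1"] by simp
  then show ?thesis
    unfolding Bw_def fps_compose_deriv[OF wfps_0] fps_binomial_deriv'
    by (simp add: fps_compose_mult_distrib[OF wfps_0] mult_ac)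
qed

text \<open>For q different from 0 this is (1 - (1 + x)^(-q)) / q. The integral also covers q = 0,
  where it is log (1 + x).\<close>

definition Hq :: "real \<Rightarrow> real fps" where "Hq q = fps_integral0 (fps_binomial (- q - 1))"

lemma Hq_deriv: "fps_deriv (Hq q) = fps_binomial (- q - 1)"
  by (simp add: Hq_def fps_deriv_fps_integral)

lemma Hq_0: "Hq q $ 0 = 0"
  by (simp add: Hq_def)

lemma Hq_eq: "1 - fps_const q * Hq q = fps_binomial (- q)"
proof -
  have "fps_deriv (1 - fps_const q * Hq q) = fps_deriv (fps_binomial (- q))"
    by (simp add: Hq_deriv fps_binomial_deriv' fps_const_neg[symmetric] del: fps_const_neg)
  from this[unfolded fps_deriv_eq_iff] show ?thesis by (simp add: Hq_0)
qed

lemma Hq_compose_deriv: "fps_deriv (Hq q oo wfps) = Bw (- q - 1) * fps_deriv wfps"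
  by (simp add: fps_compose_deriv[OF wfps_0] Hq_deriv Bw_def)

text \<open>Lagrange inversion, with (1 + x Psi'(1 + x))^(k+1) expanded binomially and the summation
  index reversed. The factor (m + 1)^(-1) comes from (k+1 choose m+1) / (k+1) = (k choose m) /
  (m+1).\<close>

lemma Hq_compose_nth:
  "(Hq q oo wfps) $ Suc k = (\<Sum>m\<le>k. real (k choose m) / real (m + 1)
      * (fps_binomial (real k - q) * psi_fps a ^ (k - m)) $ m)"
proof -
  have "fps_binomial (- q - 1) * phi ^ Suc k
      = fps_binomial (- q - 1) * (1 + fps_X) ^ Suc k * (1 + fps_X * psi_fps a) ^ Suc k"
    by (simp add: phi_def power_mult_distrib mult.assoc del: power_Suc)
  also have "fps_binomial (- q - 1) * (1 + fps_X) ^ Suc k = fps_binomial (real k - q)"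
    using fps_binomial_add_mult[of "- q - 1" "real (Suc k)"] fps_binomial_of_nat[where 'a = real, of "Suc k"]
    by (simp add: algebra_simps del: power_Suc)
  also have "(1 + fps_X * psi_fps a) ^ Suc k = (\<Sum>r\<le>Suc k. of_nat (Suc k choose r) * (fps_X ^ r * psi_fps a ^ r))"
    using binomial_ring[of "fps_X * psi_fps a" 1 "Suc k"] by (simp add: add.commute power_mult_distrib mult.assoc del: power_Suc binomial_Suc_Suc)
  finally have e: "fps_binomial (- q - 1) * phi ^ Suc k
     = (\<Sum>r\<le>Suc k. fps_const (real (Suc k choose r)) * (fps_X ^ r * (fps_binomial (real k - q) * psi_fps a ^ r)))"
    by (simp add: sum_distrib_left fps_of_nat mult_ac del: power_Suc binomial_Suc_Suc sum.atMost_Suc)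
  have "real (Suc k) * (Hq q oo wfps) $ Suc k = (fps_binomial (- q - 1) * phi ^ Suc k) $ k"
    using fps_lagrange_inversion[OF vfps_phi phi_0 wfps_0 wfps_inv, of k "Hq q"] by (simp add: Hq_deriv)
  also have "\<dots> = (\<Sum>r\<le>Suc k. real (Suc k choose r) * (if k < r then 0 else (fps_binomial (real k - q) * psi_fps a ^ r) $ (k - r)))"
    unfolding e fps_sum_nth by (intro sum.cong refl) (simp add: fps_X_power_mult_nth del: binomial_Suc_Suc)
  also have "\<dots> = (\<Sum>r\<le>k. real (Suc k choose r) * (fps_binomial (real k - q) * psi_fps a ^ r) $ (k - r))"
    by (simp add: not_less del: binomial_Suc_Suc)
  also have "\<dots> = (\<Sum>m\<le>k. real (Suc k choose (k - m)) * (fps_binomial (real k - q) * psi_fps a ^ (k - m)) $ m)"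
    by (rule sum.reindex_bij_witness[where i = "\<lambda>m. k - m" and j = "\<lambda>m. k - m"]) auto
  also have "\<dots> = (\<Sum>m\<le>k. real (Suc k) * (real (k choose m) / real (m + 1) * (fps_binomial (real k - q) * psi_fps a ^ (k - m)) $ m))"
  proof (intro sum.cong refl)
    fix m assume "m \<in> {..k}"
    then have "Suc k choose (k - m) = Suc k choose Suc m" using binomial_symmetric[of "Suc m" "Suc k"] by simp
    moreover have "real (Suc m) * real (Suc k choose Suc m) = real (Suc k) * real (k choose m)"
      using Suc_times_binomial[of m k] by (metis of_nat_mult)
    ultimately have "real (Suc k choose (k - m)) = real (Suc k) * (real (k choose m) / real (m + 1))"
      by (simp add: field_simps del: binomial_Suc_Suc)
    then show "real (Suc k choose (k - m)) * (fps_binomial (real k - q) * psi_fps a ^ (k - m)) $ m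
      = real (Suc k) * (real (k choose m) / real (m + 1) * (fps_binomial (real k - q) * psi_fps a ^ (k - m)) $ m)" by simp
  qed
  finally have "real (Suc k) * (Hq q oo wfps) $ Suc k = real (Suc k) * (\<Sum>m\<le>k. real (k choose m) / real (m + 1) * (fps_binomial (real k - q) * psi_fps a ^ (k - m)) $ m)"
    by (simp only: sum_distrib_left)
  then show ?thesis by (simp del: of_nat_Suc)
qed

text \<open>Raising 1 - q H_q = (1 + x)^(-q) to the power 1/q gives (1 + x)^(-1), whatever q is; for
  q = 0 this is exp (-log (1 + x)).\<close>

lemma PP_gen_Hq:
  assumes "mom_fps \<mu> = Hq q oo wfps"
  shows "PP_gen q \<mu> = Bw (- 1)"
proof -
  \<comment> \<open>The differential equation makes the derivative of A (1 + x) vanish, so this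
    product is 1. It replaces a power law for composed binomial series.\<close>
  have binom_m1: "A = fps_binomial (- 1)" if "fps_deriv A = - (A * fps_binomial (- 1))" "A $ 0 = 1" for A :: "real fps"
  proof -
    have "fps_deriv (A * (1 + fps_X)) = A - A * (fps_binomial (-1) * (1 + fps_X))"
      by (simp add: that(1) algebra_simps)
    also have "fps_binomial (-1) * (1 + fps_X) = (1 :: real fps)"
      using fps_binomial_Suc[of "-1"] by (simp add: mult.commute)
    finally have "fps_deriv (A * (1 + fps_X)) = fps_deriv 1" by simp
    then have "A * (1 + fps_X) = 1" unfolding fps_deriv_eq_iff using that(2) by simp
    moreover have "fps_binomial (-1) * (1 + fps_X) = (1 :: real fps)"
      using fps_binomial_Suc[of "-1"] by (simp add: mult.commute)
    moreover have "(1 + fps_X :: real fps) \<noteq> 0" by (auto dest: arg_cong[where f = "\<lambda>f. f $ 0"])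
    ultimately show ?thesis by (metis mult_right_cancel)
  qed
  show ?thesis
  proof (cases "q = 0")
    case True
    have "fps_exp 1 oo (- Hq 0) = fps_binomial (- 1 :: real)"
      by (rule binom_m1) (simp_all add: fps_compose_deriv Hq_0 Hq_deriv)
    moreover have "fps_exp 1 oo (- (Hq 0 oo wfps)) = (fps_exp 1 oo (- Hq 0)) oo wfps"
      using fps_compose_assoc[OF wfps_0, of "- Hq 0" "fps_exp 1"] by (simp add: Hq_0 fps_compose_uminus)
    ultimately show ?thesis using True assms by (simp add: PP_gen_def Bw_def)
  next
    case False
    define b where "b = fps_binomial (- q)"
    have b: "- (fps_const q * Hq q) = b - 1" using Hq_eq[of q] by (simp add: b_def algebra_simps)
    have b0: "(b - 1) $ 0 = 0" by (simp add: b_def)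
    have "fps_binomial (1 / q) oo (b - 1) = fps_binomial (- 1)"
    proof (rule binom_m1)
      define B where "B = fps_binomial (1 / q - 1) oo (b - 1)"
      have "(1 + fps_X) * fps_binomial (1 / q - 1) = fps_binomial (1 / q)"
        using fps_binomial_Suc[of "1 / q - 1"] by simp
      from arg_cong[OF this, of "\<lambda>f. f oo (b - 1)"] have bB: "b * B = fps_binomial (1 / q) oo (b - 1)"
        using b0 by (simp add: fps_compose_mult_distrib fps_compose_add_distrib B_def)
      have "fps_deriv (fps_binomial (1 / q) oo (b - 1)) = fps_const (1 / q) * B * (fps_const (- q) * fps_binomial (- q - 1))"
        using b0 by (simp add: fps_compose_deriv fps_binomial_deriv' B_def b_def fps_compose_mult_distrib)
      also have "fps_binomial (- q - 1) = b * fps_binomial (- 1)"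
        using fps_binomial_add_mult[of "- q" "- 1"] by (simp add: b_def)
      also have "fps_const (1 / q) * B * (fps_const (- q) * (b * fps_binomial (- 1))) = fps_const (1 / q) * fps_const (- q) * (b * B * fps_binomial (- 1))"
        by (simp only: mult_ac)
      also have "fps_const (1 / q) * fps_const (- q) = - 1" using False by simp
      finally show "fps_deriv (fps_binomial (1 / q) oo (b - 1)) = - ((fps_binomial (1 / q) oo (b - 1)) * fps_binomial (- 1))"
        by (simp add: bB)
    qed simp
    moreover have "- (fps_const q * (Hq q oo wfps)) = (b - 1) oo wfps"
      by (simp add: b[symmetric] fps_compose_uminus fps_compose_mult_distrib[OF wfps_0])
    moreover have "fps_binomial (1 / q) oo ((b - 1) oo wfps) = (fps_binomial (1 / q) oo (b - 1)) oo wfps"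
      by (rule fps_compose_assoc[OF wfps_0 b0])
    ultimately show ?thesis using False assms by (simp add: PP_gen_def Bw_def)
  qed
qed

end

section \<open>Derivatives at 1 as power series coefficients\<close>

lemma has_fps_expansion_powr: "(\<lambda>x. (1 + x) powr c) has_fps_expansion fps_binomial (c :: real)"
  unfolding has_fps_expansion_def
proof
  have "summable (\<lambda>n. (c gchoose n) * (1/2) ^ n)"
    using gen_binomial_real[of "1/2" c] by (rule sums_summable) simp
  then have le: "ereal (norm (1/2 :: real)) \<le> fps_conv_radius (fps_binomial c)"
    unfolding fps_conv_radius_def fps_binomial_nth by (rule conv_radius_geI)
  have "0 < ereal (norm (1/2 :: real))" by simp
  then show "fps_conv_radius (fps_binomial c) > 0" using le by (rule less_le_trans)
  have "\<forall>\<^sub>F x in nhds 0. x \<in> {-1<..<1::real}" by (rule eventually_nhds_in_open) auto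
  then show "\<forall>\<^sub>F x in nhds 0. eval_fps (fps_binomial c) x = (1 + x) powr c"
  proof eventually_elim
    case (elim x)
    then have "\<bar>x\<bar> < 1" by auto
    then show ?case using gen_binomial_real[of x c] by (simp add: eval_fps_def sums_iff)
  qed
qed

lemma has_fps_expansion_Psi':
  assumes "\<exists>r>0. \<forall>z::real. \<bar>z - 1\<bar> < r \<longrightarrow> summable (\<lambda>k. a k * (z - 1) ^ k / fact k)"
  shows "(\<lambda>x. Psi' a (1 + x)) has_fps_expansion psi_fps a"
  unfolding has_fps_expansion_def
proof
  obtain r where r: "r > 0" "\<And>z::real. \<bar>z - 1\<bar> < r \<Longrightarrow> summable (\<lambda>k. a k * (z - 1) ^ k / fact k)"
    using assms by blast
  define A where "A = Abs_fps (\<lambda>k. a k / fact k)"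
  have "conv_radius (\<lambda>k. a k / fact k) \<ge> norm (r / 2)"
    by (rule conv_radius_geI) (use r(2)[of "1 + r / 2"] r(1) in auto)
  then have "fps_conv_radius A \<ge> ereal (r / 2)"
    using r(1) by (simp add: fps_conv_radius_def A_def)
  moreover have "psi_fps a = fps_deriv A"
    by (rule fps_ext) (simp add: psi_fps_def A_def del: of_nat_Suc)
  ultimately have le: "ereal (r / 2) \<le> fps_conv_radius (psi_fps a)"
    using order_trans[OF _ fps_conv_radius_deriv[of A]] by simp
  have "0 < ereal (r / 2)" using r(1) by simp
  then show "fps_conv_radius (psi_fps a) > 0" using le by (rule less_le_trans)
  show "\<forall>\<^sub>F x in nhds 0. eval_fps (psi_fps a) x = Psi' a (1 + x)"
    by (simp add: eval_fps_def psi_fps_def Psi'_def)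
qed

lemma has_fps_expansion_pow:
  "f has_fps_expansion F \<Longrightarrow> (\<lambda>x. f x ^ n) has_fps_expansion F ^ n"
  for f :: "real \<Rightarrow> real"
  by (induction n) (auto intro!: has_fps_expansion_mult)

lemma higher_deriv_has_fps_expansion:
  fixes f :: "real \<Rightarrow> real"
  assumes "f has_fps_expansion F"
  shows "(deriv ^^ n) f 0 = fact n * F $ n"
proof -
  have "(deriv ^^ n) f has_fps_expansion (fps_deriv ^^ n) F"
    by (induction n) (auto intro: has_fps_expansion_deriv assms)
  then have "(deriv ^^ n) f 0 = (fps_deriv ^^ n) F $ 0"
    unfolding has_fps_expansion_def by (auto dest!: eventually_nhds_x_imp_x simp: eval_fps_at_0)
  moreover have "(fps_deriv ^^ n) F $ k * fact k = fact (n + k) * F $ (n + k)" for k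
  proof (induction n arbitrary: k)
    case (Suc n)
    show ?case using Suc[of "Suc k"] by (simp add: mult_ac)
  qed simp
  from this[of 0] have "(fps_deriv ^^ n) F $ 0 = fact n * F $ n" by simp
  ultimately show ?thesis by simp
qed

text \<open>The m-th derivative at u = 1 is m! times a coefficient, which turns 1/(m+1)! into the
  1/(m+1) of \<open>Hq_compose_nth\<close>.\<close>

lemma mu_moment_eq_Hq:
  assumes "\<exists>r>0. \<forall>z::real. \<bar>z - 1\<bar> < r \<longrightarrow> summable (\<lambda>k. a k * (z - 1) ^ k / fact k)"
  shows "mu_moment a q k = (Hq q oo wfps a) $ Suc k"
  unfolding Hq_compose_nth mu_moment_def
proof (intro sum.cong refl)
  fix m
  let ?f = "\<lambda>u. u powr (real k - q) * (Psi' a u) ^ (k - m)"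
  have "(\<lambda>x. (1 + x) powr (real k - q) * (Psi' a (1 + x)) ^ (k - m)) has_fps_expansion
      fps_binomial (real k - q) * psi_fps a ^ (k - m)"
    by (intro has_fps_expansion_mult has_fps_expansion_pow has_fps_expansion_powr has_fps_expansion_Psi' assms)
  from higher_deriv_has_fps_expansion[OF this, of m]
  have "(deriv ^^ m) ?f 1 = fact m * (fps_binomial (real k - q) * psi_fps a ^ (k - m)) $ m"
    unfolding higher_deriv_shift_0[of m ?f 1] by (simp add: o_def)
  then show "real (k choose m) / fact (m + 1) * (deriv ^^ m) ?f 1
    = real (k choose m) / real (m + 1) * (fps_binomial (real k - q) * psi_fps a ^ (k - m)) $ m"
  proof -
    assume *: "(deriv ^^ m) ?f 1 = fact m * (fps_binomial (real k - q) * psi_fps a ^ (k - m)) $ m"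
    have f: "fact (m + 1) = real (m + 1) * fact m" by simp
    have "x / (y * z) * (z * c) = x / y * c" if "z \<noteq> 0" for x y z c :: real using that by simp
    then show ?thesis unfolding * f by (simp del: of_nat_add)
  qed
qed

lemma mom_fps_mu:
  assumes "\<exists>r>0. \<forall>z::real. \<bar>z - 1\<bar> < r \<longrightarrow> summable (\<lambda>k. a k * (z - 1) ^ k / fact k)"
  shows "mom_fps (mu_moment a q) = Hq q oo wfps a"
proof (rule fps_ext)
  fix n
  show "mom_fps (mu_moment a q) $ n = (Hq q oo wfps a) $ n"
    by (cases n) (simp_all add: mom_fps_def mu_moment_eq_Hq[OF assms] Hq_0)
qed

section \<open>The moment generating function of a single signature\<close>

lemma prod_one_minus_partial_fraction:
  fixes y :: "'b \<Rightarrow> 'a::field" and h :: 'a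
  assumes "finite J" "inj_on y J" "z \<notin> y ` J"
  shows "(\<Prod>j\<in>J. 1 - h / (z - y j)) = 1 - (\<Sum>l\<in>J. h / (z - y l) * (\<Prod>j\<in>J - {l}. 1 - h / (y l - y j)))"
  using assms
proof (induction J arbitrary: z rule: finite_induct)
  case (insert k J)
  define \<alpha> where "\<alpha> l = (\<Prod>j\<in>J - {l}. 1 - h / (y l - y j))" for l
  have IH: "(\<Prod>j\<in>J. 1 - h / (s - y j)) = 1 - (\<Sum>l\<in>J. h / (s - y l) * \<alpha> l)" if "s \<notin> y ` J" for s
    using insert.IH[OF _ that] insert.prems by (auto simp: \<alpha>_def)
  have k: "y k \<notin> y ` J" and t: "z \<notin> y ` J" "z \<noteq> y k"
    using insert.prems insert.hyps by auto
  have ins: "(\<Prod>j\<in>insert k J - {l}. 1 - h / (y l - y j)) = (1 - h / (y l - y k)) * \<alpha> l" if "l \<in> J" for l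
  proof -
    have "insert k J - {l} = insert k (J - {l})" using that insert.hyps by auto
    then show ?thesis using insert.hyps by (simp add: \<alpha>_def)
  qed
  have key: "h / (z - y k) * (h / (z - y l)) = h / (z - y l) * (h / (y l - y k)) + h / (z - y k) * (h / (y k - y l))"
    if "l \<in> J" for l
  proof -
    have "z - y k \<noteq> 0" "z - y l \<noteq> 0" using t that by auto
    moreover have "y l - y k \<noteq> 0" using k that by (metis image_eqI right_minus_eq)
    moreover have "h / (y k - y l) = - (h / (y l - y k))"
      by (metis minus_diff_eq minus_divide_right)
    ultimately show ?thesis by (simp add: divide_simps) (simp add: algebra_simps)
  qed
  have "(\<Sum>l\<in>insert k J. h / (z - y l) * (\<Prod>j\<in>insert k J - {l}. 1 - h / (y l - y j)))
     = h / (z - y k) * (\<Prod>j\<in>J. 1 - h / (y k - y j)) + (\<Sum>l\<in>J. h / (z - y l) * ((1 - h / (y l - y k)) * \<alpha> l))"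
    using insert.hyps by (simp add: ins)
  also have "(\<Prod>j\<in>J. 1 - h / (y k - y j)) = 1 - (\<Sum>l\<in>J. h / (y k - y l) * \<alpha> l)"
    by (rule IH[OF k])
  also have "h / (z - y k) * (1 - (\<Sum>l\<in>J. h / (y k - y l) * \<alpha> l)) + (\<Sum>l\<in>J. h / (z - y l) * ((1 - h / (y l - y k)) * \<alpha> l))
     = h / (z - y k) + (\<Sum>l\<in>J. h / (z - y l) * ((1 - h / (y l - y k)) * \<alpha> l) - h / (z - y k) * (h / (y k - y l) * \<alpha> l))"
    by (simp only: sum_subtractf right_diff_distrib sum_distrib_left) simp
  also have "(\<Sum>l\<in>J. h / (z - y l) * ((1 - h / (y l - y k)) * \<alpha> l) - h / (z - y k) * (h / (y k - y l) * \<alpha> l))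
     = (\<Sum>l\<in>J. (1 - h / (z - y k)) * (h / (z - y l) * \<alpha> l))"
  proof (rule sum.cong, rule refl)
    fix l assume "l \<in> J"
    from arg_cong[OF key[OF this], of "\<lambda>x. x * \<alpha> l"]
    show "h / (z - y l) * ((1 - h / (y l - y k)) * \<alpha> l) - h / (z - y k) * (h / (y k - y l) * \<alpha> l)
        = (1 - h / (z - y k)) * (h / (z - y l) * \<alpha> l)"
      by (simp only: algebra_simps)
  qed
  also have "\<dots> = (1 - h / (z - y k)) * (\<Sum>l\<in>J. h / (z - y l) * \<alpha> l)"
    by (simp only: sum_distrib_left)
  finally have "1 - (\<Sum>l\<in>insert k J. h / (z - y l) * (\<Prod>j\<in>insert k J - {l}. 1 - h / (y l - y j)))
     = (1 - h / (z - y k)) * (1 - (\<Sum>l\<in>J. h / (z - y l) * \<alpha> l))"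
    by (simp add: algebra_simps)
  then show ?case using insert.hyps IH[OF t(1)] by simp
qed auto

definition geom :: "real \<Rightarrow> real fps" where "geom y = Abs_fps (\<lambda>n. y ^ n)"

lemma geom_mult: "(1 - fps_const y * fps_X) * geom y = 1"
proof (rule fps_ext)
  fix n show "((1 - fps_const y * fps_X) * geom y) $ n = 1 $ n"
    by (cases n) (simp_all add: left_diff_distrib geom_def mult.assoc)
qed

text \<open>The preceding identity at z = 1/x in the field of fractions, where 1 - h/(1/x - y) = (1
  - (y + h) x) / (1 - y x), with denominators cleared.\<close>

lemma fps_partial_fraction:
  fixes y :: "nat \<Rightarrow> real" and h :: real
  assumes J: "finite J" "inj_on y J"
  shows "(\<Prod>j\<in>J. 1 - fps_const (y j + h) * fps_X) = (1 - fps_const h * (\<Sum>l\<in>J. fps_const (\<Prod>j\<in>J - {l}. 1 - h / (y l - y j)) * (fps_X * geom (y l))))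
     * (\<Prod>j\<in>J. 1 - fps_const (y j) * fps_X)"
proof -
  define i where "i x = (to_fract (fps_const x) :: real fps fract)" for x :: real
  define X where "X = (to_fract fps_X :: real fps fract)"
  define D where "D l = (to_fract (1 - fps_const (y l) * fps_X) :: real fps fract)" for l
  have i_hom: "i 0 = 0" "i 1 = 1" "i (a - b) = i a - i b" "i (a * b) = i a * i b" "i (a + b) = i a + i b" for a b
    by (simp_all add: i_def flip: to_fract_diff to_fract_mult to_fract_add)
  have i_eq: "i a = i b \<longleftrightarrow> a = b" for a b by (simp add: i_def)
  have i_div: "i (a / b) = i a / i b" for a b
  proof (cases "b = 0")
    case False
    then have "i (a / b) * i b = i a" by (simp flip: i_hom)
    moreover have "i b \<noteq> 0" using False i_eq[of b 0] by (simp add: i_hom)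
    ultimately show ?thesis by (simp add: field_simps)
  qed (simp add: i_hom)
  have i_prod: "i (prod f A) = (\<Prod>x\<in>A. i (f x))" for f :: "nat \<Rightarrow> real" and A
    by (induction A rule: infinite_finite_induct) (auto simp: i_hom)
  have t_prod: "to_fract (prod f A) = (\<Prod>x\<in>A. to_fract (f x))" for f :: "nat \<Rightarrow> real fps" and A
    by (induction A rule: infinite_finite_induct) auto
  have t_sum: "to_fract (sum f A) = (\<Sum>x\<in>A. to_fract (f x))" for f :: "nat \<Rightarrow> real fps" and A
    by (induction A rule: infinite_finite_induct) auto
  have X0: "X \<noteq> 0" by (simp add: X_def)
  have D0: "D l \<noteq> 0" for l
  proof -
    have "1 - fps_const (y l) * fps_X \<noteq> 0" using geom_mult[of "y l"] by auto
    then show ?thesis by (simp add: D_def del: to_fract_diff to_fract_1)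
  qed
  have zD: "1 / X - i (y l) = D l / X" for l
    using X0 by (simp add: D_def i_def X_def field_simps)
  have znot: "1 / X \<notin> (\<lambda>l. i (y l)) ` J"
  proof
    assume "1 / X \<in> (\<lambda>l. i (y l)) ` J"
    then obtain l where "1 / X = i (y l)" by auto
    then have "D l / X = 0" using zD[of l] by simp
    then show False using D0 X0 by simp
  qed
  have inj: "inj_on (\<lambda>l. i (y l)) J" using J(2) by (auto simp: inj_on_def i_eq)
  have g: "to_fract (geom (y l)) = 1 / D l" for l
    using arg_cong[OF geom_mult[of "y l"], of to_fract] D0[of l] by (simp add: D_def field_simps)
  have hD: "i h / (1 / X - i (y l)) = i h * (X / D l)" for l
    unfolding zD by simp
  have Dh: "to_fract (1 - fps_const (y l + h) * fps_X) = (1 - i h * (X / D l)) * D l" for l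
  proof -
    have "to_fract (1 - fps_const (y l + h) * fps_X) = D l - i h * X"
    proof -
      have "1 - fps_const (y l + h) * fps_X = (1 - fps_const (y l) * fps_X) - fps_const h * fps_X"
        by (simp add: algebra_simps flip: fps_const_add)
      then show ?thesis by (simp only: D_def i_def X_def to_fract_diff to_fract_mult)
    qed
    also have "\<dots> = (1 - i h * (X / D l)) * D l" using D0[of l] by (simp add: left_diff_distrib)
    finally show ?thesis .
  qed
  have w: "i (\<Prod>j\<in>J - {l}. 1 - h / (y l - y j)) = (\<Prod>j\<in>J - {l}. 1 - i h / (i (y l) - i (y j)))" for l
    by (simp add: i_prod i_hom i_div)
  have "to_fract (\<Prod>j\<in>J. 1 - fps_const (y j + h) * fps_X) = (\<Prod>j\<in>J. 1 - i h * (X / D j)) * (\<Prod>j\<in>J. D j)"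
    unfolding t_prod Dh by (simp only: prod.distrib)
  also have "(\<Prod>j\<in>J. 1 - i h * (X / D j)) = 1 - (\<Sum>l\<in>J. i h * (X / D l) * (\<Prod>j\<in>J - {l}. 1 - i h / (i (y l) - i (y j))))"
    using prod_one_minus_partial_fraction[OF J(1) inj znot, of "i h"] unfolding hD .
  also have "\<dots> = to_fract (1 - fps_const h * (\<Sum>l\<in>J. fps_const (\<Prod>j\<in>J - {l}. 1 - h / (y l - y j)) * (fps_X * geom (y l))))"
    unfolding w[symmetric] by (simp add: t_sum g sum_distrib_left mult_ac flip: i_def X_def)
  also have "(\<Prod>j\<in>J. D j) = to_fract (\<Prod>j\<in>J. 1 - fps_const (y j) * fps_X)"
    by (simp only: t_prod D_def)
  finally show ?thesis by (simp only: to_fract_mult[symmetric] to_fract_eq_iff)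
qed

lemma fps_deriv_prod_linear:
  assumes "finite J"
  shows "fps_deriv (\<Prod>j\<in>J. 1 - fps_const (y j) * fps_X) = - ((\<Prod>j\<in>J. 1 - fps_const (y j) * fps_X) * (\<Sum>j\<in>J. fps_const (y j) * geom (y j)))"
  using assms
proof (induction J rule: finite_induct)
  case (insert k J)
  define P where "P = (\<Prod>j\<in>J. 1 - fps_const (y j) * fps_X)"
  define s where "s = (\<Sum>j\<in>J. fps_const (y j) * geom (y j))"
  define L where "L = 1 - fps_const (y k) * fps_X"
  have L: "fps_deriv L = - fps_const (y k)" "L * geom (y k) = 1" by (simp_all add: L_def geom_mult)
  have "fps_deriv (L * P) = - fps_const (y k) * P + L * - (P * s)"
    using insert.IH by (simp add: L(1) P_def s_def)
  also have "\<dots> = - (L * P * (fps_const (y k) * geom (y k) + s))"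
  proof -
    have "L * P * (fps_const (y k) * geom (y k) + s) = fps_const (y k) * P * (L * geom (y k)) + L * P * s"
      by (simp only: algebra_simps)
    then show ?thesis by (simp add: L(2) algebra_simps del: fps_const_neg)
  qed
  finally show ?case using insert.hyps by (simp add: L_def P_def s_def)
qed simp

definition ppf :: "real \<Rightarrow> int list \<Rightarrow> real fps" where
  "ppf q l = 1 - fps_const q * mom_fps (PP_moment q l)"

text \<open>The logarithmic derivative of the product formula for \<open>ppf\<close>: the power sums
  of the scaled nodes minus those of the nodes shifted by q.\<close>

definition pgen :: "real \<Rightarrow> int list \<Rightarrow> real fps" where
  "pgen q l = Abs_fps (\<lambda>s. \<Sum>j<length l. (real_of_int (nodes l j) / real (length l)) ^ Suc s - ((real_of_int (nodes l j) + q) / real (length l)) ^ Suc s)"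

text \<open>With h = q/N the scaling cancels in 1 - h/(y_i - y_j), which leaves a factor of
  \<open>PP_weight\<close>. Partial fractions then give E = \<open>ppf q l\<close> D, and this is
  differentiated logarithmically.\<close>

lemma ppf_deriv:
  assumes l: "l \<in> signatures N" and N: "N > 0"
  shows "fps_deriv (ppf q l) = ppf q l * pgen q l"
proof -
  have len: "length l = N" using l by (simp add: signatures_def)
  define y where "y j = real_of_int (nodes l j) / real N" for j
  define h where "h = q / real N"
  define D where "D = (\<Prod>j<N. 1 - fps_const (y j) * fps_X)"
  define E where "E = (\<Prod>j<N. 1 - fps_const (y j + h) * fps_X)"
  define sD where "sD = (\<Sum>j<N. fps_const (y j) * geom (y j))"
  define sE where "sE = (\<Sum>j<N. fps_const (y j + h) * geom (y j + h))"
  have inj: "inj_on y {..<N}" using nodes_inj[OF l] N by (auto simp: inj_on_def y_def)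
  have wt: "(\<Prod>j\<in>{..<N} - {i}. 1 - h / (y i - y j)) = PP_weight q l i" if "i < N" for i
    unfolding PP_weight_def Let_def len
  proof (intro prod.cong refl)
    fix j assume j: "j \<in> {..<N} - {i}"
    then have ne: "nodes l i \<noteq> nodes l j" using nodes_inj[OF l] that by (auto simp: inj_on_def)
    have d: "(l ! i - int i) - (l ! j - int j) = nodes l i - nodes l j" by (simp add: nodes_def)
    have d': "y i - y j = real_of_int (nodes l i - nodes l j) / real N"
      by (simp add: y_def diff_divide_distrib)
    have "real_of_int (nodes l i - nodes l j) \<noteq> 0" using ne by simp
    then show "1 - h / (y i - y j) = (real_of_int ((l ! i - int i) - (l ! j - int j)) - q)
        / real_of_int ((l ! i - int i) - (l ! j - int j))"
      unfolding d d' h_def using N by (simp add: diff_divide_distrib del: of_int_diff)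
  qed
  have mom: "fps_const q * mom_fps (PP_moment q l)
     = fps_const h * (\<Sum>i<N. fps_const (\<Prod>j\<in>{..<N} - {i}. 1 - h / (y i - y j)) * (fps_X * geom (y i)))"
  proof (rule fps_ext)
    fix n
    show "(fps_const q * mom_fps (PP_moment q l)) $ n
      = (fps_const h * (\<Sum>i<N. fps_const (\<Prod>j\<in>{..<N} - {i}. 1 - h / (y i - y j)) * (fps_X * geom (y i)))) $ n"
    proof (cases n)
      case (Suc k)
      have "(\<Sum>i<N. (\<Prod>j\<in>{..<N} - {i}. 1 - h / (y i - y j)) * y i ^ k) = (\<Sum>i<N. PP_weight q l i * y i ^ k)"
        by (rule sum.cong) (auto simp: wt)
      then show ?thesis
        using Suc by (simp add: mom_fps_def PP_moment_def Let_def len geom_def fps_sum_nth h_def y_def nodes_def)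
    qed (simp add: mom_fps_def fps_sum_nth)
  qed
  have ED: "E = ppf q l * D"
    using fps_partial_fraction[OF _ inj, of h] by (simp add: E_def D_def ppf_def mom)
  have "fps_deriv (ppf q l) * D + ppf q l * - (D * sD) = - (ppf q l * D * sE)"
    using arg_cong[OF ED, of fps_deriv] fps_deriv_prod_linear[of "{..<N}" y] fps_deriv_prod_linear[of "{..<N}" "\<lambda>j. y j + h"] ED
    by (simp add: D_def[symmetric] E_def[symmetric] sD_def[symmetric] sE_def[symmetric])
  then have "fps_deriv (ppf q l) * D = ppf q l * (sD - sE) * D" by (simp add: algebra_simps add_eq_0_iff)
  moreover have "D \<noteq> 0"
  proof -
    have "D $ 0 = 1" unfolding D_def by (induction N) auto
    then show ?thesis by auto
  qed
  ultimately have "fps_deriv (ppf q l) = ppf q l * (sD - sE)" by simp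
  moreover have "sD - sE = pgen q l"
  proof (rule fps_ext)
    fix s
    show "(sD - sE) $ s = pgen q l $ s"
      by (simp add: sD_def sE_def pgen_def geom_def fps_sum_nth len y_def h_def sum_subtractf add_divide_distrib)
  qed
  ultimately show ?thesis by simp
qed

lemma ppf_0: "ppf q l $ 0 = 1"
  by (simp add: ppf_def mom_fps_def)

subsection \<open>Transfer from q = 1 to arbitrary q\<close>

definition psum :: "int list \<Rightarrow> nat \<Rightarrow> real" where
  "psum l s = (1 / real (length l)) * (\<Sum>j<length l. (real_of_int (nodes l j) / real (length l)) ^ s)"

text \<open>Binomial expansion of the shifted powers. The term r = 0 is proportional to
  \<open>psum l s\<close>; all others involve lower power sums and carry N^(-r).\<close>

lemma pgen_nth:
  assumes "length l > 0"
  shows "pgen q l $ s = - (\<Sum>r\<le>s. real (Suc s choose Suc r) * q ^ Suc r * ((1 / real (length l)) ^ r * psum l (s - r)))"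
proof -
  define N where "N = length l"
  define y where "y j = real_of_int (nodes l j) / real N" for j
  have N: "real N \<noteq> 0" using assms by (simp add: N_def)
  have "y j ^ Suc s - (y j + q / real N) ^ Suc s = - (\<Sum>r\<le>s. real (Suc s choose Suc r) * (q / real N) ^ Suc r * y j ^ (s - r))" for j
  proof -
    have "(y j + q / real N) ^ Suc s = (\<Sum>r\<le>Suc s. real (Suc s choose r) * (q / real N) ^ r * y j ^ (Suc s - r))"
      using binomial_ring[of "q / real N" "y j" "Suc s"] by (simp add: add.commute del: power_Suc binomial_Suc_Suc)
    also have "\<dots> = y j ^ Suc s + (\<Sum>r\<le>s. real (Suc s choose Suc r) * (q / real N) ^ Suc r * y j ^ (s - r))"
      by (simp add: sum.atMost_Suc_shift del: power_Suc binomial_Suc_Suc sum.atMost_Suc)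
    finally show ?thesis by simp
  qed
  then have "pgen q l $ s = - (\<Sum>j<N. \<Sum>r\<le>s. real (Suc s choose Suc r) * (q / real N) ^ Suc r * y j ^ (s - r))"
    by (simp add: pgen_def N_def[symmetric] y_def add_divide_distrib sum_negf[symmetric] del: power_Suc binomial_Suc_Suc)
  also have "(\<Sum>j<N. \<Sum>r\<le>s. real (Suc s choose Suc r) * (q / real N) ^ Suc r * y j ^ (s - r))
     = (\<Sum>r\<le>s. real (Suc s choose Suc r) * (q / real N) ^ Suc r * (\<Sum>j<N. y j ^ (s - r)))"
    by (subst sum.swap) (simp only: sum_distrib_left)
  also have "\<dots> = (\<Sum>r\<le>s. real (Suc s choose Suc r) * q ^ Suc r * ((1 / real N) ^ r * psum l (s - r)))"
    using N by (intro sum.cong refl) (simp add: psum_def N_def[symmetric] y_def power_divide del: binomial_Suc_Suc)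
  finally show ?thesis by (simp add: N_def)
qed

lemma PP_moment_0_eq_psum:
  assumes l: "l \<in> signatures N"
  shows "PP_moment 0 l k = psum l k"
proof -
  have len: "length l = N" using l by (simp add: signatures_def)
  have "PP_weight 0 l i = 1" if "i < N" for i
    unfolding PP_weight_def Let_def len
  proof (rule prod.neutral, rule ballI)
    fix j assume j: "j \<in> {..<N} - {i}"
    then have "nodes l i \<noteq> nodes l j" using nodes_inj[OF l] that by (auto simp: inj_on_def)
    moreover have d: "(l ! i - int i) - (l ! j - int j) = nodes l i - nodes l j" by (simp add: nodes_def)
    ultimately show "(real_of_int ((l ! i - int i) - (l ! j - int j)) - 0) / real_of_int ((l ! i - int i) - (l ! j - int j)) = 1"
      unfolding d by simp
  qed
  then show ?thesis by (simp add: PP_moment_def psum_def len nodes_def)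
qed

text \<open>A series with constant term 1 and its logarithmic derivative determine each other by
  triangular recursions, so coefficientwise convergence carries over;
  \<open>exp_coeffs_tendsto\<close> is the converse direction.\<close>

lemma log_deriv_coeffs_tendsto:
  fixes f g :: "nat \<Rightarrow> real fps"
  assumes ode: "\<And>n. fps_deriv (f n) = f n * g n" "fps_deriv F = F * G" and f0: "\<And>n. f n $ 0 = 1" "F $ 0 = 1"
    and lim: "\<And>i. (\<lambda>n. f n $ i) \<longlonglongrightarrow> F $ i"
  shows "(\<lambda>n. g n $ s) \<longlonglongrightarrow> G $ s"
proof (induction s rule: less_induct)
  case (less s)
  have eq: "g $ s = of_nat (Suc s) * f $ Suc s - (\<Sum>i\<in>{1..s}. f $ i * g $ (s - i))"
    if "fps_deriv f = f * g" "f $ 0 = 1" for f g :: "real fps"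
  proof -
    have "of_nat (Suc s) * f $ Suc s = (f * g) $ s" using that(1)[symmetric] by simp
    also have "\<dots> = f $ 0 * g $ s + (\<Sum>i\<in>{1..s}. f $ i * g $ (s - i))"
      unfolding fps_mult_nth by (simp add: sum.atLeast_Suc_atMost)
    finally show ?thesis using that(2) by simp
  qed
  show ?case unfolding eq[OF ode(1) f0(1)] eq[OF ode(2) f0(2)]
    by (intro tendsto_intros lim less) auto
qed

lemma exp_coeffs_tendsto:
  fixes f g :: "nat \<Rightarrow> real fps"
  assumes ode: "\<And>n. fps_deriv (f n) = f n * g n" "fps_deriv F = F * G" and f0: "\<And>n. f n $ 0 = 1" "F $ 0 = 1"
    and lim: "\<And>i. (\<lambda>n. g n $ i) \<longlonglongrightarrow> G $ i"
  shows "(\<lambda>n. f n $ s) \<longlonglongrightarrow> F $ s"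
proof (induction s rule: less_induct)
  case (less s)
  show ?case
  proof (cases s)
    case (Suc p)
    have eq: "f $ Suc p = (\<Sum>i\<in>{0..p}. f $ i * g $ (p - i)) / of_nat (Suc p)" if "fps_deriv f = f * g" for f g :: "real fps"
      using arg_cong[OF that, of "\<lambda>f. f $ p"] by (simp add: fps_mult_nth field_simps del: of_nat_Suc)
    show ?thesis unfolding Suc eq[OF ode(1)] eq[OF ode(2)]
      by (intro tendsto_intros lim less) (auto simp: Suc)
  qed (simp add: f0)
qed

context
  fixes N :: "nat \<Rightarrow> nat" and l :: "nat \<Rightarrow> int list"
  assumes l: "\<And>n. l n \<in> signatures (N n)" and N0: "\<And>n. N n > 0"
    and Ninf: "(\<lambda>n. 1 / real (N n)) \<longlonglongrightarrow> 0"
begin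

lemma len: "length (l n) = N n"
  using l[of n] by (simp add: signatures_def)

text \<open>The r = 0 term of \<open>pgen_nth\<close> is solved for the power sum; the remaining
  power sums converge by induction and are multiplied by vanishing powers of 1/N.\<close>

lemma psum_tendsto:
  assumes g: "\<And>s. (\<lambda>n. pgen 1 (l n) $ s) \<longlonglongrightarrow> G $ s"
  shows "(\<lambda>n. psum (l n) s) \<longlonglongrightarrow> - G $ s / real (Suc s)"
proof (induction s rule: less_induct)
  case (less s)
  have eq: "psum (l n) s = - (pgen 1 (l n) $ s + (\<Sum>r\<in>{1..s}. real (Suc s choose Suc r) * ((1 / real (N n)) ^ r * psum (l n) (s - r)))) / real (Suc s)" for n
  proof -
    have "pgen 1 (l n) $ s = - (\<Sum>r\<le>s. real (Suc s choose Suc r) * ((1 / real (N n)) ^ r * psum (l n) (s - r)))"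
      using pgen_nth[of "l n" 1 s] N0[of n] by (simp add: len del: binomial_Suc_Suc)
    also have "(\<Sum>r\<le>s. real (Suc s choose Suc r) * ((1 / real (N n)) ^ r * psum (l n) (s - r)))
       = real (Suc s) * psum (l n) s + (\<Sum>r\<in>{1..s}. real (Suc s choose Suc r) * ((1 / real (N n)) ^ r * psum (l n) (s - r)))"
      by (simp add: atMost_atLeast0 sum.atLeast_Suc_atMost del: binomial_Suc_Suc)
    finally show ?thesis by (simp add: field_simps del: binomial_Suc_Suc of_nat_Suc)
  qed
  have "(\<lambda>n. (1 / real (N n)) ^ r * psum (l n) (s - r)) \<longlonglongrightarrow> 0 ^ r * (- G $ (s - r) / real (Suc (s - r)))" if "r \<in> {1..s}" for r
    using that by (intro tendsto_mult tendsto_power Ninf less) auto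
  then have "(\<lambda>n. (1 / real (N n)) ^ r * psum (l n) (s - r)) \<longlonglongrightarrow> 0" if "r \<in> {1..s}" for r
    using that by (auto simp: power_0_left)
  then have "(\<lambda>n. \<Sum>r\<in>{1..s}. real (Suc s choose Suc r) * ((1 / real (N n)) ^ r * psum (l n) (s - r))) \<longlonglongrightarrow> (\<Sum>r\<in>{1..s}. real (Suc s choose Suc r) * 0)"
    by (intro tendsto_sum tendsto_mult tendsto_const)
  then have "(\<lambda>n. - (pgen 1 (l n) $ s + (\<Sum>r\<in>{1..s}. real (Suc s choose Suc r) * ((1 / real (N n)) ^ r * psum (l n) (s - r)))) / real (Suc s))
      \<longlonglongrightarrow> - (G $ s + (\<Sum>r\<in>{1..s}. real (Suc s choose Suc r) * 0)) / real (Suc s)"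
    by (intro tendsto_divide tendsto_minus tendsto_add g tendsto_const) simp_all
  then show ?case unfolding eq by simp
qed

text \<open>In the limit only the term r = 0 survives, and it is linear in q.\<close>

lemma pgen_tendsto:
  assumes g: "\<And>s. (\<lambda>n. pgen 1 (l n) $ s) \<longlonglongrightarrow> G $ s"
  shows "(\<lambda>n. pgen q (l n) $ s) \<longlonglongrightarrow> q * G $ s"
proof -
  have "(\<lambda>n. - (\<Sum>r\<le>s. real (Suc s choose Suc r) * q ^ Suc r * ((1 / real (N n)) ^ r * psum (l n) (s - r))))
     \<longlonglongrightarrow> - (\<Sum>r\<le>s. real (Suc s choose Suc r) * q ^ Suc r * (0 ^ r * (- G $ (s - r) / real (Suc (s - r)))))"
    by (intro tendsto_minus tendsto_sum tendsto_mult tendsto_const tendsto_power Ninf psum_tendsto[OF g])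
  moreover have "(\<Sum>r\<le>s. real (Suc s choose Suc r) * q ^ Suc r * (0 ^ r * (- G $ (s - r) / real (Suc (s - r))))) = - (q * G $ s)"
  proof -
    have "(\<Sum>r\<le>s. real (Suc s choose Suc r) * q ^ Suc r * (0 ^ r * (- G $ (s - r) / real (Suc (s - r)))))
       = (\<Sum>r\<in>{0}. real (Suc s choose Suc r) * q ^ Suc r * (0 ^ r * (- G $ (s - r) / real (Suc (s - r)))))"
      by (rule sum.mono_neutral_right) (auto simp: power_0_left)
    then show ?thesis by (simp del: of_nat_Suc)
  qed
  ultimately show ?thesis using pgen_nth[of "l _" q s] N0 by (simp add: len)
qed

text \<open>Multiplying the logarithmic derivative by q raises the limit to the power q: from (1 +
  w)^(-1) at q = 1 one gets (1 + w)^(-q), the generating series of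
  \<open>mu_moment a q\<close>.\<close>

lemma PP_moment_tendsto:
  assumes conv: "\<exists>r>0. \<forall>z::real. \<bar>z - 1\<bar> < r \<longrightarrow> summable (\<lambda>k. a k * (z - 1) ^ k / fact k)"
    and lim: "\<And>k. (\<lambda>n. PP_moment 1 (l n) k) \<longlonglongrightarrow> limit_moment a k"
  shows "(\<lambda>n. PP_moment q (l n) k) \<longlonglongrightarrow> mu_moment a q k"
proof -
  define G where "G = - (Bw a (- 1) * fps_deriv (wfps a))"
  have FG: "fps_deriv (Bw a (- c)) = Bw a (- c) * (fps_const c * G)" for c
    unfolding G_def by (subst Bw_deriv) (simp add: fps_const_neg[symmetric] del: fps_const_neg)
  have B0: "Bw a c $ 0 = 1" for c by (simp add: Bw_def)
  have mom: "(\<lambda>n. mom_fps (PP_moment 1 (l n)) $ i) \<longlonglongrightarrow> mom_fps (limit_moment a) $ i" for i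
    by (cases i) (auto simp: mom_fps_def intro: lim)
  have f1: "(\<lambda>n. ppf 1 (l n) $ i) \<longlonglongrightarrow> Bw a (- 1) $ i" for i
    unfolding ppf_def Bw_minus_1 by (auto intro!: tendsto_intros mom)
  have g1: "(\<lambda>n. pgen 1 (l n) $ s) \<longlonglongrightarrow> G $ s" for s
    by (rule log_deriv_coeffs_tendsto[OF ppf_deriv[OF l N0] _ ppf_0 B0 f1]) (use FG[of 1] in simp)
  show ?thesis
  proof (cases "q = 0")
    case True
    \<comment> \<open>For q = 0 the series \<open>ppf\<close> is constantly 1, so the moments are
      read off from the power sums instead; \<open>Hq 0\<close> is the logarithm, whose derivative
      along w is -G.\<close>
    have "fps_deriv (Hq 0 oo wfps a) = - G" by (simp add: Hq_compose_deriv G_def)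
    from arg_cong[OF this, of "\<lambda>f. f $ k"] have "mu_moment a 0 k = - G $ k / real (Suc k)"
      by (simp add: mu_moment_eq_Hq[OF conv] field_simps del: of_nat_Suc)
    then show ?thesis using psum_tendsto[OF g1, of k] True by (simp add: PP_moment_0_eq_psum[OF l])
  next
    case False
    have "(\<lambda>n. ppf q (l n) $ Suc k) \<longlonglongrightarrow> Bw a (- q) $ Suc k"
      by (rule exp_coeffs_tendsto[OF ppf_deriv[OF l N0] FG ppf_0 B0]) (use pgen_tendsto[OF g1] in simp)
    moreover have "Bw a (- q) = 1 - fps_const q * mom_fps (mu_moment a q)"
      unfolding Bw_def Hq_eq[of q, symmetric] mom_fps_mu[OF conv]
      by (simp add: fps_compose_sub_distrib fps_compose_mult_distrib wfps_0)
    ultimately have "(\<lambda>n. - q * PP_moment q (l n) k) \<longlonglongrightarrow> - q * mu_moment a q k"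
      by (simp add: ppf_def mom_fps_def)
    from tendsto_divide[OF this tendsto_const[of "- q"]] False show ?thesis by simp
  qed
qed

end

text \<open>Turns the statement on sequences into a uniform one: if every choice K = n, \<delta> =
  1/(n+1) failed, the counterexamples would form a sequence contradicting
  \<open>PP_moment_tendsto\<close>. The uniform form applies to a random signature.\<close>

lemma PP_moment_close:
  assumes conv: "\<exists>r>0. \<forall>z::real. \<bar>z - 1\<bar> < r \<longrightarrow> summable (\<lambda>k. a k * (z - 1) ^ k / fact k)" and "\<epsilon> > 0"
  shows "\<exists>K \<delta>. \<delta> > 0 \<and> (\<forall>N>K. \<forall>l\<in>signatures N. (\<forall>j\<le>K. \<bar>PP_moment 1 l j - limit_moment a j\<bar> \<le> \<delta>) \<longrightarrow>
      \<bar>PP_moment q l k - mu_moment a q k\<bar> \<le> \<epsilon>)"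
proof (rule ccontr)
  assume neg: "\<not> ?thesis"
  define bad where "bad n N l \<longleftrightarrow> N > n \<and> l \<in> signatures N \<and>
      (\<forall>j\<le>n. \<bar>PP_moment 1 l j - limit_moment a j\<bar> \<le> 1 / real (Suc n)) \<and> \<bar>PP_moment q l k - mu_moment a q k\<bar> > \<epsilon>" for n N l
  have "\<exists>N l. bad n N l" for n
  proof -
    have "1 / real (Suc n) > 0" by simp
    with neg have "\<not> (\<forall>N>n. \<forall>l\<in>signatures N. (\<forall>j\<le>n. \<bar>PP_moment 1 l j - limit_moment a j\<bar> \<le> 1 / real (Suc n)) \<longrightarrow>
      \<bar>PP_moment q l k - mu_moment a q k\<bar> \<le> \<epsilon>)" by blast
    then obtain N l where "N > n" "l \<in> signatures N" "\<forall>j\<le>n. \<bar>PP_moment 1 l j - limit_moment a j\<bar> \<le> 1 / real (Suc n)"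
      "\<not> \<bar>PP_moment q l k - mu_moment a q k\<bar> \<le> \<epsilon>" by blast
    then have "bad n N l" by (simp add: bad_def)
    then show ?thesis by blast
  qed
  then obtain N l where "\<And>n. bad n (N n) (l n)" by metis
  then have Nl: "\<And>n. N n > n" "\<And>n. l n \<in> signatures (N n)"
    "\<And>n j. j \<le> n \<Longrightarrow> \<bar>PP_moment 1 (l n) j - limit_moment a j\<bar> \<le> 1 / real (Suc n)"
    "\<And>n. \<bar>PP_moment q (l n) k - mu_moment a q k\<bar> > \<epsilon>"
    by (simp_all add: bad_def)
  have i0: "(\<lambda>n. 1 / real (Suc n)) \<longlonglongrightarrow> 0"
    using LIMSEQ_inverse_real_of_nat by (simp add: inverse_eq_divide)
  have "(\<lambda>n. 1 / real (N n)) \<longlonglongrightarrow> 0"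
  proof (rule tendsto_sandwich[OF _ _ tendsto_const i0])
    show "\<forall>\<^sub>F n in sequentially. 1 / real (N n) \<le> 1 / real (Suc n)"
    proof (intro always_eventually allI)
      fix n
      have "real (Suc n) \<le> real (N n)" using Nl(1)[of n] by simp
      then show "1 / real (N n) \<le> 1 / real (Suc n)" by (intro frac_le) auto
    qed
  qed auto
  moreover have "(\<lambda>n. PP_moment 1 (l n) j) \<longlonglongrightarrow> limit_moment a j" for j
  proof -
    have "(\<lambda>n. PP_moment 1 (l n) j - limit_moment a j) \<longlonglongrightarrow> 0"
    proof (rule Lim_null_comparison[OF _ i0])
      show "\<forall>\<^sub>F n in sequentially. norm (PP_moment 1 (l n) j - limit_moment a j) \<le> 1 / real (Suc n)"
        using eventually_ge_at_top[of j] by eventually_elim (use Nl(3) in auto)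
    qed
    then show ?thesis by (simp add: LIM_zero_iff)
  qed
  moreover have "N n > 0" for n using Nl(1)[of n] by simp
  ultimately have "(\<lambda>n. PP_moment q (l n) k) \<longlonglongrightarrow> mu_moment a q k"
    by (intro PP_moment_tendsto[of l N] Nl(2) conv)
  then have "\<forall>\<^sub>F n in sequentially. dist (PP_moment q (l n) k) (mu_moment a q k) < \<epsilon>"
    using \<open>\<epsilon> > 0\<close> by (rule tendstoD)
  from eventually_happens'[OF sequentially_bot this]
  obtain n where "dist (PP_moment q (l n) k) (mu_moment a q k) < \<epsilon>" by blast
  then show False using Nl(4)[of n] by (simp add: dist_real_def)
qed

subsection \<open>Weak limits and moments\<close>

text \<open>Powers of the truncated identity are bounded continuous test functions for weak
  convergence.\<close>

definition clamp :: "real \<Rightarrow> real \<Rightarrow> real" where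
  "clamp R t = max (- R) (min R t)"

lemma clamp_abs_le: "0 \<le> R \<Longrightarrow> \<bar>clamp R t\<bar> \<le> R" "0 \<le> R \<Longrightarrow> \<bar>clamp R t\<bar> \<le> \<bar>t\<bar>"
  by (auto simp: clamp_def)

lemma clamp_eq: "\<bar>t\<bar> \<le> R \<Longrightarrow> clamp R t = t"
  by (auto simp: clamp_def)

lemma clamp_cont: "isCont (\<lambda>t. clamp R t ^ k) x"
  unfolding clamp_def by (intro continuous_intros)

lemma clamp_power_le: "0 \<le> R \<Longrightarrow> \<bar>clamp R t ^ k\<bar> \<le> R ^ k"
  by (simp add: power_abs power_mono clamp_abs_le)

lemma clamp_even_le: "0 \<le> R \<Longrightarrow> clamp R t ^ (2 * j) \<le> t ^ (2 * j)"
  using power_mono[OF clamp_abs_le(2)[of R t], of "2 * j"] by (simp add: power_even_abs)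

text \<open>The difference vanishes up to R. Beyond R it is at most 2 |t|^k, and there |t|^(k+2) / R
  is at least 1; this particular exponent makes the bound an even moment.\<close>

lemma clamp_diff_le:
  assumes R: "1 \<le> R"
  shows "\<bar>t ^ k - clamp R t ^ k\<bar> \<le> 2 / R * t ^ (2 * (k + 1))"
proof (cases "\<bar>t\<bar> \<le> R")
  case True
  have "0 \<le> t ^ (2 * (k + 1))" by (rule zero_le_even_power) simp
  then show ?thesis using True R by (simp add: clamp_eq)
next
  case False
  have t1: "\<bar>t\<bar> \<ge> 1" "\<bar>t\<bar> > R" using R False by auto
  have "\<bar>t ^ k - clamp R t ^ k\<bar> \<le> \<bar>t\<bar> ^ k + \<bar>clamp R t\<bar> ^ k"
    using abs_triangle_ineq4[of "t ^ k" "clamp R t ^ k"] by (simp add: power_abs)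
  also have "\<dots> \<le> \<bar>t\<bar> ^ k + \<bar>t\<bar> ^ k"
    using R by (intro add_mono power_mono clamp_abs_le) auto
  also have "\<dots> = 2 * \<bar>t\<bar> ^ k * 1" by simp
  also have "\<dots> \<le> 2 * \<bar>t\<bar> ^ k * (\<bar>t\<bar> ^ (k + 2) / R)"
  proof (intro mult_left_mono)
    have "R \<le> \<bar>t\<bar> ^ 1" using t1 by simp
    also have "\<dots> \<le> \<bar>t\<bar> ^ (k + 2)" by (intro power_increasing) (use t1 in auto)
    finally show "1 \<le> \<bar>t\<bar> ^ (k + 2) / R" using R by (simp add: field_simps)
  qed auto
  also have "\<dots> = 2 / R * \<bar>t\<bar> ^ (2 * (k + 1))"
  proof -
    have "\<bar>t\<bar> ^ k * \<bar>t\<bar> ^ (k + 2) = \<bar>t\<bar> ^ (2 * (k + 1))"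
      unfolding power_add[symmetric] by (intro arg_cong[where f = "power \<bar>t\<bar>"]) simp
    then show ?thesis by (simp only: times_divide_eq_right times_divide_eq_left mult.assoc)
  qed
  also have "\<bar>t\<bar> ^ (2 * (k + 1)) = t ^ (2 * (k + 1))" by (simp add: power_even_abs)
  finally show ?thesis .
qed

lemma integral_clamp_diff_le:
  assumes "real_distribution M" and R: "1 \<le> R"
    and i: "integrable M (\<lambda>t. t ^ k)" "integrable M (\<lambda>t. t ^ (2 * (k + 1)))"
    and B: "(\<integral>t. t ^ (2 * (k + 1)) \<partial>M) \<le> B"
  shows "\<bar>(\<integral>t. t ^ k \<partial>M) - (\<integral>t. clamp R t ^ k \<partial>M)\<bar> \<le> 2 * B / R"
proof -
  interpret real_distribution M by fact
  have ic: "integrable M (\<lambda>t. clamp R t ^ k)"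
    by (rule integrable_const_bound[where B = "R ^ k"])
      (use R clamp_power_le in \<open>auto simp: clamp_def\<close>)
  have "\<bar>(\<integral>t. t ^ k \<partial>M) - (\<integral>t. clamp R t ^ k \<partial>M)\<bar> = \<bar>\<integral>t. t ^ k - clamp R t ^ k \<partial>M\<bar>"
    using i ic by simp
  also have "\<dots> \<le> (\<integral>t. 2 / R * t ^ (2 * (k + 1)) \<partial>M)"
    by (intro integral_abs_bound_integral Bochner_Integration.integrable_diff i ic integrable_mult_right) (rule clamp_diff_le[OF R])
  also have "\<dots> = 2 / R * (\<integral>t. t ^ (2 * (k + 1)) \<partial>M)" by simp
  also have "\<dots> \<le> 2 / R * B" using R B by (intro mult_left_mono) auto
  finally show ?thesis by simp
qed

lemma integrable_clamp:
  assumes "real_distribution M" "0 \<le> R"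
  shows "integrable M (\<lambda>t. clamp R t ^ k)"
proof -
  interpret real_distribution M by fact
  show ?thesis by (rule integrable_const_bound[where B = "R ^ k"]) (use assms clamp_power_le in \<open>auto simp: clamp_def\<close>)
qed

lemma weak_conv_integral_clamp:
  assumes rd: "\<And>n. real_distribution (M n)" and \<mu>: "real_distribution \<mu>" and wc: "weak_conv_m M \<mu>"
    and R: "0 \<le> R"
  shows "(\<lambda>n. \<integral>t. clamp R t ^ k \<partial>M n) \<longlonglongrightarrow> (\<integral>t. clamp R t ^ k \<partial>\<mu>)"
proof (rule weak_conv_imp_integral_bdd_continuous_conv[OF rd \<mu> wc clamp_cont])
  show "norm (clamp R x ^ k) \<le> R ^ k" for x using clamp_power_le[OF R] by simp
qed

lemma tight_bounded_second_moment:
  assumes rd: "\<And>n. real_distribution (M n)" and int: "\<And>n. integrable (M n) (\<lambda>t. t\<^sup>2)"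
    and B: "\<And>n. (\<integral>t. t\<^sup>2 \<partial>M n) \<le> B" and B0: "0 \<le> B"
  shows "tight M"
    unfolding tight_def
  proof (intro conjI allI impI rd)
    fix \<epsilon> :: real assume \<epsilon>: "\<epsilon> > 0"
    \<comment> \<open>Markov's inequality leaves mass at most B/R^2 outside; the added 1 makes the
      estimate strict and R positive also for B = 0.\<close>
    define R where "R = sqrt (B / \<epsilon>) + 1"
    have R: "R > 0" "B / R\<^sup>2 < \<epsilon>"
    proof -
      have s: "sqrt (B / \<epsilon>) \<ge> 0" using B0 \<epsilon> by simp
      then show "R > 0" unfolding R_def by linarith
      have "B / \<epsilon> = (sqrt (B / \<epsilon>))\<^sup>2" using B0 \<epsilon> by simp
      also have "\<dots> < R\<^sup>2" using s by (intro power_strict_mono) (auto simp: R_def)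
      finally show "B / R\<^sup>2 < \<epsilon>" using \<epsilon> \<open>R > 0\<close> by (simp add: field_simps)
    qed
    have "measure (M n) {- R<..R} > 1 - \<epsilon>" for n
    proof -
      interpret real_distribution "M n" by (rule rd)
      have "measure (M n) {x \<in> space (M n). R\<^sup>2 \<le> x\<^sup>2} \<le> (\<integral>x. x\<^sup>2 \<partial>M n) / R\<^sup>2"
        by (rule integral_Markov_inequality_measure[where A = "space (M n)"]) (use int[of n] R in auto)
      also have "\<dots> \<le> B / R\<^sup>2" using B[of n] by (intro divide_right_mono) auto
      finally have 1: "measure (M n) {x \<in> space (M n). R\<^sup>2 \<le> x\<^sup>2} < \<epsilon>" using R by simp
      have "space (M n) - {- R<..R} \<subseteq> {x \<in> space (M n). R\<^sup>2 \<le> x\<^sup>2}"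
        using R by (auto simp: abs_le_square_iff[symmetric])
      then have "measure (M n) (space (M n) - {- R<..R}) \<le> measure (M n) {x \<in> space (M n). R\<^sup>2 \<le> x\<^sup>2}"
        by (intro finite_measure_mono) auto
      then show ?thesis using 1 prob_compl[of "{- R<..R}"] by simp
    qed
    then show "\<exists>a b. a < b \<and> (\<forall>n. 1 - \<epsilon> < measure (M n) {a<..b})" using R(1) by (intro exI[of _ "- R"] exI[of _ R]) auto
  qed

text \<open>Truncated moments pass to the weak limit and keep the bound B; Fatou's lemma then
  removes the truncation. Evenness makes the integrands nonnegative.\<close>

lemma weak_limit_even_moment:
  assumes rd: "\<And>n. real_distribution (M n)" and \<mu>: "real_distribution \<mu>" and wc: "weak_conv_m M \<mu>"
    and int: "\<And>n. integrable (M n) (\<lambda>t. t ^ (2 * j))"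
    and B: "\<And>n. (\<integral>t. t ^ (2 * j) \<partial>M n) \<le> B" and B0: "0 \<le> B"
  shows "integrable \<mu> (\<lambda>t. t ^ (2 * j))" "(\<integral>t. t ^ (2 * j) \<partial>\<mu>) \<le> B"
proof -
  interpret \<mu>: real_distribution \<mu> by (rule \<mu>)
  have ev: "0 \<le> t ^ (2 * j)" for t :: real by (rule zero_le_even_power) simp
  have ceven: "(\<integral>t. clamp R t ^ (2 * j) \<partial>\<mu>) \<le> B" if "R \<ge> 0" for R
  proof (rule LIMSEQ_le_const2[OF weak_conv_integral_clamp[OF rd \<mu> wc that]], intro exI allI impI)
    fix n
    have "(\<integral>t. clamp R t ^ (2 * j) \<partial>M n) \<le> (\<integral>t. t ^ (2 * j) \<partial>M n)"
      by (rule integral_mono[OF integrable_clamp[OF rd that] int clamp_even_le[OF that]])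
    also have "\<dots> \<le> B" by (rule B)
    finally show "(\<integral>t. clamp R t ^ (2 * j) \<partial>M n) \<le> B" .
  qed
  have nn: "(\<integral>\<^sup>+t. ennreal (t ^ (2 * j)) \<partial>\<mu>) \<le> ennreal B"
  proof -
    have "ennreal (t ^ (2 * j)) = liminf (\<lambda>n. ennreal (clamp (real n) t ^ (2 * j)))" for t
    proof -
      have "\<forall>\<^sub>F n in sequentially. clamp (real n) t = t"
        using eventually_ge_at_top[of "nat \<lceil>\<bar>t\<bar>\<rceil>"] by eventually_elim (auto intro!: clamp_eq simp: nat_ceiling_le_eq)
      then have "(\<lambda>n. ennreal (clamp (real n) t ^ (2 * j))) \<longlonglongrightarrow> ennreal (t ^ (2 * j))"
        by (intro tendsto_eventually) (erule eventually_mono, simp)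
      then show ?thesis by (intro lim_imp_Liminf[symmetric]) auto
    qed
    then have "(\<integral>\<^sup>+t. ennreal (t ^ (2 * j)) \<partial>\<mu>) = (\<integral>\<^sup>+t. liminf (\<lambda>n. ennreal (clamp (real n) t ^ (2 * j))) \<partial>\<mu>)" by (rule nn_integral_cong)
    also have "\<dots> \<le> liminf (\<lambda>n. \<integral>\<^sup>+t. ennreal (clamp (real n) t ^ (2 * j)) \<partial>\<mu>)"
      by (rule nn_integral_liminf) (simp add: clamp_def)
    also have "\<dots> \<le> liminf (\<lambda>n :: nat. ennreal B)"
    proof (rule Liminf_mono, rule always_eventually, rule allI)
      fix n :: nat
      have "(\<integral>\<^sup>+t. ennreal (clamp (real n) t ^ (2 * j)) \<partial>\<mu>) = ennreal (\<integral>t. clamp (real n) t ^ (2 * j) \<partial>\<mu>)"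
        by (rule nn_integral_eq_integral[OF integrable_clamp[OF \<mu>]]) (simp_all add: ev)
      also have "\<dots> \<le> ennreal B" by (intro ennreal_leI ceven) simp
      finally show "(\<integral>\<^sup>+t. ennreal (clamp (real n) t ^ (2 * j)) \<partial>\<mu>) \<le> ennreal B" .
    qed
    also have "\<dots> = ennreal B" by (simp add: Liminf_const)
    finally show ?thesis .
  qed
  show inte: "integrable \<mu> (\<lambda>t. t ^ (2 * j))"
  proof (rule integrableI_bounded)
    have "(\<integral>\<^sup>+t. ennreal (norm (t ^ (2 * j))) \<partial>\<mu>) = (\<integral>\<^sup>+t. ennreal (t ^ (2 * j)) \<partial>\<mu>)"
      unfolding real_norm_def abs_of_nonneg[OF ev] ..
    also have "\<dots> < \<infinity>" using nn ennreal_less_top[of B] unfolding infinity_ennreal_def by (rule order.strict_trans1)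
    finally show "(\<integral>\<^sup>+t. ennreal (norm (t ^ (2 * j))) \<partial>\<mu>) < \<infinity>" .
  qed simp
  have "ennreal (\<integral>t. t ^ (2 * j) \<partial>\<mu>) = (\<integral>\<^sup>+t. ennreal (t ^ (2 * j)) \<partial>\<mu>)"
    by (rule nn_integral_eq_integral[OF inte, symmetric]) (simp only: ev AE_I2)
  also note nn
  finally show "(\<integral>t. t ^ (2 * j) \<partial>\<mu>) \<le> B" using B0 by (simp only: ennreal_le_iff)
qed

text \<open>Truncation at R costs at most 2C/R, uniformly along the sequence and also for the limit,
  where C bounds the moments of order 2(k+1). For fixed R weak convergence applies, and then R tends
  to infinity.\<close>

lemma weak_limit_moment:
  assumes rd: "\<And>n. real_distribution (M n)" and \<mu>: "real_distribution \<mu>" and wc: "weak_conv_m M \<mu>"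
    and int: "\<And>n k. integrable (M n) (\<lambda>t. t ^ k)"
    and B: "\<And>n k. (\<integral>t. t ^ k \<partial>M n) \<le> B k" and B0: "\<And>k. 0 \<le> B k"
    and lim: "(\<lambda>n. \<integral>t. t ^ k \<partial>M n) \<longlonglongrightarrow> m"
  shows "integrable \<mu> (\<lambda>t. t ^ k)" "(\<integral>t. t ^ k \<partial>\<mu>) = m"
proof -
  interpret \<mu>: real_distribution \<mu> by (rule \<mu>)
  note even = weak_limit_even_moment[OF rd \<mu> wc int B B0]
  show intk: "integrable \<mu> (\<lambda>t. t ^ k)"
  proof (rule Bochner_Integration.integrable_bound)
    show "integrable \<mu> (\<lambda>t. 1 + t ^ (2 * k))" using even(1)[of k] by simp
    have "\<bar>x\<bar> \<le> 1 + x\<^sup>2" for x :: real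
      using zero_le_power2[of "\<bar>x\<bar> - 1"] zero_le_power2[of x] by (simp add: power2_eq_square algebra_simps)
    then have "\<bar>t ^ k\<bar> \<le> 1 + (t ^ k)\<^sup>2" for t :: real .
    then have *: "\<bar>t ^ k\<bar> \<le> 1 + t ^ (2 * k)" for t :: real
      by (simp only: power_mult[symmetric] mult.commute[of k 2])
    show "AE t in \<mu>. norm (t ^ k) \<le> norm (1 + t ^ (2 * k))"
    proof (intro AE_I2)
      fix t :: real
      have "norm (t ^ k) \<le> 1 + t ^ (2 * k)" using *[of t] by simp
      also have "\<dots> \<le> norm (1 + t ^ (2 * k))" unfolding real_norm_def by (rule abs_ge_self)
      finally show "norm (t ^ k) \<le> norm (1 + t ^ (2 * k))" .
    qed
  qed simp
  define C where "C = B (2 * (k + 1))"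
  have le: "\<bar>m - (\<integral>t. t ^ k \<partial>\<mu>)\<bar> \<le> 4 * C / R" if R: "R \<ge> 1" for R
  proof -
    have l1: "(\<lambda>n. \<bar>(\<integral>t. t ^ k \<partial>M n) - (\<integral>t. clamp R t ^ k \<partial>M n)\<bar>) \<longlonglongrightarrow> \<bar>m - (\<integral>t. clamp R t ^ k \<partial>\<mu>)\<bar>"
    proof (intro tendsto_rabs tendsto_diff)
      show "(\<lambda>n. \<integral>t. t ^ k \<partial>M n) \<longlonglongrightarrow> m"
        by (rule lim)
      show "(\<lambda>n. \<integral>t. clamp R t ^ k \<partial>M n) \<longlonglongrightarrow> (\<integral>t. clamp R t ^ k \<partial>\<mu>)"
        by (rule weak_conv_integral_clamp[OF rd \<mu> wc]) (use R in simp)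
    qed
    have "\<bar>m - (\<integral>t. clamp R t ^ k \<partial>\<mu>)\<bar> \<le> 2 * C / R"
    proof (rule LIMSEQ_le_const2[OF l1], intro exI allI impI)
      fix n
      have "(\<integral>t. t ^ (2 * (k + 1)) \<partial>M n) \<le> C" unfolding C_def by (rule B)
      then show "\<bar>(\<integral>t. t ^ k \<partial>M n) - (\<integral>t. clamp R t ^ k \<partial>M n)\<bar> \<le> 2 * C / R"
        by (rule integral_clamp_diff_le[where M = "M n" and k = k and R = R and B = C, OF rd R int int])
    qed
    moreover have "\<bar>(\<integral>t. t ^ k \<partial>\<mu>) - (\<integral>t. clamp R t ^ k \<partial>\<mu>)\<bar> \<le> 2 * C / R"
      unfolding C_def by (rule integral_clamp_diff_le[where M = \<mu> and k = k and R = R and B = "B (2 * (k + 1))", OF \<mu> R intk even])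
    moreover have "4 * C / R = 2 * C / R + 2 * C / R" by simp
    ultimately show ?thesis by linarith
  qed
  have lim0: "(\<lambda>n. 4 * C * inverse (real (Suc n))) \<longlonglongrightarrow> 4 * C * 0"
    by (intro tendsto_mult tendsto_const LIMSEQ_inverse_real_of_nat)
  have "\<bar>m - (\<integral>t. t ^ k \<partial>\<mu>)\<bar> \<le> 4 * C * inverse (real (Suc n))" for n
    using le[of "real (Suc n)"] by (simp add: divide_inverse)
  then have ex: "\<exists>N. \<forall>n\<ge>N. \<bar>m - (\<integral>t. t ^ k \<partial>\<mu>)\<bar> \<le> 4 * C * inverse (real (Suc n))" by blast
  have "\<bar>m - (\<integral>t. t ^ k \<partial>\<mu>)\<bar> \<le> 4 * C * 0"
    by (rule LIMSEQ_le_const[OF lim0 ex])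
  then show "(\<integral>t. t ^ k \<partial>\<mu>) = m" by linarith
qed

text \<open>Bounded second moments give tightness. A weakly convergent subsequence is enough, as the
  moments converge along the full sequence.\<close>

lemma moment_limit_measure_exists:
  fixes p :: "nat \<Rightarrow> real pmf"
  assumes fin: "\<And>n. finite (set_pmf (p n))"
    and lim: "\<And>k. (\<lambda>n. measure_pmf.expectation (p n) (\<lambda>x. x ^ k)) \<longlonglongrightarrow> m k"
  shows "\<exists>\<mu>. prob_space \<mu> \<and> sets \<mu> = sets borel \<and> (\<forall>k. integrable \<mu> (\<lambda>t. t ^ k) \<and> (\<integral>t. t ^ k \<partial>\<mu>) = m k)"
proof -
  define M where "M n = distr (measure_pmf (p n)) borel (\<lambda>x. x)" for n
  have rd: "real_distribution (M n)" for n
    unfolding M_def by (rule prob_space.real_distribution_distr) (auto intro: prob_space_measure_pmf)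
  have int: "integrable (M n) (\<lambda>t. t ^ k)" for n k
    unfolding M_def by (subst integrable_distr_eq) (auto intro: integrable_measure_pmf_finite fin)
  have E: "(\<integral>t. t ^ k \<partial>M n) = measure_pmf.expectation (p n) (\<lambda>x. x ^ k)" for n k
    unfolding M_def by (subst integral_distr) auto
  have "\<exists>B. \<forall>n. \<bar>\<integral>t. t ^ k \<partial>M n\<bar> \<le> B" for k
    using convergent_imp_Bseq[OF convergentI[OF lim[of k]]] unfolding E Bseq_def by auto
  then obtain B where B: "\<And>k n. \<bar>\<integral>t. t ^ k \<partial>M n\<bar> \<le> B k" by metis
  have B0: "B k \<ge> 0" for k using B[of 0 k] by linarith
  have "tight M"
    by (rule tight_bounded_second_moment[OF rd int _ B0[of 2]]) (rule order.trans[OF abs_ge_self B])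
  then obtain r \<mu> where r: "strict_mono (r :: nat \<Rightarrow> nat)" and \<mu>: "real_distribution \<mu>" and wc: "weak_conv_m (M \<circ> r) \<mu>"
    using tight_imp_convergent_subsubsequence[OF _ strict_mono_id, of M] unfolding comp_id by metis
  interpret \<mu>: real_distribution \<mu> by (rule \<mu>)
  have B': "(\<integral>t. t ^ k \<partial>(M \<circ> r) n) \<le> B k" for n k unfolding o_def by (rule order.trans[OF abs_ge_self B])
  have rd': "real_distribution ((M \<circ> r) n)" for n unfolding o_def by (rule rd)
  have int': "integrable ((M \<circ> r) n) (\<lambda>t. t ^ k)" for n k unfolding o_def by (rule int)
  have lim': "(\<lambda>n. \<integral>t. t ^ k \<partial>(M \<circ> r) n) \<longlonglongrightarrow> m k" for k
    using LIMSEQ_subseq_LIMSEQ[OF lim[of k] r] unfolding E o_def .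
  note mom = weak_limit_moment[OF rd' \<mu> wc int' B' B0 lim']
  show ?thesis
    by (rule exI[of _ \<mu>], rule conjI[OF \<mu>.prob_space_axioms], rule conjI[OF \<mu>.events_eq_borel],
      rule allI, rule conjI[OF mom])
qed

subsection \<open>Convergence for arbitrary q\<close>

text \<open>The differences d are nonzero integers, so |d| is at least 1 and d - q does not have the
  sign opposite to d.\<close>

lemma PP_weight_nonneg:
  assumes l: "l \<in> signatures N" and "\<bar>q\<bar> \<le> 1" and i: "i < N"
  shows "0 \<le> PP_weight q l i"
proof -
  have len: "length l = N" using l by (simp add: signatures_def)
  show ?thesis
    unfolding PP_weight_def Let_def
  proof (rule prod_nonneg)
    fix j assume j: "j \<in> {..<length l} - {i}"
    define d where "d = (l ! i - int i) - (l ! j - int j)"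
    have "nodes l i \<noteq> nodes l j" using nodes_inj[of l N] l j i len by (auto simp: inj_on_def)
    then have "d \<noteq> 0" by (simp add: d_def nodes_def)
    then have "1 \<le> real_of_int d \<or> real_of_int d \<le> - 1" by linarith
    then show "0 \<le> (real_of_int ((l ! i - int i) - (l ! j - int j)) - q) / real_of_int ((l ! i - int i) - (l ! j - int j))"
      unfolding d_def[symmetric] using assms(2) by (auto simp: zero_le_divide_iff)
  qed
qed

text \<open>For q different from 0 this compares constant coefficients in \<open>ppf_deriv\<close>;
  for q = 0 all weights are 1.\<close>

lemma PP_moment_0:
  assumes l: "l \<in> signatures N" and N: "N > 0"
  shows "PP_moment q l 0 = 1"
proof (cases "q = 0")
  case True
  have len: "length l = N" using l by (simp add: signatures_def)
  show ?thesis using N unfolding True PP_moment_0_eq_psum[OF l] psum_def len by simp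
next
  case False
  have len: "length l = N" using l by (simp add: signatures_def)
  have "fps_deriv (ppf q l) $ 0 = (ppf q l * pgen q l) $ 0" by (simp only: ppf_deriv[OF l N])
  then have "ppf q l $ 1 = pgen q l $ 0" by (simp add: ppf_0)
  moreover have "ppf q l $ 1 = - q * PP_moment q l 0" by (simp add: ppf_def mom_fps_def)
  moreover have "pgen q l $ 0 = - q" using N by (simp add: pgen_def len diff_divide_distrib[symmetric] add_divide_distrib)
  ultimately show ?thesis using False by simp
qed

lemma PP_pmf_exists:
  assumes l: "l \<in> signatures N" and N: "N > 0" and q: "\<bar>q\<bar> \<le> 1"
  shows "\<exists>p :: real pmf. finite (set_pmf p) \<and> (\<forall>k. measure_pmf.expectation p (\<lambda>x. x ^ k) = PP_moment q l k)"
proof -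
  have len: "length l = N" using l by (simp add: signatures_def)
  define f where "f i = (if i < N then PP_weight q l i / real N else 0)" for i
  have f0: "0 \<le> f i" for i using PP_weight_nonneg[OF l q] by (simp add: f_def)
  have "(\<Sum>i<N. f i) = PP_moment q l 0" by (simp add: f_def PP_moment_def len sum_divide_distrib)
  then have f1: "(\<Sum>i<N. f i) = 1" by (simp only: PP_moment_0[OF l N])
  have "(\<integral>\<^sup>+i. ennreal (f i) \<partial>count_space UNIV) = (\<integral>\<^sup>+i. ennreal (f i) \<partial>count_space {..<N})"
    by (rule nn_integral_count_space_eq) (auto simp: f_def)
  also have "\<dots> = (\<Sum>i<N. ennreal (f i))" by (simp add: nn_integral_count_space_finite)
  also have "\<dots> = 1" using f0 f1 by (simp add: sum_ennreal)
  finally have fs: "(\<integral>\<^sup>+i. ennreal (f i) \<partial>count_space UNIV) = 1" .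
  define p0 where "p0 = embed_pmf f"
  have p0: "pmf p0 i = f i" for i unfolding p0_def by (rule pmf_embed_pmf[OF f0 fs])
  have sp0: "set_pmf p0 \<subseteq> {..<N}" by (auto simp: set_pmf_eq p0 f_def)
  define p where "p = map_pmf (\<lambda>i. real_of_int (nodes l i) / real N) p0"
  have "finite (set_pmf p)" unfolding p_def using finite_subset[OF sp0] by simp
  moreover have "measure_pmf.expectation p (\<lambda>x. x ^ k) = PP_moment q l k" for k
  proof -
    have "measure_pmf.expectation p (\<lambda>x. x ^ k) = (\<Sum>i<N. (real_of_int (nodes l i) / real N) ^ k * pmf p0 i)"
      unfolding p_def integral_map_pmf by (rule integral_measure_pmf_real) (use sp0 in auto)
    also have "\<dots> = PP_moment q l k"
      by (simp add: p0 f_def PP_moment_def len sum_distrib_left nodes_def mult_ac)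
    finally show ?thesis .
  qed
  ultimately show ?thesis by blast
qed

context
  fixes \<rho> :: "nat \<Rightarrow> int list pmf" and a :: "nat \<Rightarrow> real"
  assumes supp: "\<And>N. set_pmf (\<rho> N) \<subseteq> signatures N"
    and unif: "\<And>N. \<exists>\<epsilon>>0. uniform_limit {u. \<forall>i<N. cmod (u i - 1) < \<epsilon>}
                 (\<lambda>F u. \<Sum>l\<in>F. schur_term (\<rho> N) l u) (SGF (\<rho> N))
                 (finite_subsets_at_top UNIV)"
    and diag: "\<And>k i0. k \<ge> 1 \<Longrightarrow>
        (\<lambda>N. pdiffs (replicate k i0) (\<lambda>u. Ln (SGF (\<rho> N) u) / of_nat N) ones)
          \<longlonglongrightarrow> complex_of_real (a k)"
    and mixed: "\<And>is. card (set is) \<ge> 2 \<Longrightarrow>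
        (\<lambda>N. pdiffs is (\<lambda>u. Ln (SGF (\<rho> N) u) / of_nat N) ones) \<longlonglongrightarrow> 0"
    and conv: "\<exists>r>0. \<forall>z::real. \<bar>z - 1\<bar> < r \<longrightarrow> summable (\<lambda>k. a k * (z - 1) ^ k / fact k)"
begin

text \<open>Union bound: for large N a deviation at q on the support forces a deviation at q = 1 in
  one of finitely many moments, and each of those has vanishing probability.\<close>

lemma PP_moment_conv:
  assumes "\<epsilon> > 0"
  shows "(\<lambda>N. measure_pmf.prob (\<rho> N) {l. \<bar>PP_moment q l k - mu_moment a q k\<bar> > \<epsilon>}) \<longlonglongrightarrow> 0"
proof -
  obtain K \<delta> where \<delta>: "\<delta> > 0" and close: "\<And>N l. N > K \<Longrightarrow> l \<in> signatures N \<Longrightarrow>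
      (\<forall>j\<le>K. \<bar>PP_moment 1 l j - limit_moment a j\<bar> \<le> \<delta>) \<Longrightarrow> \<bar>PP_moment q l k - mu_moment a q k\<bar> \<le> \<epsilon>"
    using PP_moment_close[OF conv assms, of q k] by blast
  define A where "A j = {l. \<bar>PP_moment 1 l j - limit_moment a j\<bar> > \<delta>}" for j
  have "(\<lambda>N. \<Sum>j\<le>K. measure_pmf.prob (\<rho> N) (A j)) \<longlonglongrightarrow> (\<Sum>j\<le>K. 0)"
    unfolding A_def by (rule tendsto_sum) (rule PP1_moment_conv[OF supp unif diag mixed \<delta>])
  then have lim: "(\<lambda>N. \<Sum>j\<le>K. measure_pmf.prob (\<rho> N) (A j)) \<longlonglongrightarrow> 0" by simp
  show ?thesis
  proof (rule tendsto_sandwich[OF _ _ tendsto_const lim])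
    show "\<forall>\<^sub>F N in sequentially. 0 \<le> measure_pmf.prob (\<rho> N) {l. \<bar>PP_moment q l k - mu_moment a q k\<bar> > \<epsilon>}"
      by simp
    show "\<forall>\<^sub>F N in sequentially. measure_pmf.prob (\<rho> N) {l. \<bar>PP_moment q l k - mu_moment a q k\<bar> > \<epsilon>}
        \<le> (\<Sum>j\<le>K. measure_pmf.prob (\<rho> N) (A j))"
      using eventually_gt_at_top[of K]
    proof eventually_elim
      case (elim N)
      have "measure_pmf.prob (\<rho> N) {l. \<bar>PP_moment q l k - mu_moment a q k\<bar> > \<epsilon>}
          = measure_pmf.prob (\<rho> N) ({l. \<bar>PP_moment q l k - mu_moment a q k\<bar> > \<epsilon>} \<inter> set_pmf (\<rho> N))"
        by (rule measure_Int_set_pmf[symmetric])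
      also have "\<dots> \<le> measure_pmf.prob (\<rho> N) (\<Union>j\<le>K. A j)"
      proof (rule measure_pmf.finite_measure_mono)
        show "{l. \<bar>PP_moment q l k - mu_moment a q k\<bar> > \<epsilon>} \<inter> set_pmf (\<rho> N) \<subseteq> (\<Union>j\<le>K. A j)"
        proof
          fix l assume l: "l \<in> {l. \<bar>PP_moment q l k - mu_moment a q k\<bar> > \<epsilon>} \<inter> set_pmf (\<rho> N)"
          then have "l \<in> signatures N" using supp by blast
          from close[OF elim this] l have "\<not> (\<forall>j\<le>K. \<bar>PP_moment 1 l j - limit_moment a j\<bar> \<le> \<delta>)" by auto
          then show "l \<in> (\<Union>j\<le>K. A j)" by (auto simp: A_def not_le)
        qed
      qed simp
      also have "\<dots> \<le> (\<Sum>j\<le>K. measure_pmf.prob (\<rho> N) (A j))"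
        by (rule measure_pmf.finite_measure_subadditive_finite) auto
      finally show ?case .
    qed
  qed
qed

text \<open>Probabilistic method: once the probabilities of the n + 1 bad events sum to less than 1,
  some signature in the support avoids them all. This provides deterministic measures whose moments
  converge.\<close>

lemma exists_signature_close:
  "\<exists>N l. N > 0 \<and> l \<in> signatures N \<and> (\<forall>k\<le>n. \<bar>PP_moment q l k - mu_moment a q k\<bar> \<le> 1 / real (Suc n))"
proof -
  define A where "A k = {l. \<bar>PP_moment q l k - mu_moment a q k\<bar> > 1 / real (Suc n)}" for k
  have "(\<lambda>N. \<Sum>k\<le>n. measure_pmf.prob (\<rho> N) (A k)) \<longlonglongrightarrow> (\<Sum>k\<le>n. 0)"
    unfolding A_def by (rule tendsto_sum) (rule PP_moment_conv, simp)
  then have "(\<lambda>N. \<Sum>k\<le>n. measure_pmf.prob (\<rho> N) (A k)) \<longlonglongrightarrow> 0" by simp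
  from order_tendstoD(2)[OF this, of 1]
  have "\<forall>\<^sub>F N in sequentially. (\<Sum>k\<le>n. measure_pmf.prob (\<rho> N) (A k)) < 1 \<and> N > 0"
    by (intro eventually_conj eventually_gt_at_top) simp
  then obtain N where N: "(\<Sum>k\<le>n. measure_pmf.prob (\<rho> N) (A k)) < 1" "N > 0"
    using eventually_happens'[OF sequentially_bot] by blast
  have "measure_pmf.prob (\<rho> N) (\<Union>k\<le>n. A k) \<le> (\<Sum>k\<le>n. measure_pmf.prob (\<rho> N) (A k))"
    by (rule measure_pmf.finite_measure_subadditive_finite) auto
  then have "measure_pmf.prob (\<rho> N) (\<Union>k\<le>n. A k) \<noteq> 1" using N by simp
  then have "\<not> set_pmf (\<rho> N) \<subseteq> (\<Union>k\<le>n. A k)" by (auto simp: measure_pmf.prob_eq_1 AE_measure_pmf_iff)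
  then obtain l where "l \<in> set_pmf (\<rho> N)" "l \<notin> (\<Union>k\<le>n. A k)" by blast
  then show ?thesis using N(2) supp[of N] by (intro exI[of _ N] exI[of _ l]) (auto simp: A_def not_less)
qed

lemma limit_measure_exists:
  assumes q: "\<bar>q\<bar> \<le> 1"
  shows "\<exists>\<mu>. prob_space \<mu> \<and> sets \<mu> = sets borel \<and> (\<forall>k. integrable \<mu> (\<lambda>t. t ^ k) \<and> (\<integral>t. t ^ k \<partial>\<mu>) = mu_moment a q k)"
proof -
  have "\<exists>p :: real pmf. finite (set_pmf p) \<and>
      (\<forall>k\<le>n. \<bar>measure_pmf.expectation p (\<lambda>x. x ^ k) - mu_moment a q k\<bar> \<le> 1 / real (Suc n))" for n
  proof -
    obtain N l where *: "N > 0" "l \<in> signatures N" "\<forall>k\<le>n. \<bar>PP_moment q l k - mu_moment a q k\<bar> \<le> 1 / real (Suc n)"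
      using exists_signature_close[of n q] by blast
    obtain p :: "real pmf" where "finite (set_pmf p)" "\<And>k. measure_pmf.expectation p (\<lambda>x. x ^ k) = PP_moment q l k"
      using PP_pmf_exists[OF *(2,1) q] by blast
    then show ?thesis using *(3) by (intro exI[of _ p]) simp
  qed
  then obtain p :: "nat \<Rightarrow> real pmf" where fin: "\<And>n. finite (set_pmf (p n))"
    and p: "\<And>n k. k \<le> n \<Longrightarrow> \<bar>measure_pmf.expectation (p n) (\<lambda>x. x ^ k) - mu_moment a q k\<bar> \<le> 1 / real (Suc n)"
    by metis
  have "(\<lambda>n. measure_pmf.expectation (p n) (\<lambda>x. x ^ k)) \<longlonglongrightarrow> mu_moment a q k" for k
  proof (rule LIM_zero_cancel, rule Lim_null_comparison)
    show "\<forall>\<^sub>F n in sequentially. norm (measure_pmf.expectation (p n) (\<lambda>x. x ^ k) - mu_moment a q k) \<le> inverse (real (Suc n))"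
      using eventually_ge_at_top[of k] by eventually_elim (use p in \<open>simp add: inverse_eq_divide\<close>)
  qed (rule LIMSEQ_inverse_real_of_nat)
  then show ?thesis by (rule moment_limit_measure_exists[OF fin])
qed

end

theorem theorem1:
  fixes \<rho> :: "nat \<Rightarrow> int list pmf" and a :: "nat \<Rightarrow> real"
  assumes supp: "\<And>N. set_pmf (\<rho> N) \<subseteq> signatures N"
    and unif: "\<And>N. \<exists>\<epsilon>>0. uniform_limit {u. \<forall>i<N. cmod (u i - 1) < \<epsilon>}
                 (\<lambda>F u. \<Sum>l\<in>F. schur_term (\<rho> N) l u) (SGF (\<rho> N))
                 (finite_subsets_at_top UNIV)"
    and diag: "\<And>k i0. k \<ge> 1 \<Longrightarrow>
        (\<lambda>N. pdiffs (replicate k i0) (\<lambda>u. Ln (SGF (\<rho> N) u) / of_nat N) ones)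
          \<longlonglongrightarrow> complex_of_real (a k)"
    and mixed: "\<And>is. card (set is) \<ge> 2 \<Longrightarrow>
        (\<lambda>N. pdiffs is (\<lambda>u. Ln (SGF (\<rho> N) u) / of_nat N) ones) \<longlonglongrightarrow> 0"
    and conv: "\<exists>r>0. \<forall>z::real. \<bar>z - 1\<bar> < r \<longrightarrow> summable (\<lambda>k. a k * (z - 1) ^ k / fact k)"
  shows "(\<forall>q\<in>{-1..1::real}. \<exists>\<mu> :: real measure.
            prob_space \<mu> \<and> sets \<mu> = sets borel \<and>
            (\<forall>k. integrable \<mu> (\<lambda>t. t ^ k) \<and> (\<integral>t. t ^ k \<partial>\<mu>) = mu_moment a q k) \<and>
            (\<forall>k. \<forall>\<epsilon>>0. (\<lambda>N. measure_pmf.prob (\<rho> N)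
                {l. \<bar>PP_moment q l k - (\<integral>t. t ^ k \<partial>\<mu>)\<bar> > \<epsilon>}) \<longlonglongrightarrow> 0))
       \<and> (\<forall>q\<in>{-1..1::real}. \<forall>q'\<in>{-1..1::real}.
            PP_gen q (mu_moment a q) = PP_gen q' (mu_moment a q'))"
proof (intro conjI ballI)
  fix q :: real assume "q \<in> {-1..1}"
  then have "\<bar>q\<bar> \<le> 1" by auto
  from limit_measure_exists[OF supp unif diag mixed conv this]
  obtain \<mu> :: "real measure" where \<mu>: "prob_space \<mu>" "sets \<mu> = sets borel"
    "\<And>k. integrable \<mu> (\<lambda>t. t ^ k)" "\<And>k. (\<integral>t. t ^ k \<partial>\<mu>) = mu_moment a q k" by blast
  show "\<exists>\<mu> :: real measure. prob_space \<mu> \<and> sets \<mu> = sets borel \<and>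
      (\<forall>k. integrable \<mu> (\<lambda>t. t ^ k) \<and> (\<integral>t. t ^ k \<partial>\<mu>) = mu_moment a q k) \<and>
      (\<forall>k. \<forall>\<epsilon>>0. (\<lambda>N. measure_pmf.prob (\<rho> N)
          {l. \<bar>PP_moment q l k - (\<integral>t. t ^ k \<partial>\<mu>)\<bar> > \<epsilon>}) \<longlonglongrightarrow> 0)"
  proof (intro exI[of _ \<mu>] conjI allI impI)
    fix k and \<epsilon> :: real assume "\<epsilon> > 0"
    show "(\<lambda>N. measure_pmf.prob (\<rho> N) {l. \<bar>PP_moment q l k - (\<integral>t. t ^ k \<partial>\<mu>)\<bar> > \<epsilon>}) \<longlonglongrightarrow> 0"
      unfolding \<mu>(4) by (rule PP_moment_conv[OF supp unif diag mixed conv \<open>\<epsilon> > 0\<close>])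
  qed (rule \<mu>)+
next
  fix q q' :: real
  show "PP_gen q (mu_moment a q) = PP_gen q' (mu_moment a q')"
    \<comment> \<open>Both sides equal \<open>Bw a (- 1)\<close>, in which q no longer
      occurs.\<close>
    unfolding PP_gen_Hq[OF mom_fps_mu[OF conv]] ..
qed

end
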